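(* There exists an absolute constant $c_5>0$ such that the following holds for every $n\geq 2$. Let $K$ be a convex body in $\mathbb{R}^n$. If $K$ is in the minimal surface area, minimal mean width, isotropic, John's or Löwner's position, then $$|K|^{\frac{1}{n}}\,\int_{S^{n-1}}S(P_{\xi^{\perp}}(K))\,d\sigma(\xi)\geq c_5\,S(K).$$
   Context: A convex body in $\mathbb{R}^n$ is a compact convex set with non-empty interior; $K$ is centered if its barycenter is at the origin. $|\cdot|$ denotes volume, $\sigma$ is the rotationally invariant probability measure on the Euclidean unit sphere $S^{n-1}$, and $P_{\xi^{\perp}}$ is the orthogonal projection onto the hyperplane $\xi^{\perp}$. $S(A)$ is the surface area of a convex body $A$; $P_{\xi^\perp}(K)$ is regarded as a convex body in the $(n-1)$-dimensional Euclidean space $\xi^\perp$, and its surface area is taken there. In dimension $m$ one has $S(A)=mV((A,m-1),(B_2^m,1))$ (a mixed volume, $B_2^m$ the Euclidean unit ball); in particular the surface area of a segment in a one-dimensional space is $2$. The mean width of $K$ is $w(K)=\int_{S^{n-1}}h_K(\theta)\,d\sigma(\theta)$, where $h_K(y)=\max_{x\in K}\langle x,y\rangle$. Positions: $K$ is in the minimal surface area position if $S(K)\leq S(T(K))$ for every $T\in SL(n)$. $K$ is in the minimal mean width position if $w(K)\leq w(T(K))$ for every $T\in SL(n)$. $K$ is in the isotropic position if it is centered, has volume $1$, and there is a constant $L_K>0$ with $\int_K\langle x,\xi\rangle^2dx=L_K^2$ for every $\xi\in S^{n-1}$ (equivalently, $\int_K\|x\|_2^2dx\leq\int_{T(K)}\|x\|_2^2dx$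 for every $T\in SL(n)$). $K$ is in John's position if the ellipsoid of maximal volume inscribed in $K$ is a multiple of the Euclidean unit ball $B_2^n$. $K$ is in Löwner's position if the ellipsoid of minimal volume containing $K$ is a multiple of $B_2^n$. "Absolute constant" means a constant independent of $n$ and of $K$. *)

theory Defs
  imports
    "HOL-Analysis.Analysis"
    "Jordan_Normal_Form.Determinant"
begin

text \<open>
  The dimension is quantified inside the statement (the constant must not depend on it), so
  \<open>\<real>\<^sup>n\<close> is the carrier \<open>{x. \<forall>i\<ge>n. x i = 0}\<close> of the library space \<open>Euclidean_space n\<close>, a subset
  of \<open>nat \<Rightarrow> real\<close>. The Euclidean norm of \<open>x\<close> is \<open>L2_set x {..<n}\<close>.
\<close>

abbreviation rspace :: "nat \<Rightarrow> (nat \<Rightarrow> real) set" where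
  "rspace n \<equiv> topspace (Euclidean_space n)"

definition ip :: "nat \<Rightarrow> (nat \<Rightarrow> real) \<Rightarrow> (nat \<Rightarrow> real) \<Rightarrow> real" where
  "ip n x y = (\<Sum>i<n. x i * y i)"

definition eball :: "nat \<Rightarrow> real \<Rightarrow> (nat \<Rightarrow> real) set" where
  "eball n r = {x \<in> rspace n. L2_set x {..<n} \<le> r}"

definition usphere :: "nat \<Rightarrow> (nat \<Rightarrow> real) set" where
  "usphere n = {x \<in> rspace n. L2_set x {..<n} = 1}"

definition add_set :: "(nat \<Rightarrow> real) set \<Rightarrow> (nat \<Rightarrow> real) set \<Rightarrow> (nat \<Rightarrow> real) set" where
  "add_set A B = {\<lambda>i. a i + b i | a b. a \<in> A \<and> b \<in> B}"

definition convex_body :: "nat \<Rightarrow> (nat \<Rightarrow> real) set \<Rightarrow> bool" where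
  "convex_body n K \<longleftrightarrow>
     compactin (Euclidean_space n) K \<and>
     (\<forall>x\<in>K. \<forall>y\<in>K. \<forall>u\<in>{0..1}. (\<lambda>i. (1 - u) * x i + u * y i) \<in> K) \<and>
     Euclidean_space n interior_of K \<noteq> {}"

text \<open>
  Lebesgue measure on \<open>\<real>\<^sup>n\<close>, carried to \<open>nat \<Rightarrow> real\<close> from the product measure on
  \<open>{..<n} \<rightarrow>\<^sub>E \<real>\<close> by extending with zeros.
\<close>

definition lebn :: "nat \<Rightarrow> (nat \<Rightarrow> real) measure" where
  "lebn n = distr (Pi\<^sub>M {..<n} (\<lambda>_. lborel)) borel (\<lambda>x i. if i < n then x i else 0)"

definition vol :: "nat \<Rightarrow> (nat \<Rightarrow> real) set \<Rightarrow> real" where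
  "vol n A = measure (lebn n) A"

text \<open>
  The rotation invariant probability measure on the unit sphere, as the law of \<open>x / \<parallel>x\<parallel>\<close> for a
  uniformly distributed point \<open>x\<close> of the unit ball. The point \<open>0\<close>, where the quotient is \<open>0\<close>,
  is a null set for \<open>n \<ge> 1\<close>.
\<close>

definition sphere_measure :: "nat \<Rightarrow> (nat \<Rightarrow> real) measure" where
  "sphere_measure n =
     distr (uniform_measure (lebn n) (eball n 1)) borel (\<lambda>x i. x i / L2_set x {..<n})"

text \<open>
  Surface area in dimension \<open>m\<close> in the sense of Minkowski: the derivative at \<open>0+\<close> of
  \<open>\<epsilon> \<mapsto> |A + \<epsilon> B|\<close>, i.e. \<open>m\<close> times the mixed volume \<open>V(A,\<dots>,A,B)\<close> with \<open>m - 1\<close> entries \<open>A\<close> and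
  one entry the unit ball \<open>B\<close>. For a segment and \<open>m = 1\<close> it is 2.
\<close>

definition surface_area :: "nat \<Rightarrow> (nat \<Rightarrow> real) set \<Rightarrow> real" where
  "surface_area m A =
     Lim (at_right 0) (\<lambda>\<epsilon>. (vol m (add_set A (eball m \<epsilon>)) - vol m A) / \<epsilon>)"

definition hyperplane :: "nat \<Rightarrow> (nat \<Rightarrow> real) \<Rightarrow> (nat \<Rightarrow> real) set" where
  "hyperplane n \<xi> = {x \<in> rspace n. ip n x \<xi> = 0}"

text \<open>Orthogonal projection onto the hyperplane orthogonal to a unit vector \<open>\<xi>\<close>.\<close>

definition proj :: "nat \<Rightarrow> (nat \<Rightarrow> real) \<Rightarrow> (nat \<Rightarrow> real) \<Rightarrow> (nat \<Rightarrow> real)" where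
  "proj n \<xi> x = (\<lambda>i. x i - ip n x \<xi> * \<xi> i)"

text \<open>
  The Euclidean space \<open>\<xi>\<^sup>\<bottom>\<close> is identified with \<open>\<real>\<^sup>n\<^sup>-\<^sup>1\<close> by the coordinates with respect to an
  orthonormal basis \<open>b 0, \<dots>, b (n - 2)\<close>; the \<open>n - 1\<close> orthonormal vectors span \<open>\<xi>\<^sup>\<bottom>\<close> when
  \<open>\<xi> \<noteq> 0\<close>. Surface area does not depend on the basis.
\<close>

definition orthonormal_basis_perp ::
    "nat \<Rightarrow> (nat \<Rightarrow> real) \<Rightarrow> (nat \<Rightarrow> nat \<Rightarrow> real) \<Rightarrow> bool" where
  "orthonormal_basis_perp n \<xi> b \<longleftrightarrow>
     (\<forall>j<n - 1. b j \<in> hyperplane n \<xi>) \<and>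
     (\<forall>j<n - 1. \<forall>k<n - 1. ip n (b j) (b k) = (if j = k then 1 else 0))"

definition perp_coords :: "nat \<Rightarrow> (nat \<Rightarrow> real) \<Rightarrow> (nat \<Rightarrow> real) \<Rightarrow> (nat \<Rightarrow> real)" where
  "perp_coords n \<xi> x =
     (let b = (SOME b. orthonormal_basis_perp n \<xi> b)
      in (\<lambda>j. if j < n - 1 then ip n x (b j) else 0))"

definition surface_area_perp :: "nat \<Rightarrow> (nat \<Rightarrow> real) \<Rightarrow> (nat \<Rightarrow> real) set \<Rightarrow> real" where
  "surface_area_perp n \<xi> A = surface_area (n - 1) (perp_coords n \<xi> ` A)"

definition support_fun :: "nat \<Rightarrow> (nat \<Rightarrow> real) set \<Rightarrow> (nat \<Rightarrow> real) \<Rightarrow> real" where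
  "support_fun n K y = (SUP x\<in>K. ip n x y)"

definition mean_width :: "nat \<Rightarrow> (nat \<Rightarrow> real) set \<Rightarrow> real" where
  "mean_width n K = (LINT \<theta>:usphere n|sphere_measure n. support_fun n K \<theta>)"

definition lin :: "nat \<Rightarrow> real mat \<Rightarrow> (nat \<Rightarrow> real) \<Rightarrow> (nat \<Rightarrow> real)" where
  "lin n T x = (\<lambda>i. if i < n then \<Sum>j<n. T $$ (i, j) * x j else 0)"

definition SL :: "nat \<Rightarrow> real mat set" where
  "SL n = {T \<in> carrier_mat n n. Determinant.det T = 1}"

definition minimal_surface_area_position :: "nat \<Rightarrow> (nat \<Rightarrow> real) set \<Rightarrow> bool" where
  "minimal_surface_area_position n K \<longleftrightarrow>
     (\<forall>T\<in>SL n. surface_area n K \<le> surface_area n (lin n T ` K))"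

definition minimal_mean_width_position :: "nat \<Rightarrow> (nat \<Rightarrow> real) set \<Rightarrow> bool" where
  "minimal_mean_width_position n K \<longleftrightarrow>
     (\<forall>T\<in>SL n. mean_width n K \<le> mean_width n (lin n T ` K))"

definition barycenter :: "nat \<Rightarrow> (nat \<Rightarrow> real) set \<Rightarrow> (nat \<Rightarrow> real)" where
  "barycenter n K = (\<lambda>i. (LINT x:K|lebn n. x i) / vol n K)"

definition centered :: "nat \<Rightarrow> (nat \<Rightarrow> real) set \<Rightarrow> bool" where
  "centered n K \<longleftrightarrow> barycenter n K = (\<lambda>_. 0)"

definition isotropic_position :: "nat \<Rightarrow> (nat \<Rightarrow> real) set \<Rightarrow> bool" where
  "isotropic_position n K \<longleftrightarrow>
     centered n K \<and> vol n K = 1 \<and>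
     (\<exists>L>0. \<forall>\<xi>\<in>usphere n. (LINT x:K|lebn n. (ip n x \<xi>)\<^sup>2) = L\<^sup>2)"

text \<open>Ellipsoids are non-degenerate and may have any centre.\<close>

definition ellipsoid :: "nat \<Rightarrow> (nat \<Rightarrow> real) set \<Rightarrow> bool" where
  "ellipsoid n E \<longleftrightarrow>
     (\<exists>T\<in>carrier_mat n n. \<exists>a\<in>rspace n.
        Determinant.det T \<noteq> 0 \<and> E = add_set {a} (lin n T ` eball n 1))"

definition max_inscribed_ellipsoid ::
    "nat \<Rightarrow> (nat \<Rightarrow> real) set \<Rightarrow> (nat \<Rightarrow> real) set \<Rightarrow> bool" where
  "max_inscribed_ellipsoid n K E \<longleftrightarrow>
     ellipsoid n E \<and> E \<subseteq> K \<and> (\<forall>E'. ellipsoid n E' \<and> E' \<subseteq> K \<longrightarrow> vol n E' \<le> vol n E)"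

definition min_enclosing_ellipsoid ::
    "nat \<Rightarrow> (nat \<Rightarrow> real) set \<Rightarrow> (nat \<Rightarrow> real) set \<Rightarrow> bool" where
  "min_enclosing_ellipsoid n K E \<longleftrightarrow>
     ellipsoid n E \<and> K \<subseteq> E \<and> (\<forall>E'. ellipsoid n E' \<and> K \<subseteq> E' \<longrightarrow> vol n E \<le> vol n E')"

definition john_position :: "nat \<Rightarrow> (nat \<Rightarrow> real) set \<Rightarrow> bool" where
  "john_position n K \<longleftrightarrow> (\<exists>r>0. max_inscribed_ellipsoid n K (eball n r))"

definition loewner_position :: "nat \<Rightarrow> (nat \<Rightarrow> real) set \<Rightarrow> bool" where
  "loewner_position n K \<longleftrightarrow> (\<exists>r>0. min_enclosing_ellipsoid n K (eball n r))"

end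

theory Submission
  imports "HOL-Library.Function_Algebras" "HOL-Probability.Probability_Measure" Defs
begin

text \<open>
  Write \<open>m = n - 1\<close> and \<open>P\<^sub>\<xi>\<close> for the projection of \<open>K\<close> orthogonal to \<open>\<xi>\<close>. The isoperimetric inequality in
  dimension \<open>m\<close> gives \<open>S(P\<^sub>\<xi>) \<ge> 2 \<surd>m |P\<^sub>\<xi>|\<^bsup>1-1/m\<^esup>\<close>, and Cauchy's formula gives
  \<open>S(K) \<le> C \<surd>n \<integral>|P\<^sub>\<xi>| d\<sigma>\<close>. Hence the theorem follows as soon as all the factors \<open>|P\<^sub>\<xi>|\<^bsup>-1/m\<^esup>\<close> are at least
  \<open>c |K|\<^bsup>-1/n\<^esup>\<close>. Because of the \<open>m\<close>-th root, and since \<open>|P\<^sub>\<xi>| \<le> S(K)\<close>, this only needs a bound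
  \<open>S(K) \<le> C\<^sup>n |K|\<^bsup>1-1/n\<^esup>\<close> with an exponential constant, and each of the five positions easily yields
  such a crude bound, mostly because \<open>K\<close> contains a ball of radius \<open>C\<^sup>-\<^sup>n |K|\<^bsup>1/n\<^esup>\<close>.
\<close>

section \<open>Euclidean geometry in the coordinate spaces\<close>

text \<open>\<open>surface_area\<close> is a \<open>Lim\<close>, which means nothing before the
  limit is shown to exist. Log-concavity of the parallel volume, a consequence of Brunn--Minkowski,
  settles this; the same inequality with a ball as second body gives the isoperimetric bound.
  Projections enter through volumes too: |P| is half the growth of |K| when a segment
  [-\<xi>, \<xi>] is added, so Cauchy's bound becomes a Fubini comparison between thin shells of
  parallel bodies and such sums.

  The m-th root tames exponential factors because n/m \<le> 2, so that C^n becomes at most C^2.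
  Since S(K) \<le> n|K|/r when K contains a ball of radius r, it suffices that |K|^(1/n) \<le> 64^n
  r; the factor n is absorbed by 2^n, which is where 128 comes from. Each position is therefore only
  compared with a map or ellipsoid scaled along one axis, or tested in one direction at a time.
  Minimal surface area is the exception: the inradius bound is proved for a volume-preserving image
  of K, and minimality transfers only the bound on the surface area.\<close>

instantiation "fun" :: (type, real_vector) real_vector
begin

text \<open>Turns the whole function space into a real vector space, so that \<open>convex\<close>,
  \<open>convexD\<close> and vector algebra apply to points; each \<open>rspace n\<close> is then a
  subspace.\<close>

definition scaleR_fun :: "real \<Rightarrow> ('a \<Rightarrow> 'b) \<Rightarrow> 'a \<Rightarrow> 'b" where
  "scaleR_fun c f = (\<lambda>x. c *\<^sub>R f x)"

instance
  by standard (simp_all add: scaleR_fun_def fun_eq_iff scaleR_add_right scaleR_add_left)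

end

lemma scaleR_fun_apply [simp]: "(c *\<^sub>R f) x = c *\<^sub>R f x"
  by (simp add: scaleR_fun_def)

abbreviation nm :: "nat \<Rightarrow> (nat \<Rightarrow> real) \<Rightarrow> real" where
  "nm n x \<equiv> L2_set x {..<n}"

lemma rspace_iff: "x \<in> rspace n \<longleftrightarrow> (\<forall>i\<ge>n. x i = 0)"
  by (simp add: topspace_Euclidean_space)

lemma rspaceI: "(\<And>i. i \<ge> n \<Longrightarrow> x i = 0) \<Longrightarrow> x \<in> rspace n"
  by (simp add: rspace_iff)

lemma rspaceD: "x \<in> rspace n \<Longrightarrow> i \<ge> n \<Longrightarrow> x i = 0"
  by (simp add: rspace_iff)

lemma rspace_closure [simp, intro]:
  "0 \<in> rspace n"
  "x \<in> rspace n \<Longrightarrow> y \<in> rspace n \<Longrightarrow> x + y \<in> rspace n"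
  "x \<in> rspace n \<Longrightarrow> y \<in> rspace n \<Longrightarrow> x - y \<in> rspace n"
  "x \<in> rspace n \<Longrightarrow> - x \<in> rspace n"
  "x \<in> rspace n \<Longrightarrow> c *\<^sub>R x \<in> rspace n"
  by (auto simp: rspace_iff)

lemma rspace_sum: "(\<And>j. j \<in> J \<Longrightarrow> f j \<in> rspace n) \<Longrightarrow> sum f J \<in> rspace n"
  by (induction J rule: infinite_finite_induct) auto

lemma add_set_eq: "add_set A B = {a + b | a b. a \<in> A \<and> b \<in> B}"
  by (auto simp: add_set_def plus_fun_def)

lemma add_setI: "a \<in> A \<Longrightarrow> b \<in> B \<Longrightarrow> a + b \<in> add_set A B"
  by (auto simp: add_set_eq)

lemma add_setE: "x \<in> add_set A B \<Longrightarrow> (\<And>a b. x = a + b \<Longrightarrow> a \<in> A \<Longrightarrow> b \<in> B \<Longrightarrow> P) \<Longrightarrow> P"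
  by (auto simp: add_set_eq)

lemma add_set_image: "add_set A B = (\<lambda>(a, b). a + b) ` (A \<times> B)"
  by (auto simp: add_set_eq)

lemma add_set_mono: "A \<subseteq> A' \<Longrightarrow> B \<subseteq> B' \<Longrightarrow> add_set A B \<subseteq> add_set A' B'"
  unfolding add_set_eq by blast

lemma add_set_rspace: "A \<subseteq> rspace n \<Longrightarrow> B \<subseteq> rspace n \<Longrightarrow> add_set A B \<subseteq> rspace n"
  by (auto elim!: add_setE)

lemma convex_add_set: "convex A \<Longrightarrow> convex B \<Longrightarrow> convex (add_set A B)"
proof -
  have "add_set A B = (\<Union>x\<in>A. \<Union>y\<in>B. {x + y})" by (auto simp: add_set_eq)
  then show "convex A \<Longrightarrow> convex B \<Longrightarrow> convex (add_set A B)" by (simp add: convex_sums)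
qed

subsection \<open>Inner product and norm\<close>

lemma ip_add_left: "ip n (x + y) z = ip n x z + ip n y z"
  and ip_add_right: "ip n z (x + y) = ip n z x + ip n z y"
  and ip_diff_left: "ip n (x - y) z = ip n x z - ip n y z"
  and ip_diff_right: "ip n z (x - y) = ip n z x - ip n z y"
  and ip_scale_left: "ip n (c *\<^sub>R x) z = c * ip n x z"
  and ip_scale_right: "ip n z (c *\<^sub>R x) = c * ip n z x"
  and ip_minus_left: "ip n (- x) z = - ip n x z"
  and ip_minus_right: "ip n z (- x) = - ip n z x"
  by (simp_all add: ip_def algebra_simps sum.distrib sum_subtractf sum_distrib_left sum_negf)

lemma ip_zero [simp]: "ip n 0 x = 0" "ip n x 0 = 0"
  by (simp_all add: ip_def)

lemmas ip_simps = ip_add_left ip_add_right ip_diff_left ip_diff_right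
  ip_scale_left ip_scale_right ip_minus_left ip_minus_right

lemma ip_commute: "ip n x y = ip n y x"
  by (simp add: ip_def mult.commute)

lemma sum_fun_apply: "(sum f J) i = (\<Sum>j\<in>J. f j i)" for f :: "_ \<Rightarrow> nat \<Rightarrow> real"
  by (induction J rule: infinite_finite_induct) simp_all

lemma ip_sum_left: "ip n (sum f J) z = (\<Sum>j\<in>J. ip n (f j) z)"
proof -
  have "ip n (sum f J) z = (\<Sum>i<n. \<Sum>j\<in>J. f j i * z i)"
    by (simp add: ip_def sum_fun_apply sum_distrib_right)
  then show ?thesis by (simp add: ip_def sum.swap[of _ J])
qed

lemma ip_sum_right: "ip n z (sum f J) = (\<Sum>j\<in>J. ip n z (f j))"
  using ip_sum_left[of n f J z] by (simp add: ip_commute[of n z])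

lemma ip_self: "ip n x x = (nm n x)\<^sup>2"
  by (simp add: ip_def L2_set_def sum_nonneg power2_eq_square)

lemma ip_self_nonneg: "ip n x x \<ge> 0"
  by (simp add: ip_self)

lemma nm_eq_sqrt: "nm n x = sqrt (ip n x x)"
  by (simp add: ip_self)

lemma abs_ip_le: "\<bar>ip n x y\<bar> \<le> nm n x * nm n y"
proof -
  have "\<bar>ip n x y\<bar> \<le> (\<Sum>i<n. \<bar>x i\<bar> * \<bar>y i\<bar>)"
    unfolding ip_def by (rule order_trans[OF sum_abs]) (simp add: abs_mult)
  then show ?thesis using L2_set_mult_ineq[of x y "{..<n}"] by linarith
qed

lemma ip_le: "ip n x y \<le> nm n x * nm n y"
  using abs_ip_le[of n x y] by linarith

lemma nm_scale [simp]: "nm n (c *\<^sub>R x) = \<bar>c\<bar> * nm n x"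
  by (simp add: nm_eq_sqrt ip_simps real_sqrt_mult)

lemma nm_minus [simp]: "nm n (- x) = nm n x"
  by (simp add: nm_eq_sqrt ip_simps)

lemma nm_zero [simp]: "nm n 0 = 0"
  by (simp add: nm_eq_sqrt)

lemma nm_triangle: "nm n (x + y) \<le> nm n x + nm n y"
  using L2_set_triangle_ineq[of x y "{..<n}"] by (simp add: plus_fun_def)

lemma abs_le_nm: "i < n \<Longrightarrow> \<bar>x i\<bar> \<le> nm n x"
  unfolding L2_set_def by (rule real_le_rsqrt) (auto intro!: member_le_sum)

lemma nm_eq_0: "x \<in> rspace n \<Longrightarrow> nm n x = 0 \<longleftrightarrow> x = 0"
proof
  assume x: "x \<in> rspace n" "nm n x = 0"
  show "x = 0"
  proof
    fix i show "x i = 0 i" using abs_le_nm[of i n x] rspaceD[of x n i] x by (cases "i < n") auto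
  qed
qed simp

lemma nm_le_iff: "r \<ge> 0 \<Longrightarrow> nm n x \<le> r \<longleftrightarrow> ip n x x \<le> r\<^sup>2"
  by (simp add: ip_self abs_le_square_iff[symmetric])

lemma usphere_iff: "u \<in> usphere n \<longleftrightarrow> u \<in> rspace n \<and> nm n u = 1"
  by (simp add: usphere_def)

lemma usphere_ip: "u \<in> usphere n \<Longrightarrow> ip n u u = 1"
  by (simp add: usphere_iff ip_self)

lemma eball_iff: "x \<in> eball n r \<longleftrightarrow> x \<in> rspace n \<and> nm n x \<le> r"
  by (simp add: eball_def)

lemma scale_eball: "c > 0 \<Longrightarrow> (\<lambda>x. c *\<^sub>R x) ` eball n r = eball n (c * r)"
proof (intro equalityI subsetI)
  fix x assume c: "c > 0" and "x \<in> eball n (c * r)"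
  then have "(1/c) *\<^sub>R x \<in> eball n r" "x = c *\<^sub>R (1/c) *\<^sub>R x"
    by (auto simp: eball_iff field_simps)
  then show "x \<in> (\<lambda>x. c *\<^sub>R x) ` eball n r" by blast
qed (auto simp: eball_iff)

lemma eball_mono: "r \<le> s \<Longrightarrow> eball n r \<subseteq> eball n s"
  by (auto simp: eball_iff)

lemma convex_eball: "convex (eball n r)"
proof (rule convexI)
  fix x y and u v :: real assume *: "x \<in> eball n r" "y \<in> eball n r" "0 \<le> u" "0 \<le> v" "u + v = 1"
  have "nm n (u *\<^sub>R x + v *\<^sub>R y) \<le> u * nm n x + v * nm n y"
    using nm_triangle[of "u *\<^sub>R x" "v *\<^sub>R y" n] * by simp
  also have "\<dots> \<le> u * r + v * r" using * by (intro add_mono mult_left_mono) (auto simp: eball_iff)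
  also have "\<dots> = r" using * by (simp add: distrib_right[symmetric])
  finally show "u *\<^sub>R x + v *\<^sub>R y \<in> eball n r" using * by (auto simp: eball_iff)
qed

subsection \<open>Topology\<close>

lemma continuous_on_fun_apply: "continuous_on S f \<Longrightarrow> continuous_on S (\<lambda>x. (f x :: nat \<Rightarrow> real) i)"
  by (rule continuous_on_product_then_coordinatewise)

lemma continuous_on_ip:
  assumes "continuous_on S f" "continuous_on S g"
  shows "continuous_on S (\<lambda>x. ip n (f x) (g x))"
  unfolding ip_def
  by (rule continuous_on_sum, rule continuous_on_mult)
     (rule continuous_on_fun_apply, rule assms)+

lemma continuous_on_nm:
  assumes "continuous_on S f" shows "continuous_on S (\<lambda>x. nm n (f x))"
  unfolding nm_eq_sqrt by (intro continuous_on_real_sqrt continuous_on_ip assms)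

lemma continuous_on_fun_add:
  fixes f g :: "_ \<Rightarrow> nat \<Rightarrow> real"
  assumes "continuous_on S f" "continuous_on S g"
  shows "continuous_on S (\<lambda>x. f x + g x)"
  using continuous_on_add[OF assms[THEN continuous_on_fun_apply]]
  by (intro continuous_on_coordinatewise_then_product) simp

lemma continuous_on_fun_diff:
  fixes f g :: "_ \<Rightarrow> nat \<Rightarrow> real"
  assumes "continuous_on S f" "continuous_on S g"
  shows "continuous_on S (\<lambda>x. f x - g x)"
  using continuous_on_diff[OF assms[THEN continuous_on_fun_apply]]
  by (intro continuous_on_coordinatewise_then_product) simp

lemma continuous_on_fun_scale:
  fixes g :: "_ \<Rightarrow> nat \<Rightarrow> real"
  assumes "continuous_on S f" "continuous_on S g"
  shows "continuous_on S (\<lambda>x. f x *\<^sub>R g x)"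
  using continuous_on_mult[OF assms(1) continuous_on_fun_apply[OF assms(2)]]
  by (intro continuous_on_coordinatewise_then_product) simp

lemmas fun_cont = continuous_on_fun_add continuous_on_fun_diff continuous_on_fun_scale
  continuous_on_ip continuous_on_nm continuous_on_id continuous_on_const continuous_on_fst
  continuous_on_snd

lemma closed_rspace: "closed (rspace n)"
  using closedin_Euclidean_space_iff closedin_topspace by blast

lemma closed_eball: "closed (eball n r)"
proof -
  have "eball n r = rspace n \<inter> {x. nm n x \<le> r}" by (auto simp: eball_iff)
  then show ?thesis
    by (auto intro!: closed_Int closed_rspace closed_Collect_le fun_cont)
qed

text \<open>Compactness refers to the product topology on all coordinates at once, so this is
  Tychonoff's theorem; balls are compact as closed subsets of such boxes.\<close>

lemma compact_box: "compact {x::nat\<Rightarrow>real. \<forall>i. \<bar>x i\<bar> \<le> r}"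
proof -
  have eq: "{x::nat\<Rightarrow>real. \<forall>i. \<bar>x i\<bar> \<le> r} = PiE UNIV (\<lambda>_. {-r..r})"
    by (auto simp: PiE_def Pi_def abs_le_iff minus_le_iff)
  have "compactin (product_topology (\<lambda>i. euclidean) UNIV) (PiE UNIV (\<lambda>_::nat. {-r..r}))"
    by (subst compactin_PiE) (auto simp: compactin_euclidean_iff)
  then show ?thesis unfolding eq by (simp add: euclidean_product_topology compactin_euclidean_iff)
qed

lemma compact_eball: "compact (eball n r)"
proof -
  have "\<bar>x i\<bar> \<le> r" if "x \<in> eball n r" for x i
  proof (cases "i < n")
    case True then show ?thesis using abs_le_nm[of i n x] that by (auto simp: eball_iff)
  next
    case False then show ?thesis using that rspaceD[of x n i] L2_set_nonneg[of x "{..<n}"] by (auto simp: eball_iff simp del: L2_set_nonneg)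
  qed
  then have "eball n r = {x. \<forall>i. \<bar>x i\<bar> \<le> r} \<inter> eball n r" by auto
  then show ?thesis using compact_Int_closed[OF compact_box closed_eball] by metis
qed

lemma compact_usphere: "compact (usphere n)"
proof -
  have "usphere n = eball n 1 \<inter> {x. nm n x = 1}" by (auto simp: usphere_iff eball_iff)
  moreover have "closed {x. nm n x = 1}" by (intro closed_Collect_eq fun_cont)
  ultimately show ?thesis using compact_Int_closed[OF compact_eball] by metis
qed

lemma compact_add_set: "compact A \<Longrightarrow> compact B \<Longrightarrow> compact (add_set A B)"
  unfolding add_set_image
  by (intro compact_continuous_image compact_Times) (auto simp: case_prod_unfold intro!: fun_cont)

lemma compact_scale_image:
  "compact A \<Longrightarrow> compact ((\<lambda>x::nat\<Rightarrow>real. c *\<^sub>R x) ` A)"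
  by (intro compact_continuous_image fun_cont)

lemma eball_bounds:
  assumes "compact K" "K \<subseteq> rspace n"
  obtains R where "R > 0" "K \<subseteq> eball n R"
proof -
  have "compact (nm n ` K)" by (intro compact_continuous_image fun_cont assms)
  then obtain b where b: "\<And>x. x \<in> K \<Longrightarrow> norm (nm n x) \<le> b"
    using compact_imp_bounded[of "nm n ` K"] unfolding bounded_iff by auto
  have "K \<subseteq> eball n (\<bar>b\<bar> + 1)" using b assms by (fastforce simp: eball_iff)
  then show ?thesis using that[of "\<bar>b\<bar> + 1"] by auto
qed

lemma convex_body_imp:
  assumes "convex_body n K"
  shows "compact K" "K \<subseteq> rspace n" "convex K" "\<exists>a\<in>rspace n. \<exists>r>0. add_set {a} (eball n r) \<subseteq> K"
proof -
  have c: "compactin (Euclidean_space n) K" and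
    cv: "\<And>x y u. x\<in>K \<Longrightarrow> y\<in>K \<Longrightarrow> u\<in>{0..1} \<Longrightarrow> (\<lambda>i. (1 - u) * x i + u * y i) \<in> K" and
    i: "Euclidean_space n interior_of K \<noteq> {}"
    using assms unfolding convex_body_def by auto
  show "compact K" using c unfolding Euclidean_space_def compactin_subtopology
    by (simp add: euclidean_product_topology compactin_euclidean_iff)
  show sub: "K \<subseteq> rspace n" using compactin_subset_topspace[OF c] .
  show "convex K"
  proof (rule convexI)
    fix x y and u v :: real assume *: "x \<in> K" "y \<in> K" "0 \<le> u" "0 \<le> v" "u + v = 1"
    then have "u = 1 - v" "v \<in> {0..1}" by auto
    then show "u *\<^sub>R x + v *\<^sub>R y \<in> K" using cv[OF *(1,2), of v] by (simp add: plus_fun_def scaleR_fun_def)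
  qed
  obtain a where a: "a \<in> Euclidean_space n interior_of K" using i by auto
  then obtain T where T: "openin (Euclidean_space n) T" "a \<in> T" "T \<subseteq> K"
    by (auto simp: interior_of_def)
  then obtain W where W: "open W" "T = W \<inter> rspace n"
    unfolding Euclidean_space_def openin_subtopology
    by (auto simp: euclidean_product_topology)
  have ar: "a \<in> rspace n" using W T by auto
  have "openin (product_topology (\<lambda>i. euclidean) UNIV) W" using W(1) by (simp add: euclidean_product_topology)
  then obtain X where X: "a \<in> PiE UNIV X" "\<And>i. open (X i)" "PiE UNIV X \<subseteq> W"
    using product_topology_open_contains_basis[of "\<lambda>_. euclidean" UNIV W a] W T by auto
  have "\<exists>e>0. \<forall>y. dist y (a i) < e \<longrightarrow> y \<in> X i" for i
    using X(1) X(2)[of i] unfolding open_dist by (auto simp: PiE_def Pi_def)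
  then obtain e where e: "\<And>i. e i > 0" "\<And>i y. dist y (a i) < e i \<Longrightarrow> y \<in> X i" by metis
  \<comment> \<open>Within \<open>rspace n\<close> only the first n coordinates can move, so a
    minimum over \<open>{..<n}\<close> suffices. The 1 keeps the set nonempty for n = 0, and halving
    makes \<open>re\<close> strict.\<close>
  define r where "r = Min (insert 1 (e ` {..<n})) / 2"
  have rp: "r > 0" unfolding r_def using e(1) by (subst Min_gr_iff | simp)+
  have re: "r < e i" if "i < n" for i
  proof -
    have "Min (insert 1 (e ` {..<n})) \<le> e i" using that by (intro Min_le) auto
    then show ?thesis using e(1)[of i] rp unfolding r_def by linarith
  qed
  have "a + b \<in> K" if b: "b \<in> eball n r" for b
  proof -
    have "(a + b) i \<in> X i" for i
    proof (cases "i < n")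
      case True
      then have "\<bar>b i\<bar> < e i" using abs_le_nm[of i n b] re[of i] b by (auto simp: eball_iff)
      then show ?thesis using e(2)[of "(a+b) i" i] by (simp add: dist_real_def)
    next
      case False
      then have "(a + b) i = a i" using b rspaceD[of b n i] by (auto simp: eball_iff)
      then show ?thesis using X(1) by (auto simp: PiE_def Pi_def)
    qed
    then have "a + b \<in> W" using X(3) by auto
    then show ?thesis using W T ar b by (auto simp: eball_iff)
  qed
  then have "add_set {a} (eball n r) \<subseteq> K" by (auto elim!: add_setE)
  then show "\<exists>a\<in>rspace n. \<exists>r>0. add_set {a} (eball n r) \<subseteq> K" using ar rp by blast
qed

section \<open>Lebesgue measure on the coordinate spaces, by recursion on the dimension\<close>

lemma space_lebn [simp]: "space (lebn n) = UNIV"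
  by (simp add: lebn_def)

lemma sets_lebn [simp, measurable_cong]: "sets (lebn n) = sets borel"
  by (simp add: lebn_def)

lemma measurable_fun_apply [measurable (raw)]:
  "f \<in> borel_measurable M \<Longrightarrow> (\<lambda>x. (f x :: nat \<Rightarrow> real) i) \<in> borel_measurable M"
  by (rule measurable_product_then_coordinatewise)

lemma measurable_funI:
  "(\<And>i. (\<lambda>x. (f x :: nat \<Rightarrow> real) i) \<in> borel_measurable M) \<Longrightarrow> f \<in> borel_measurable M"
  by (rule measurable_coordinatewise_then_product)

lemma measurable_fun_add [measurable (raw)]:
  fixes f g :: "_ \<Rightarrow> nat \<Rightarrow> real"
  assumes [measurable]: "f \<in> borel_measurable M" "g \<in> borel_measurable M"
  shows "(\<lambda>x. f x + g x) \<in> borel_measurable M"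
  by (rule measurable_funI) simp

lemma measurable_fun_diff [measurable (raw)]:
  fixes f g :: "_ \<Rightarrow> nat \<Rightarrow> real"
  assumes [measurable]: "f \<in> borel_measurable M" "g \<in> borel_measurable M"
  shows "(\<lambda>x. f x - g x) \<in> borel_measurable M"
  by (rule measurable_funI) simp

lemma measurable_fun_uminus [measurable (raw)]:
  fixes f g :: "_ \<Rightarrow> nat \<Rightarrow> real"
  assumes [measurable]: "f \<in> borel_measurable M"
  shows "(\<lambda>x. - f x) \<in> borel_measurable M"
  by (rule measurable_funI) simp

lemma measurable_fun_scale [measurable (raw)]:
  fixes g :: "_ \<Rightarrow> nat \<Rightarrow> real"
  assumes [measurable]: "f \<in> borel_measurable M" "g \<in> borel_measurable M"
  shows "(\<lambda>x. f x *\<^sub>R g x) \<in> borel_measurable M"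
  by (rule measurable_funI) simp

lemma measurable_fun_upd [measurable (raw)]:
  fixes f :: "_ \<Rightarrow> nat \<Rightarrow> real"
  assumes [measurable]: "f \<in> borel_measurable M" "g \<in> borel_measurable M"
  shows "(\<lambda>x. (f x)(m := g x)) \<in> borel_measurable M"
  by (rule measurable_funI) simp

lemma measurable_ip [measurable (raw)]:
  assumes [measurable]: "f \<in> borel_measurable M" "g \<in> borel_measurable M"
  shows "(\<lambda>x. ip n (f x) (g x)) \<in> borel_measurable M"
  unfolding ip_def by simp

lemma measurable_nm [measurable (raw)]:
  assumes [measurable]: "f \<in> borel_measurable M"
  shows "(\<lambda>x. nm n (f x)) \<in> borel_measurable M"
  unfolding nm_eq_sqrt by simp

lemma sets_rspace [measurable]: "rspace n \<in> sets borel"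
  by (intro borel_closed closed_rspace)

lemma sets_eball [measurable]: "eball n r \<in> sets borel"
  by (intro borel_closed closed_eball)

lemma sets_usphere [measurable]: "usphere n \<in> sets borel"
  by (intro borel_closed compact_imp_closed compact_usphere)

lemma measurable_extend_zero:
  fixes n :: nat
  shows "(\<lambda>x i. if i < n then x i else 0) \<in> measurable (Pi\<^sub>M {..<n} (\<lambda>_. lborel :: real measure)) borel"
proof (rule measurable_funI)
  fix i
  have "(\<lambda>x. x i) \<in> measurable (Pi\<^sub>M {..<n} (\<lambda>_. lborel :: real measure)) lborel" if "i < n"
    by (rule measurable_component_singleton) (use that in auto)
  then show "(\<lambda>x. if i < n then x i else 0) \<in> borel_measurable (Pi\<^sub>M {..<n} (\<lambda>_. lborel :: real measure))"
    by (cases "i < n") auto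
qed

lemma AE_rspace: "AE x in lebn n. x \<in> rspace n"
proof -
  have "{x \<in> space borel. x \<in> rspace n} \<in> sets borel" using sets_rspace[of n] by (simp add: Collect_mem_eq)
  then show ?thesis unfolding lebn_def by (subst AE_distr_iff[OF measurable_extend_zero]) (auto simp: rspace_iff)
qed

lemma nn_integral_lebn_0:
  assumes [measurable]: "f \<in> borel_measurable borel"
  shows "(\<integral>\<^sup>+x. f x \<partial>lebn 0) = f 0"
proof -
  interpret product_sigma_finite "\<lambda>_::nat. lborel :: real measure" ..
  have "(\<integral>\<^sup>+x. f x \<partial>lebn 0) = (\<integral>\<^sup>+x. f (\<lambda>i. if i < 0 then x i else 0) \<partial>Pi\<^sub>M {..<0} (\<lambda>_. lborel :: real measure))"
    unfolding lebn_def by (rule nn_integral_distr[OF measurable_extend_zero]) simp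
  then show ?thesis by (simp add: PiM_empty zero_fun_def)
qed

text \<open>The recursion behind the inductions on the dimension: because points are extended by
  zeros, adding the last coordinate is a single function update.\<close>

lemma nn_integral_lebn_Suc:
  assumes [measurable]: "f \<in> borel_measurable borel"
  shows "(\<integral>\<^sup>+x. f x \<partial>lebn (Suc m)) = (\<integral>\<^sup>+y. (\<integral>\<^sup>+t. f (y(m := t)) \<partial>lborel) \<partial>lebn m)"
proof -
  interpret product_sigma_finite "\<lambda>_::nat. lborel :: real measure" ..
  let ?e = "\<lambda>(n::nat) x i. if i < n then x i else (0::real)"
  have [measurable]: "?e n \<in> measurable (Pi\<^sub>M {..<n} (\<lambda>_. lborel :: real measure)) borel" for n :: nat
    by (rule measurable_extend_zero)
  have ins: "{..<Suc m} = insert m {..<m}" by auto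
  have eq: "?e (Suc m) (x(m := t)) = (?e m x)(m := t)" for x t
    by (auto simp: fun_eq_iff)
  have "(\<integral>\<^sup>+x. f x \<partial>lebn (Suc m)) = (\<integral>\<^sup>+x. f (?e (Suc m) x) \<partial>Pi\<^sub>M {..<Suc m} (\<lambda>_. lborel :: real measure))"
    unfolding lebn_def by (rule nn_integral_distr[OF measurable_extend_zero]) simp
  also have "\<dots> = (\<integral>\<^sup>+x. \<integral>\<^sup>+t. f (?e (Suc m) (x(m := t))) \<partial>lborel \<partial>Pi\<^sub>M {..<m} (\<lambda>_. lborel :: real measure))"
    unfolding ins
    by (rule product_nn_integral_insert) (auto simp: ins[symmetric])
  also have "\<dots> = (\<integral>\<^sup>+y. (\<integral>\<^sup>+t. f (y(m := t)) \<partial>lborel) \<partial>lebn m)"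
    unfolding lebn_def eq by (rule nn_integral_distr[symmetric, OF measurable_extend_zero]) measurable
  finally show ?thesis .
qed

lemma emeasure_lebn_Suc:
  assumes [measurable]: "A \<in> sets borel"
  shows "emeasure (lebn (Suc m)) A = (\<integral>\<^sup>+y. emeasure lborel {t. y(m := t) \<in> A} \<partial>lebn m)"
proof -
  have "emeasure (lebn (Suc m)) A = (\<integral>\<^sup>+x. indicator A x \<partial>lebn (Suc m))" by simp
  also have "\<dots> = (\<integral>\<^sup>+y. (\<integral>\<^sup>+t. indicator A (y(m := t)) \<partial>lborel) \<partial>lebn m)"
    by (rule nn_integral_lebn_Suc) simp
  also have "\<dots> = (\<integral>\<^sup>+y. emeasure lborel {t. y(m := t) \<in> A} \<partial>lebn m)"
  proof (rule nn_integral_cong)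
    fix y :: "nat \<Rightarrow> real"
    have [measurable]: "{t. y(m := t) \<in> A} \<in> sets lborel" by measurable
    have "(\<integral>\<^sup>+t. indicator A (y(m := t)) \<partial>lborel) = (\<integral>\<^sup>+t. indicator {t. y(m := t) \<in> A} t \<partial>lborel)"
      by (intro nn_integral_cong) (simp add: indicator_def)
    then show "(\<integral>\<^sup>+t. indicator A (y(m := t)) \<partial>lborel) = emeasure lborel {t. y(m := t) \<in> A}" by simp
  qed
  finally show ?thesis .
qed

lemma sigma_finite_lebn: "sigma_finite_measure (lebn n)"
proof
  interpret finite_product_sigma_finite "\<lambda>_::nat. lborel :: real measure" "{..<n}" by standard auto
  let ?C = "\<lambda>k::nat. {x::nat\<Rightarrow>real. \<forall>i<n. \<bar>x i\<bar> \<le> real k}"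
  have [measurable]: "?C k \<in> sets borel" for k by measurable
  have "emeasure (lebn n) (?C k) \<noteq> \<infinity>" for k
  proof -
    have "emeasure (lebn n) (?C k) = emeasure (Pi\<^sub>M {..<n} (\<lambda>_. lborel :: real measure))
       ((\<lambda>x i. if i < n then x i else 0) -` ?C k \<inter> space (Pi\<^sub>M {..<n} (\<lambda>_. lborel :: real measure)))"
      unfolding lebn_def by (rule emeasure_distr[OF measurable_extend_zero]) simp
    also have "(\<lambda>x i. if i < n then x i else 0) -` ?C k \<inter> space (Pi\<^sub>M {..<n} (\<lambda>_. lborel :: real measure))
       = PiE {..<n} (\<lambda>_. {- real k .. real k})"
      by (auto simp: space_PiM PiE_def Pi_def abs_le_iff minus_le_iff)
    finally show ?thesis by (simp add: measure_times emeasure_lborel_Icc_eq ennreal_power[symmetric] ennreal_mult_eq_top_iff power_eq_top_ennreal)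
  qed
  then show "\<exists>A. countable A \<and> A \<subseteq> sets (lebn n) \<and> \<Union> A = space (lebn n) \<and> (\<forall>a\<in>A. emeasure (lebn n) a \<noteq> \<infinity>)"
  proof (intro exI[of _ "range ?C"] conjI)
    show "\<Union> (range ?C) = space (lebn n)"
    proof -
      have "\<exists>k::nat. \<forall>i<n. \<bar>x i\<bar> \<le> real k" for x :: "nat \<Rightarrow> real"
      proof -
        obtain k :: nat where "Max (insert 0 ((\<lambda>i. \<bar>x i\<bar>) ` {..<n})) \<le> real k" using real_arch_simple by blast
        then show ?thesis by (intro exI[of _ k]) auto
      qed
      then show ?thesis by auto
    qed
  qed auto
qed

interpretation lebn: sigma_finite_measure "lebn n" for n by (rule sigma_finite_lebn)

lemma pair_lebn: "pair_sigma_finite (lebn n) (lebn m)"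
  by (simp add: pair_sigma_finite_def sigma_finite_lebn)

lemma nn_integral_lebn_translate:
  assumes [measurable]: "f \<in> borel_measurable borel" and "a \<in> rspace n"
  shows "(\<integral>\<^sup>+x. f (x + a) \<partial>lebn n) = (\<integral>\<^sup>+x. f x \<partial>lebn n)"
  using assms
proof (induction n arbitrary: f a)
  case 0
  then have "a = 0" by (auto simp: rspace_iff fun_eq_iff)
  then show ?case by simp
next
  case (Suc m)
  note [measurable] = Suc.prems(1)
  let ?a = "a(m := 0)"
  have a': "?a \<in> rspace m" using Suc.prems(2) by (auto simp: rspace_iff)
  have eq: "y(m := t) + a = (y + ?a)(m := a m + 1 * t)" for y t by (auto simp: fun_eq_iff)
  have "(\<integral>\<^sup>+x. f (x + a) \<partial>lebn (Suc m)) = (\<integral>\<^sup>+y. (\<integral>\<^sup>+t. f ((y + ?a)(m := a m + 1 * t)) \<partial>lborel) \<partial>lebn m)"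
    unfolding eq[symmetric] by (rule nn_integral_lebn_Suc) simp
  also have "\<dots> = (\<integral>\<^sup>+y. (\<integral>\<^sup>+t. f ((y + ?a)(m := t)) \<partial>lborel) \<partial>lebn m)"
  proof (rule nn_integral_cong)
    fix y
    show "(\<integral>\<^sup>+t. f ((y + ?a)(m := a m + 1 * t)) \<partial>lborel) = (\<integral>\<^sup>+t. f ((y + ?a)(m := t)) \<partial>lborel)"
      using nn_integral_real_affine[of "\<lambda>t. f ((y + ?a)(m := t))" 1 "a m"] by simp
  qed
  also have "\<dots> = (\<integral>\<^sup>+y. (\<integral>\<^sup>+t. f (y(m := t)) \<partial>lborel) \<partial>lebn m)"
    by (rule Suc.IH[OF _ a']) measurable
  finally show ?case unfolding nn_integral_lebn_Suc[OF Suc.prems(1)] .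
qed

lemma nn_integral_lebn_diag:
  assumes [measurable]: "f \<in> borel_measurable borel" and "\<And>i. i < n \<Longrightarrow> d i \<noteq> 0"
  shows "(\<integral>\<^sup>+x. f x \<partial>lebn n) = ennreal (\<Prod>i<n. \<bar>d i\<bar>) * (\<integral>\<^sup>+x. f (\<lambda>i. d i * x i) \<partial>lebn n)"
  using assms
proof (induction n arbitrary: f)
  case 0
  note [measurable] = "0.prems"(1)
  have [measurable]: "(\<lambda>x i. d i * x i) \<in> borel_measurable borel" by (rule measurable_funI) measurable
  show ?case by (simp add: nn_integral_lebn_0 zero_fun_def)
next
  case (Suc m)
  note [measurable] = Suc.prems(1)
  have [measurable]: "(\<lambda>x i. d i * x i) \<in> borel_measurable borel" by (rule measurable_funI) measurable
  have d: "d m \<noteq> 0" using Suc.prems by simp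
  have eq: "(\<lambda>i. d i * (y(m := t)) i) = (\<lambda>i. d i * y i)(m := 0 + d m * t)" for y t by (auto simp: fun_eq_iff)
  have "(\<integral>\<^sup>+x. f x \<partial>lebn (Suc m)) = (\<integral>\<^sup>+y. (\<integral>\<^sup>+t. f (y(m := t)) \<partial>lborel) \<partial>lebn m)"
    by (simp add: nn_integral_lebn_Suc)
  also have "\<dots> = (\<integral>\<^sup>+y. ennreal \<bar>d m\<bar> * (\<integral>\<^sup>+t. f (y(m := 0 + d m * t)) \<partial>lborel) \<partial>lebn m)"
    by (intro nn_integral_cong nn_integral_real_affine d) measurable
  also have "\<dots> = ennreal \<bar>d m\<bar> * (\<integral>\<^sup>+y. (\<integral>\<^sup>+t. f (y(m := 0 + d m * t)) \<partial>lborel) \<partial>lebn m)"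
    by (rule nn_integral_cmult) measurable
  also have "(\<integral>\<^sup>+y. (\<integral>\<^sup>+t. f (y(m := 0 + d m * t)) \<partial>lborel) \<partial>lebn m) =
     ennreal (\<Prod>i<m. \<bar>d i\<bar>) * (\<integral>\<^sup>+y. (\<integral>\<^sup>+t. f ((\<lambda>i. d i * y i)(m := 0 + d m * t)) \<partial>lborel) \<partial>lebn m)"
  proof (rule Suc.IH)
    show "(\<lambda>y. \<integral>\<^sup>+t. f (y(m := 0 + d m * t)) \<partial>lborel) \<in> borel_measurable borel" by measurable
  qed (use Suc.prems(2) in simp)
  also have "(\<integral>\<^sup>+y. (\<integral>\<^sup>+t. f ((\<lambda>i. d i * y i)(m := 0 + d m * t)) \<partial>lborel) \<partial>lebn m)
     = (\<integral>\<^sup>+x. f (\<lambda>i. d i * x i) \<partial>lebn (Suc m))"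
    unfolding eq[symmetric] by (rule nn_integral_lebn_Suc[symmetric]) measurable
  finally show ?case by (simp add: ennreal_mult' mult.assoc mult.left_commute prod_nonneg)
qed

lemma emeasure_lebn_translate:
  assumes [measurable]: "B \<in> sets borel" and "a \<in> rspace n"
  shows "emeasure (lebn n) {x. x + a \<in> B} = emeasure (lebn n) B"
proof -
  have [measurable]: "{x. x + a \<in> B} \<in> sets borel" by measurable
  have "(\<integral>\<^sup>+x. indicator {x. x + a \<in> B} x \<partial>lebn n) = (\<integral>\<^sup>+x. indicator B (x + a) \<partial>lebn n)"
    by (intro nn_integral_cong) (simp add: indicator_def)
  also have "\<dots> = (\<integral>\<^sup>+x. indicator B x \<partial>lebn n)" by (rule nn_integral_lebn_translate) (use assms in auto)
  finally show ?thesis by simp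
qed

lemma emeasure_lebn_box:
  assumes "r \<ge> 0"
  shows "emeasure (lebn n) {x. \<forall>i<n. \<bar>x i\<bar> \<le> r} = ennreal ((2 * r) ^ n)"
proof -
  interpret finite_product_sigma_finite "\<lambda>_::nat. lborel :: real measure" "{..<n}" by standard auto
  have "emeasure (lebn n) {x. \<forall>i<n. \<bar>x i\<bar> \<le> r} = emeasure (Pi\<^sub>M {..<n} (\<lambda>_. lborel :: real measure))
     ((\<lambda>x i. if i < n then x i else 0) -` {x. \<forall>i<n. \<bar>x i\<bar> \<le> r} \<inter> space (Pi\<^sub>M {..<n} (\<lambda>_. lborel :: real measure)))"
    unfolding lebn_def by (rule emeasure_distr[OF measurable_extend_zero]) measurable
  also have "(\<lambda>x i. if i < n then x i else 0) -` {x. \<forall>i<n. \<bar>x i\<bar> \<le> r} \<inter> space (Pi\<^sub>M {..<n} (\<lambda>_. lborel :: real measure))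
     = PiE {..<n} (\<lambda>_. {- r .. r})"
    by (auto simp: space_PiM PiE_def Pi_def abs_le_iff minus_le_iff)
  finally show ?thesis using assms by (simp add: measure_times emeasure_lborel_Icc_eq ennreal_power)
qed

lemma emeasure_eball_le: "r \<ge> 0 \<Longrightarrow> emeasure (lebn n) (eball n r) \<le> ennreal ((2 * r) ^ n)"
proof -
  assume r: "r \<ge> 0"
  have [measurable]: "{x::nat\<Rightarrow>real. \<forall>i<n. \<bar>x i\<bar> \<le> r} \<in> sets borel" by measurable
  have "emeasure (lebn n) (eball n r) \<le> emeasure (lebn n) {x. \<forall>i<n. \<bar>x i\<bar> \<le> r}"
    by (rule emeasure_mono) (auto simp: eball_iff intro: order_trans[OF abs_le_nm])
  then show ?thesis by (simp add: emeasure_lebn_box[OF r])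
qed

text \<open>The ball contains the cube of half side r / sqrt n. This crude bound is the source of
  the factor sqrt n in the isoperimetric inequality below.\<close>

lemma emeasure_eball_ge:
  assumes "r \<ge> 0"
  shows "ennreal ((2 * r / sqrt (real n)) ^ n) \<le> emeasure (lebn n) (eball n r)"
proof -
  let ?s = "r / sqrt (real n)"
  have "nm n x \<le> r" if "\<forall>i<n. \<bar>x i\<bar> \<le> ?s" for x
  proof (cases "n = 0")
    case False
    have "ip n x x \<le> (\<Sum>i<n. ?s * ?s)" unfolding ip_def
    proof (rule sum_mono)
      fix i assume "i \<in> {..<n}"
      then have "\<bar>x i\<bar> * \<bar>x i\<bar> \<le> ?s * ?s" using that assms by (intro mult_mono) auto
      then show "x i * x i \<le> ?s * ?s" by simp
    qed
    also have "\<dots> = r\<^sup>2" using False by (simp add: power2_eq_square)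
    finally show ?thesis using nm_le_iff[OF assms] by simp
  qed (use assms in \<open>simp add: L2_set_def\<close>)
  then have sub: "{x. \<forall>i<n. \<bar>x i\<bar> \<le> ?s} \<inter> rspace n \<subseteq> eball n r" by (auto simp: eball_iff)
  have [measurable]: "{x::nat\<Rightarrow>real. \<forall>i<n. \<bar>x i\<bar> \<le> ?s} \<in> sets borel" by measurable
  have "ennreal ((2 * ?s) ^ n) = emeasure (lebn n) {x. \<forall>i<n. \<bar>x i\<bar> \<le> ?s}"
    using assms by (intro emeasure_lebn_box[symmetric]) auto
  also have "\<dots> = emeasure (lebn n) ({x. \<forall>i<n. \<bar>x i\<bar> \<le> ?s} \<inter> rspace n)"
    by (rule emeasure_eq_AE) (use AE_rspace[of n] in auto)
  also have "\<dots> \<le> emeasure (lebn n) (eball n r)" by (rule emeasure_mono[OF sub]) simp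
  finally show ?thesis by simp
qed

lemma emeasure_eball_pos: "r > 0 \<Longrightarrow> emeasure (lebn n) (eball n r) > 0"
  using emeasure_eball_ge[of r n]
  by (cases "n = 0") (auto intro!: less_le_trans[OF _ emeasure_eball_ge])

lemma emeasure_eball_finite: "emeasure (lebn n) (eball n r) < \<infinity>"
proof -
  have "emeasure (lebn n) (eball n r) \<le> emeasure (lebn n) (eball n \<bar>r\<bar>)"
    by (intro emeasure_mono) (auto simp: eball_iff)
  also have "\<dots> < \<infinity>" using emeasure_eball_le[of "\<bar>r\<bar>" n] by (auto simp: le_less_trans)
  finally show ?thesis .
qed

subsection \<open>Invariance under isometries\<close>

text \<open>
  For invertible additive \<open>U\<close> the integral \<open>\<integral>\<integral> 1\<^sub>A(x) 1\<^sub>B(y + U x) dy dx\<close> equals \<open>|A| |B|\<close>, and after the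
  substitution \<open>x \<mapsto> x - U\<^sup>-\<^sup>1 y\<close> it equals \<open>\<kappa>(A) |U\<^sup>-\<^sup>1 B|\<close>.
\<close>

lemma emeasure_vimage_additive:
  fixes U V :: "(nat \<Rightarrow> real) \<Rightarrow> nat \<Rightarrow> real"
  assumes [measurable]: "U \<in> borel_measurable borel" "V \<in> borel_measurable borel"
  assumes rs: "\<And>x. x \<in> rspace n \<Longrightarrow> U x \<in> rspace n" "\<And>x. x \<in> rspace n \<Longrightarrow> V x \<in> rspace n"
  assumes add: "\<And>x y. U (x + y) = U x + U y" "\<And>x y. V (x + y) = V x + V y"
  assumes inv: "\<And>x. x \<in> rspace n \<Longrightarrow> U (V x) = x" "\<And>x. x \<in> rspace n \<Longrightarrow> V (U x) = x"
  obtains \<kappa> where "\<And>A B. A \<in> sets borel \<Longrightarrow> B \<in> sets borel \<Longrightarrow>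
    emeasure (lebn n) A * emeasure (lebn n) B = \<kappa> A * emeasure (lebn n) {x. U x \<in> B}"
proof
  fix A B :: "(nat \<Rightarrow> real) set"
  assume [measurable]: "A \<in> sets borel" "B \<in> sets borel"
  interpret pair_sigma_finite "lebn n" "lebn n" by (rule pair_lebn)
  define \<kappa> where "\<kappa> = (\<lambda>A. \<integral>\<^sup>+y. indicator A (- V y) \<partial>lebn n)"
  have subU: "U (x - z) = U x - U z" for x z using add(1)[of "x - z" z] by simp
  have [measurable]: "{x. U x \<in> B} \<in> sets borel" by measurable
  have "emeasure (lebn n) A * emeasure (lebn n) B = (\<integral>\<^sup>+x. indicator A x * emeasure (lebn n) B \<partial>lebn n)"
    by (simp add: nn_integral_multc)
  also have "\<dots> = (\<integral>\<^sup>+x. (\<integral>\<^sup>+y. indicator A x * indicator B (y + U x) \<partial>lebn n) \<partial>lebn n)"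
  proof (rule nn_integral_cong_AE, use AE_rspace in \<open>rule AE_mp\<close>, rule AE_I2, rule impI)
    fix x assume x: "x \<in> rspace n"
    have "(\<integral>\<^sup>+y. indicator B (y + U x) \<partial>lebn n) = (\<integral>\<^sup>+y. indicator B y \<partial>lebn n)"
      by (rule nn_integral_lebn_translate) (auto intro: rs x)
    then show "indicator A x * emeasure (lebn n) B = (\<integral>\<^sup>+y. indicator A x * indicator B (y + U x) \<partial>lebn n)"
      by (simp add: nn_integral_cmult)
  qed
  also have "\<dots> = (\<integral>\<^sup>+y. (\<integral>\<^sup>+x. indicator A x * indicator B (y + U x) \<partial>lebn n) \<partial>lebn n)"
    by (rule Fubini') measurable
  also have "\<dots> = (\<integral>\<^sup>+y. (\<integral>\<^sup>+x. indicator A (x - V y) * indicator B (U x) \<partial>lebn n) \<partial>lebn n)"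
  proof (rule nn_integral_cong_AE, use AE_rspace in \<open>rule AE_mp\<close>, rule AE_I2, rule impI)
    fix y assume y: "y \<in> rspace n"
    have "(\<integral>\<^sup>+x. indicator A (x + (- V y)) * indicator B (y + U (x + (- V y))) \<partial>lebn n)
      = (\<integral>\<^sup>+x. indicator A x * indicator B (y + U x) \<partial>lebn n)"
      by (rule nn_integral_lebn_translate[where f="\<lambda>x. indicator A x * indicator B (y + U x)"])
         (auto intro!: rs y)
    then show "(\<integral>\<^sup>+x. indicator A x * indicator B (y + U x) \<partial>lebn n) =
        (\<integral>\<^sup>+x. indicator A (x - V y) * indicator B (U x) \<partial>lebn n)"
      by (simp add: subU inv y)
  qed
  also have "\<dots> = (\<integral>\<^sup>+x. (\<integral>\<^sup>+y. indicator A (x - V y) * indicator B (U x) \<partial>lebn n) \<partial>lebn n)"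
    by (rule Fubini') measurable
  also have "\<dots> = (\<integral>\<^sup>+x. \<kappa> A * indicator {x. U x \<in> B} x \<partial>lebn n)"
  proof (rule nn_integral_cong_AE, use AE_rspace in \<open>rule AE_mp\<close>, rule AE_I2, rule impI)
    fix x assume x: "x \<in> rspace n"
    have "(\<integral>\<^sup>+y. indicator A (x - V (y + U x)) \<partial>lebn n) = (\<integral>\<^sup>+y. indicator A (x - V y) \<partial>lebn n)"
      by (rule nn_integral_lebn_translate[where f="\<lambda>y. indicator A (x - V y)"]) (auto intro!: rs x)
    moreover have "x - V (y + U x) = - V y" for y by (simp add: add inv x)
    ultimately show "(\<integral>\<^sup>+y. indicator A (x - V y) * indicator B (U x) \<partial>lebn n) = \<kappa> A * indicator {x. U x \<in> B} x"
      by (simp add: nn_integral_multc \<kappa>_def indicator_def)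
  qed
  also have "\<dots> = \<kappa> A * emeasure (lebn n) {x. U x \<in> B}" by (simp add: nn_integral_cmult)
  finally show "emeasure (lebn n) A * emeasure (lebn n) B = (\<integral>\<^sup>+y. indicator A (- V y) \<partial>lebn n) * emeasure (lebn n) {x. U x \<in> B}"
    by (simp add: \<kappa>_def)
qed

text \<open>The factor \<open>\<kappa> A\<close> does not depend on B. Taking both sets to be the
  unit ball, which U preserves up to a null set, gives \<open>\<kappa>\<close> of the ball as its
  volume; keeping A the ball and letting B vary then shows that U preserves the measure of every
  B.\<close>

lemma distr_lebn_isometry:
  fixes U V :: "(nat \<Rightarrow> real) \<Rightarrow> nat \<Rightarrow> real"
  assumes m [measurable]: "U \<in> borel_measurable borel" "V \<in> borel_measurable borel"
  assumes rs: "\<And>x. x \<in> rspace n \<Longrightarrow> U x \<in> rspace n" "\<And>x. x \<in> rspace n \<Longrightarrow> V x \<in> rspace n"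
  assumes add: "\<And>x y. U (x + y) = U x + U y" "\<And>x y. V (x + y) = V x + V y"
  assumes inv: "\<And>x. x \<in> rspace n \<Longrightarrow> U (V x) = x" "\<And>x. x \<in> rspace n \<Longrightarrow> V (U x) = x"
  assumes norm: "\<And>x. x \<in> rspace n \<Longrightarrow> nm n (U x) = nm n x"
  shows "distr (lebn n) borel U = lebn n"
proof (rule measure_eqI)
  fix B assume "B \<in> sets (distr (lebn n) borel U)"
  then have B [measurable]: "B \<in> sets borel" by simp
  let ?\<mu> = "emeasure (lebn n)" and ?b = "eball n 1"
  obtain \<kappa> where \<kappa>: "\<And>A B. A \<in> sets borel \<Longrightarrow> B \<in> sets borel \<Longrightarrow> ?\<mu> A * ?\<mu> B = \<kappa> A * ?\<mu> {x. U x \<in> B}"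
    using emeasure_vimage_additive[OF m rs add inv] by blast
  have [measurable]: "{x. U x \<in> ?b} \<in> sets borel" by measurable
  have "?\<mu> {x. U x \<in> ?b} = ?\<mu> ?b"
    by (rule emeasure_eq_AE) (use AE_rspace[of n] in \<open>auto simp: eball_iff norm rs\<close>)
  then have "?\<mu> ?b * ?\<mu> ?b = \<kappa> ?b * ?\<mu> ?b" using \<kappa>[of ?b ?b] by simp
  moreover have b: "?\<mu> ?b \<noteq> 0" "?\<mu> ?b \<noteq> \<infinity>" using emeasure_eball_pos[of 1 n] emeasure_eball_finite[of n 1] by auto
  ultimately have k: "\<kappa> ?b = ?\<mu> ?b" by (metis ennreal_mult_cancel_left mult.commute infinity_ennreal_def)
  have "?\<mu> ?b * ?\<mu> B = ?\<mu> ?b * ?\<mu> {x. U x \<in> B}" using \<kappa>[of ?b B] k by simp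
  then have "?\<mu> B = ?\<mu> {x. U x \<in> B}" using b by (metis ennreal_mult_cancel_left infinity_ennreal_def)
  then show "emeasure (distr (lebn n) borel U) B = ?\<mu> B"
    by (simp add: emeasure_distr vimage_def)
qed simp

section \<open>The Brunn--Minkowski inequality\<close>

lemma emeasure_lborel_affine:
  fixes X :: "real set"
  assumes [measurable]: "X \<in> sets borel" and a: "a > 0"
  shows "emeasure lborel {z. (z - b) / a \<in> X} = ennreal a * emeasure lborel X"
proof -
  let ?S = "{z. (z - b) / a \<in> X}"
  have [measurable]: "?S \<in> sets borel" by measurable
  have "emeasure lborel ?S = (\<integral>\<^sup>+z. indicator ?S z \<partial>lborel)" by simp
  also have "\<dots> = ennreal \<bar>a\<bar> * (\<integral>\<^sup>+x. indicator ?S (b + a * x) \<partial>lborel)"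
    by (rule nn_integral_real_affine) (use a in auto)
  also have "(\<lambda>x. indicator ?S (b + a * x)) = (indicator X :: real \<Rightarrow> ennreal)"
    using a by (auto simp: fun_eq_iff indicator_def)
  finally show ?thesis using a by simp
qed

text \<open>Cut X at a point x0 near its supremum and Y at a point y0 near its infimum. The scaled
  copy of X shifted by l y0 lies left of c, that of Y shifted by (1 - l) x0 lies right of c, both
  are inside Z, and they share at most the null set {c}. The cut loses at most e, since the extrema
  need not be attained. Z is any measurable superset of the Minkowski combination, which itself may
  fail to be measurable.\<close>

lemma brunn_minkowski_line:
  fixes X Y Z :: "real set"
  assumes [measurable]: "X \<in> sets borel" "Y \<in> sets borel" "Z \<in> sets borel"
  assumes ne: "X \<noteq> {}" "Y \<noteq> {}" and bd: "X \<subseteq> {-R..R}" "Y \<subseteq> {-R..R}"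
  assumes l: "0 < l" "l < 1"
  assumes Z: "\<And>x y. x \<in> X \<Longrightarrow> y \<in> Y \<Longrightarrow> (1 - l) * x + l * y \<in> Z"
  shows "ennreal (1 - l) * emeasure lborel X + ennreal l * emeasure lborel Y \<le> emeasure lborel Z"
proof (rule ennreal_le_epsilon)
  fix e :: real assume e: "e > 0"
  have bdd: "bdd_above X" "bdd_below Y"
    using bd bdd_above_mono[of "{-R..R}" X] bdd_below_mono[of "{-R..R}" Y] by auto
  obtain x0 where x0: "x0 \<in> X" "Sup X - e < x0"
    using less_cSup_iff[OF ne(1) bdd(1), of "Sup X - e"] e by auto
  obtain y0 where y0: "y0 \<in> Y" "y0 < Inf Y + e"
    using cInf_less_iff[OF ne(2) bdd(2), of "Inf Y + e"] e by auto
  define c where "c = (1 - l) * x0 + l * y0"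
  define Z1 where "Z1 = {z. (z - l * y0) / (1 - l) \<in> X \<inter> {..x0}}"
  define Z2 where "Z2 = {z. (z - (1 - l) * x0) / l \<in> Y \<inter> {y0..}}"
  have [measurable]: "Z1 \<in> sets borel" "Z2 \<in> sets borel" unfolding Z1_def Z2_def by measurable
  have "Z1 \<subseteq> Z"
  proof
    fix z assume "z \<in> Z1"
    then have "(z - l * y0) / (1 - l) \<in> X" by (simp add: Z1_def)
    from Z[OF this y0(1)] have "(1 - l) * ((z - l * y0) / (1 - l)) + l * y0 \<in> Z" .
    moreover have "(1 - l) * ((z - l * y0) / (1 - l)) = z - l * y0" using l by simp
    ultimately show "z \<in> Z" by simp
  qed
  moreover have "Z2 \<subseteq> Z"
  proof
    fix z assume "z \<in> Z2"
    then have "(z - (1 - l) * x0) / l \<in> Y" by (simp add: Z2_def)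
    from Z[OF x0(1) this] have "(1 - l) * x0 + l * ((z - (1 - l) * x0) / l) \<in> Z" .
    then show "z \<in> Z" using l by simp
  qed
  moreover have "Z1 \<inter> (Z2 - {c}) = {}"
  proof -
    have "z \<le> c" if "z \<in> Z1" for z using that l by (auto simp: Z1_def c_def field_simps)
    moreover have "z \<ge> c" if "z \<in> Z2" for z using that l by (auto simp: Z2_def c_def field_simps)
    ultimately show ?thesis by force
  qed
  ultimately have "emeasure lborel Z1 + emeasure lborel (Z2 - {c}) \<le> emeasure lborel Z"
    by (subst plus_emeasure) (auto intro!: emeasure_mono)
  moreover have "emeasure lborel (Z2 - {c}) = emeasure lborel Z2"
    by (rule emeasure_Diff_null_set) (auto intro!: finite_imp_null_set_lborel)
  ultimately have Zge: "emeasure lborel Z1 + emeasure lborel Z2 \<le> emeasure lborel Z" by simp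
  have "emeasure lborel Z1 = ennreal (1 - l) * emeasure lborel (X \<inter> {..x0})"
    unfolding Z1_def using l by (intro emeasure_lborel_affine) auto
  moreover have "emeasure lborel Z2 = ennreal l * emeasure lborel (Y \<inter> {y0..})"
    unfolding Z2_def using l by (intro emeasure_lborel_affine) auto
  moreover have "emeasure lborel X \<le> emeasure lborel (X \<inter> {..x0}) + ennreal e"
  proof -
    have "X \<subseteq> (X \<inter> {..x0}) \<union> {x0..x0+e}" using cSup_upper[OF _ bdd(1)] x0 by force
    then have "emeasure lborel X \<le> emeasure lborel ((X \<inter> {..x0}) \<union> {x0..x0+e})"
      by (intro emeasure_mono) auto
    also have "\<dots> \<le> emeasure lborel (X \<inter> {..x0}) + emeasure lborel {x0..x0+e}"
      by (rule emeasure_subadditive) auto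
    finally show ?thesis using e by simp
  qed
  moreover have "emeasure lborel Y \<le> emeasure lborel (Y \<inter> {y0..}) + ennreal e"
  proof -
    have "Y \<subseteq> (Y \<inter> {y0..}) \<union> {y0-e..y0}" using cInf_lower[OF _ bdd(2)] y0 by force
    then have "emeasure lborel Y \<le> emeasure lborel ((Y \<inter> {y0..}) \<union> {y0-e..y0})"
      by (intro emeasure_mono) auto
    also have "\<dots> \<le> emeasure lborel (Y \<inter> {y0..}) + emeasure lborel {y0-e..y0}"
      by (rule emeasure_subadditive) auto
    finally show ?thesis using e by simp
  qed
  ultimately have "ennreal (1 - l) * emeasure lborel X + ennreal l * emeasure lborel Y
     \<le> ennreal (1 - l) * (emeasure lborel (X \<inter> {..x0}) + ennreal e) + ennreal l * (emeasure lborel (Y \<inter> {y0..}) + ennreal e)"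
    by (intro add_mono mult_left_mono) auto
  also have "\<dots> = emeasure lborel Z1 + emeasure lborel Z2 + (ennreal (1 - l) * ennreal e + ennreal l * ennreal e)"
    using \<open>emeasure lborel Z1 = _\<close> \<open>emeasure lborel Z2 = _\<close> by (simp add: algebra_simps)
  also have "ennreal (1 - l) * ennreal e + ennreal l * ennreal e = ennreal e"
    using l e by (simp add: ennreal_mult[symmetric] ennreal_plus[symmetric] algebra_simps del: ennreal_plus)
  also have "emeasure lborel Z1 + emeasure lborel Z2 + ennreal e \<le> emeasure lborel Z + ennreal e"
    using Zge by (intro add_mono) auto
  finally show "ennreal (1 - l) * emeasure lborel X + ennreal l * emeasure lborel Y \<le> emeasure lborel Z + ennreal e" .
qed

lemma emeasure_levels:
  assumes c: "c > 0"
  shows "ennreal c * emeasure lborel {u. 0 < u \<and> u < 1 \<and> ennreal (c * u) < v} = min (ennreal c) v"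
proof (cases "ennreal c \<le> v")
  case True
  have "{u. 0 < u \<and> u < 1 \<and> ennreal (c * u) < v} = {0<..<1}"
  proof -
    have "ennreal (c * u) < v" if "0 < u" "u < 1" for u
    proof -
      have "ennreal (c * u) < ennreal c" using that c by (simp add: ennreal_less_iff)
      then show ?thesis using True by simp
    qed
    then show ?thesis by auto
  qed
  then show ?thesis using True by (simp add: min_absorb1)
next
  case False
  then obtain r where r: "v = ennreal r" "r \<ge> 0" "r < c"
    by (cases v) (auto simp: not_le ennreal_less_iff)
  have "{u. 0 < u \<and> u < 1 \<and> ennreal (c * u) < v} = {0<..<r/c}"
  proof -
    have "u < 1" if "u < r / c" for u using that r c by (smt (verit) divide_less_eq_1_pos)
    moreover have "ennreal (c * u) < v \<longleftrightarrow> u < r / c" if "0 < u" for u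
      using that r c by (simp add: ennreal_less_iff field_simps)
    ultimately show ?thesis by auto
  qed
  then show ?thesis using r c False by (simp add: ennreal_mult[symmetric] min_absorb2)
qed

text \<open>The levels are rescaled to run over (0, 1) whatever the height c, so that level sets of
  functions with different suprema can be compared at the same u.\<close>

lemma layer_cake:
  assumes [measurable]: "F \<in> borel_measurable lborel" and c: "c > 0"
  shows "(\<integral>\<^sup>+x. min (ennreal c) (F x) \<partial>lborel) =
     ennreal c * (\<integral>\<^sup>+u. indicator {0<..<1} u * emeasure lborel {x. ennreal (c * u) < F x} \<partial>lborel)"
proof -
  have m [measurable]: "{u. 0 < u \<and> u < 1 \<and> ennreal (c * u) < F x} \<in> sets lborel" for x by measurable
  have m2 [measurable]: "{x. ennreal (c * u) < F x} \<in> sets lborel" for u by measurable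
  have "(\<integral>\<^sup>+x. min (ennreal c) (F x) \<partial>lborel) = (\<integral>\<^sup>+x. ennreal c * emeasure lborel {u. 0 < u \<and> u < 1 \<and> ennreal (c * u) < F x} \<partial>lborel)"
    using emeasure_levels[OF c] by simp
  also have "\<dots> = (\<integral>\<^sup>+x. ennreal c * (\<integral>\<^sup>+u. indicator {0<..<1} u * indicator {x. ennreal (c * u) < F x} x \<partial>lborel) \<partial>lborel)"
  proof (intro nn_integral_cong arg_cong2[where f="(*)"] refl)
    fix x
    have "emeasure lborel {u. 0 < u \<and> u < 1 \<and> ennreal (c * u) < F x} = (\<integral>\<^sup>+u. indicator {u. 0 < u \<and> u < 1 \<and> ennreal (c * u) < F x} u \<partial>lborel)"
      by simp
    also have "\<dots> = (\<integral>\<^sup>+u. indicator {0<..<1} u * indicator {x. ennreal (c * u) < F x} x \<partial>lborel)"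
      by (intro nn_integral_cong) (auto simp: indicator_def)
    finally show "emeasure lborel {u. 0 < u \<and> u < 1 \<and> ennreal (c * u) < F x} = \<dots>" .
  qed
  also have "\<dots> = ennreal c * (\<integral>\<^sup>+x. (\<integral>\<^sup>+u. indicator {0<..<1} u * indicator {x. ennreal (c * u) < F x} x \<partial>lborel) \<partial>lborel)"
    by (rule nn_integral_cmult) (simp add: indicator_def; measurable)
  also have "(\<integral>\<^sup>+x. (\<integral>\<^sup>+u. indicator {0<..<1} u * indicator {x. ennreal (c * u) < F x} x \<partial>lborel) \<partial>lborel)
     = (\<integral>\<^sup>+u. (\<integral>\<^sup>+x. indicator {0<..<1} u * indicator {x. ennreal (c * u) < F x} x \<partial>lborel) \<partial>lborel)"
    by (rule lborel_pair.Fubini') (simp add: indicator_def case_prod_unfold; measurable)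
  also have "\<dots> = (\<integral>\<^sup>+u. indicator {0<..<1} u * emeasure lborel {x. ennreal (c * u) < F x} \<partial>lborel)"
    by (intro nn_integral_cong) (simp add: nn_integral_cmult)
  finally show ?thesis .
qed

text \<open>At relative height u < 1 of their suprema MF and MG, the level sets of F and G are both
  nonempty, so the inequality for sets on the line applies; the combination lies in the level set of
  H at height c u, with c the geometric mean of MF and MG. Integrating over u gives an arithmetic
  mean of the normalised integrals, which dominates the geometric one. Real minorants a, b represent
  the values of F and G because \<open>powr\<close> acts on reals.\<close>

lemma prekopa_leindler_line:
  fixes F G H :: "real \<Rightarrow> ennreal"
  assumes mF [measurable]: "F \<in> borel_measurable borel" and mG [measurable]: "G \<in> borel_measurable borel"
    and mH [measurable]: "H \<in> borel_measurable borel"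
  assumes bd: "\<And>x. F x \<le> ennreal N * indicator {-R..R} x" "\<And>x. G x \<le> ennreal N * indicator {-R..R} x"
  assumes l: "0 < l" "l < 1"
  assumes FGH: "\<And>x y a b. 0 < a \<Longrightarrow> 0 < b \<Longrightarrow> ennreal a \<le> F x \<Longrightarrow> ennreal b \<le> G y \<Longrightarrow>
     ennreal (a powr (1 - l) * b powr l) \<le> H ((1 - l) * x + l * y)"
  assumes ab: "0 < a" "0 < b" "ennreal a \<le> (\<integral>\<^sup>+x. F x \<partial>lborel)" "ennreal b \<le> (\<integral>\<^sup>+x. G x \<partial>lborel)"
  shows "ennreal (a powr (1 - l) * b powr l) \<le> (\<integral>\<^sup>+x. H x \<partial>lborel)"
proof -
  have sup: "\<exists>M>0. (\<forall>x. E x \<le> ennreal M) \<and> (\<forall>u<1. \<exists>x. ennreal (M * u) < E x)"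
    if E: "\<And>x. E x \<le> ennreal N * indicator {-R..R} x" and e: "0 < e" "ennreal e \<le> (\<integral>\<^sup>+x. E x \<partial>lborel)" for E e
  proof -
    have le: "E x \<le> ennreal N" for x using E[of x] by (cases "- R \<le> x \<and> x \<le> R") (auto simp: indicator_def)
    define S where "S = (SUP x. E x)"
    have "S \<le> ennreal N" unfolding S_def using le by (auto intro: SUP_least)
    then obtain M where M: "S = ennreal M" "M \<ge> 0" by (cases S) (auto simp: top_unique)
    have up: "E x \<le> ennreal M" for x using M unfolding S_def by (metis SUP_upper UNIV_I)
    have "M \<noteq> 0"
    proof
      assume "M = 0"
      then have "E x = 0" for x using up[of x] by simp
      then show False using e by simp
    qed
    then have Mp: "M > 0" using M by simp
    have "\<exists>x. ennreal (M * u) < E x" if "u < 1" for u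
    proof -
      have "ennreal (M * u) < S" using that Mp M(1) by (simp add: ennreal_lessI)
      then show ?thesis unfolding S_def less_SUP_iff by auto
    qed
    then show ?thesis using Mp up by auto
  qed
  have bd0: "F x = 0" "G x = 0" if "x \<notin> {-R..R}" for x
    using bd(1)[of x] bd(2)[of x] that by (simp_all split: split_indicator_asm)
  obtain MF where MF: "MF > 0" "\<And>x. F x \<le> ennreal MF" "\<And>u. u < 1 \<Longrightarrow> \<exists>x. ennreal (MF * u) < F x"
    using sup[OF bd(1) ab(1,3)] by auto
  obtain MG where MG: "MG > 0" "\<And>x. G x \<le> ennreal MG" "\<And>u. u < 1 \<Longrightarrow> \<exists>x. ennreal (MG * u) < G x"
    using sup[OF bd(2) ab(2,4)] by auto
  define c where "c = MF powr (1 - l) * MG powr l"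
  have c: "c > 0" using MF MG by (simp add: c_def)
  let ?lev = "\<lambda>M E u. emeasure lborel {x. ennreal (M * u) < E x}"
  define A where "A = (\<integral>\<^sup>+u. indicator {0<..<1::real} u * ?lev MF F u \<partial>lborel)"
  define B where "B = (\<integral>\<^sup>+u. indicator {0<..<1::real} u * ?lev MG G u \<partial>lborel)"
  define D where "D = (\<integral>\<^sup>+u. indicator {0<..<1::real} u * ?lev c H u \<partial>lborel)"
  have A: "(\<integral>\<^sup>+x. F x \<partial>lborel) = ennreal MF * A"
    using layer_cake[OF _ MF(1), of F] MF(2) by (simp add: A_def min_absorb2)
  have B: "(\<integral>\<^sup>+x. G x \<partial>lborel) = ennreal MG * B"
    using layer_cake[OF _ MG(1), of G] MG(2) by (simp add: B_def min_absorb2)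
  have "ennreal c * D = (\<integral>\<^sup>+x. min (ennreal c) (H x) \<partial>lborel)"
    using layer_cake[OF _ c, of H] by (simp add: D_def)
  also have "\<dots> \<le> (\<integral>\<^sup>+x. H x \<partial>lborel)" by (intro nn_integral_mono) auto
  finally have D: "ennreal c * D \<le> (\<integral>\<^sup>+x. H x \<partial>lborel)" .
  have pt: "ennreal (1 - l) * ?lev MF F u + ennreal l * ?lev MG G u \<le> ?lev c H u" if u: "0 < u" "u < 1" for u
  proof (rule brunn_minkowski_line[OF _ _ _ _ _ _ _ l])
    show "{x. ennreal (MF * u) < F x} \<noteq> {}" "{x. ennreal (MG * u) < G x} \<noteq> {}"
      using MF(3) MG(3) u by auto
    show "{x. ennreal (MF * u) < F x} \<subseteq> {-R..R}" "{x. ennreal (MG * u) < G x} \<subseteq> {-R..R}"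
      using bd0 by (metis (no_types, lifting) mem_Collect_eq not_less_zero subsetI)+
    fix x y assume x: "x \<in> {x. ennreal (MF * u) < F x}" and y: "y \<in> {x. ennreal (MG * u) < G x}"
    obtain s where s: "F x = ennreal s" "s \<ge> 0" using MF(2)[of x] by (cases "F x") (auto simp: top_unique)
    obtain t where t: "G y = ennreal t" "t \<ge> 0" using MG(2)[of y] by (cases "G y") (auto simp: top_unique)
    have st: "MF * u < s" "MG * u < t" using x y s t MF(1) MG(1) u by (auto simp: ennreal_less_iff)
    have p: "0 < MF * u" "0 < MG * u" using MF(1) MG(1) u by auto
    have "c * u = c * (u powr (1 - l) * u powr l)" using u by (simp add: powr_add[symmetric])
    also have "\<dots> = (MF * u) powr (1 - l) * (MG * u) powr l"
      using MF(1) MG(1) u by (simp add: c_def powr_mult)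
    also have "\<dots> < s powr (1 - l) * t powr l"
      using st p l by (intro mult_strict_mono powr_less_mono2) auto
    finally have "ennreal (c * u) < ennreal (s powr (1 - l) * t powr l)"
      using c u by (simp add: ennreal_less_iff)
    also have "\<dots> \<le> H ((1 - l) * x + l * y)" using FGH[of s t x y] s t st p by auto
    finally show "(1 - l) * x + l * y \<in> {x. ennreal (c * u) < H x}" by simp
  qed measurable
  have meas: "(\<lambda>u. ?lev M E u) \<in> borel_measurable lborel" if [measurable]: "E \<in> borel_measurable borel" for M E
  proof -
    have "{p \<in> space (borel \<Otimes>\<^sub>M borel). ennreal (M * fst p) < E (snd p)} \<in> sets (borel \<Otimes>\<^sub>M borel)"
      by measurable
    then have [measurable]: "{p. ennreal (M * fst p) < E (snd p)} \<in> sets (borel \<Otimes>\<^sub>M borel)"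
      by (simp add: space_pair_measure)
    have "(\<lambda>u. emeasure lborel (Pair u -` {p. ennreal (M * fst p) < E (snd p)})) \<in> borel_measurable lborel"
      by (rule lborel.measurable_emeasure_Pair) measurable
    then show ?thesis by (simp add: vimage_def)
  qed
  note [measurable] = meas[OF mF] meas[OF mG] meas[OF mH]
  have "ennreal (1 - l) * A + ennreal l * B =
      (\<integral>\<^sup>+u. ennreal (1 - l) * (indicator {0<..<1::real} u * ?lev MF F u) + ennreal l * (indicator {0<..<1::real} u * ?lev MG G u) \<partial>lborel)"
    unfolding A_def B_def by (simp add: nn_integral_add nn_integral_cmult)
  also have "\<dots> \<le> D" unfolding D_def
    by (intro nn_integral_mono) (use pt in \<open>auto simp: indicator_def\<close>)
  finally have ABD: "ennreal (1 - l) * A + ennreal l * B \<le> D" .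
  have aA: "ennreal (a / MF) \<le> A"
  proof -
    have "ennreal (a / MF) = ennreal (1 / MF) * ennreal a" using MF(1) ab by (simp add: ennreal_mult[symmetric])
    also have "\<dots> \<le> ennreal (1 / MF) * (ennreal MF * A)" using ab(3) A by (intro mult_left_mono) auto
    also have "\<dots> = A" using MF(1) by (simp add: mult.assoc[symmetric] ennreal_mult[symmetric])
    finally show ?thesis .
  qed
  have bB: "ennreal (b / MG) \<le> B"
  proof -
    have "ennreal (b / MG) = ennreal (1 / MG) * ennreal b" using MG(1) ab by (simp add: ennreal_mult[symmetric])
    also have "\<dots> \<le> ennreal (1 / MG) * (ennreal MG * B)" using ab(4) B by (intro mult_left_mono) auto
    also have "\<dots> = B" using MG(1) by (simp add: mult.assoc[symmetric] ennreal_mult[symmetric])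
    finally show ?thesis .
  qed
  have "a powr (1 - l) * b powr l = c * ((a / MF) powr (1 - l) * (b / MG) powr l)"
    using MF(1) MG(1) ab by (simp add: c_def powr_divide)
  also have "\<dots> \<le> c * ((1 - l) * (a / MF) + l * (b / MG))"
    using c l ab MF(1) MG(1) by (intro mult_left_mono Youngs_inequality_0) auto
  finally have "ennreal (a powr (1 - l) * b powr l) \<le> ennreal (c * ((1 - l) * (a / MF) + l * (b / MG)))"
    by (rule ennreal_leI)
  also have "\<dots> = ennreal c * (ennreal (1 - l) * ennreal (a / MF) + ennreal l * ennreal (b / MG))"
    using c l ab MF(1) MG(1) by (simp add: ennreal_mult[symmetric] ennreal_plus[symmetric] del: ennreal_plus)
  also have "\<dots> \<le> ennreal c * (ennreal (1 - l) * A + ennreal l * B)"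
    by (intro mult_left_mono add_mono aA bB) auto
  also have "\<dots> \<le> ennreal c * D" using ABD by (intro mult_left_mono) auto
  also note D
  finally show ?thesis .
qed

text \<open>The line case is applied to the integrals over the sections with fixed last coordinate;
  its pointwise hypothesis for two sections is exactly the induction hypothesis. The bound on a box
  guarantees that the section integrals are again bounded with bounded support.\<close>

theorem prekopa_leindler:
  fixes f g h :: "(nat \<Rightarrow> real) \<Rightarrow> ennreal"
  assumes "f \<in> borel_measurable borel" "g \<in> borel_measurable borel" "h \<in> borel_measurable borel"
  assumes "\<And>x. f x \<le> ennreal N * indicator {x. \<forall>i<n. \<bar>x i\<bar> \<le> R} x"
    "\<And>x. g x \<le> ennreal N * indicator {x. \<forall>i<n. \<bar>x i\<bar> \<le> R} x"
  assumes l: "0 < l" "l < 1" and "R \<ge> 0" "N \<ge> 0"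
  assumes "\<And>x y a b. 0 < a \<Longrightarrow> 0 < b \<Longrightarrow> ennreal a \<le> f x \<Longrightarrow> ennreal b \<le> g y \<Longrightarrow>
     ennreal (a powr (1 - l) * b powr l) \<le> h ((1 - l) *\<^sub>R x + l *\<^sub>R y)"
  assumes "0 < a" "0 < b" "ennreal a \<le> (\<integral>\<^sup>+x. f x \<partial>lebn n)" "ennreal b \<le> (\<integral>\<^sup>+x. g x \<partial>lebn n)"
  shows "ennreal (a powr (1 - l) * b powr l) \<le> (\<integral>\<^sup>+x. h x \<partial>lebn n)"
  using assms(1-5,10-)
proof (induction n arbitrary: f g h a b)
  case (0 f g h)
  then have "ennreal a \<le> f 0" "ennreal b \<le> g 0" unfolding nn_integral_lebn_0[OF "0"(1)] nn_integral_lebn_0[OF "0"(2)] by auto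
  then have "ennreal (a powr (1 - l) * b powr l) \<le> h ((1 - l) *\<^sub>R 0 + l *\<^sub>R 0)" by (rule "0"(6)[OF "0"(7,8)])
  then show ?case unfolding nn_integral_lebn_0[OF "0"(3)] by simp
next
  case (Suc m f g h a b)
  note [measurable] = Suc.prems(1-3)
  let ?I = "\<lambda>f t. \<integral>\<^sup>+y. f (y(m := t)) \<partial>lebn m"
  have fub: "(\<integral>\<^sup>+x. k x \<partial>lebn (Suc m)) = (\<integral>\<^sup>+t. ?I k t \<partial>lborel)" if [measurable]: "k \<in> borel_measurable borel" for k
  proof -
    interpret pair_sigma_finite "lebn m" "lborel :: real measure"
      by (simp add: pair_sigma_finite_def sigma_finite_lebn sigma_finite_lborel)
    have "(\<integral>\<^sup>+y. (\<integral>\<^sup>+t. k (y(m := t)) \<partial>lborel) \<partial>lebn m) = (\<integral>\<^sup>+t. ?I k t \<partial>lborel)"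
      by (rule Fubini'[symmetric]) measurable
    then show ?thesis using nn_integral_lebn_Suc[OF that] by simp
  qed
  have bI: "?I k t \<le> ennreal (N * (2 * R) ^ m) * indicator {-R..R} t"
    if k: "\<And>x. k x \<le> ennreal N * indicator {x. \<forall>i<Suc m. \<bar>x i\<bar> \<le> R} x" for k t
  proof -
    have [measurable]: "{x::nat\<Rightarrow>real. \<forall>i<m. \<bar>x i\<bar> \<le> R} \<in> sets borel" by measurable
    have "?I k t \<le> (\<integral>\<^sup>+y. ennreal N * indicator {-R..R} t * indicator {x. \<forall>i<m. \<bar>x i\<bar> \<le> R} y \<partial>lebn m)"
    proof (rule nn_integral_mono)
      fix y
      show "k (y(m := t)) \<le> ennreal N * indicator {-R..R} t * indicator {x. \<forall>i<m. \<bar>x i\<bar> \<le> R} y"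
        by (rule order_trans[OF k]) (auto simp: indicator_def less_Suc_eq abs_le_iff minus_le_iff all_conj_distrib imp_conjL)
    qed
    also have "\<dots> = ennreal N * indicator {-R..R} t * ennreal ((2 * R) ^ m)"
      using emeasure_lebn_box[OF \<open>R \<ge> 0\<close>, of m] by (simp add: nn_integral_cmult)
    also have "\<dots> = ennreal (N * (2 * R) ^ m) * indicator {-R..R} t"
      using \<open>R \<ge> 0\<close> \<open>N \<ge> 0\<close> by (simp add: ennreal_mult mult_ac)
    finally show ?thesis .
  qed
  show ?case unfolding fub[OF Suc.prems(3)]
  proof (rule prekopa_leindler_line[OF _ _ _ bI[OF Suc.prems(4)] bI[OF Suc.prems(5)] l])
    show "(\<lambda>t. ?I f t) \<in> borel_measurable borel" "(\<lambda>t. ?I g t) \<in> borel_measurable borel" "(\<lambda>t. ?I h t) \<in> borel_measurable borel"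
      by measurable
    show "0 < a" "0 < b" "ennreal a \<le> (\<integral>\<^sup>+t. ?I f t \<partial>lborel)" "ennreal b \<le> (\<integral>\<^sup>+t. ?I g t \<partial>lborel)"
      using Suc.prems(7-) unfolding fub[OF Suc.prems(1)] fub[OF Suc.prems(2)] by auto
    fix t s a b :: real assume ab: "0 < a" "0 < b" "ennreal a \<le> ?I f t" "ennreal b \<le> ?I g s"
    show "ennreal (a powr (1 - l) * b powr l) \<le> ?I h ((1 - l) * t + l * s)"
    proof (rule Suc.IH[OF _ _ _ _ _ _ ab])
      have ind: "indicator {x. \<forall>i<Suc m. \<bar>x i\<bar> \<le> R} (x(m := t)) \<le> (indicator {x. \<forall>i<m. \<bar>x i\<bar> \<le> R} x :: ennreal)" for x t
        by (auto simp: indicator_def)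
      show "f (x(m := t)) \<le> ennreal N * indicator {x. \<forall>i<m. \<bar>x i\<bar> \<le> R} x" for x
        by (rule order_trans[OF Suc.prems(4)]) (intro mult_left_mono ind zero_le)
      show "g (x(m := s)) \<le> ennreal N * indicator {x. \<forall>i<m. \<bar>x i\<bar> \<le> R} x" for x
        by (rule order_trans[OF Suc.prems(5)]) (intro mult_left_mono ind zero_le)
      fix x y and a b :: real assume xy: "0 < a" "0 < b" "ennreal a \<le> f (x(m := t))" "ennreal b \<le> g (y(m := s))"
      have "((1 - l) *\<^sub>R x + l *\<^sub>R y)(m := (1 - l) * t + l * s) = (1 - l) *\<^sub>R x(m := t) + l *\<^sub>R y(m := s)"
        by (auto simp: fun_eq_iff)
      then show "ennreal (a powr (1 - l) * b powr l) \<le> h (((1 - l) *\<^sub>R x + l *\<^sub>R y)(m := (1 - l) * t + l * s))"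
        using Suc.prems(6)[OF xy] by metis
    qed measurable
  qed
qed

lemma emeasure_compact_finite:
  assumes "compact K" "K \<subseteq> rspace n"
  shows "emeasure (lebn n) K < \<infinity>"
proof -
  obtain R where "K \<subseteq> eball n R" using eball_bounds[OF assms] by blast
  then have "emeasure (lebn n) K \<le> emeasure (lebn n) (eball n R)" by (intro emeasure_mono) auto
  then show ?thesis using emeasure_eball_finite[of n R] by simp
qed

lemma emeasure_eq_vol:
  assumes "compact K" "K \<subseteq> rspace n"
  shows "emeasure (lebn n) K = ennreal (vol n K)"
  unfolding vol_def using emeasure_compact_finite[OF assms]
  by (intro emeasure_eq_ennreal_measure) auto

lemma sets_compact: "compact (K :: (nat \<Rightarrow> real) set) \<Longrightarrow> K \<in> sets borel"
  by (intro borel_closed compact_imp_closed)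

lemma vol_nonneg [simp]: "vol n A \<ge> 0"
  by (simp add: vol_def)

text \<open>Prekopa--Leindler for indicator functions. The multiplicative form loses nothing when
  the two volumes agree, and its applications are arranged accordingly or take logarithms.\<close>

theorem brunn_minkowski:
  assumes A: "compact A" "A \<subseteq> rspace n" and B: "compact B" "B \<subseteq> rspace n" and l: "0 < l" "l < 1"
  shows "vol n A powr (1 - l) * vol n B powr l \<le> vol n (add_set ((\<lambda>x. (1 - l) *\<^sub>R x) ` A) ((\<lambda>x. l *\<^sub>R x) ` B))"
proof (cases "vol n A > 0 \<and> vol n B > 0")
  case True
  let ?C = "add_set ((\<lambda>x. (1 - l) *\<^sub>R x) ` A) ((\<lambda>x. l *\<^sub>R x) ` B)"
  have C: "compact ?C" "?C \<subseteq> rspace n"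
    using A B by (auto intro!: compact_add_set compact_scale_image elim!: add_setE)
  note [measurable] = sets_compact[OF A(1)] sets_compact[OF B(1)] sets_compact[OF C(1)]
  obtain R1 where R1: "R1 > 0" "A \<subseteq> eball n R1" using eball_bounds[OF A] by blast
  obtain R2 where R2: "R2 > 0" "B \<subseteq> eball n R2" using eball_bounds[OF B] by blast
  define R where "R = max R1 R2"
  have R: "R \<ge> 0" "A \<subseteq> eball n R" "B \<subseteq> eball n R"
    using R1 R2 eball_mono[of R1 R n] eball_mono[of R2 R n] by (auto simp: R_def)
  have sub: "E \<subseteq> {x. \<forall>i<n. \<bar>x i\<bar> \<le> R}" if "E \<subseteq> eball n R" for E
    using that by (auto simp: eball_iff subset_iff intro: order_trans[OF abs_le_nm[of _ n]])
  have "ennreal (vol n A powr (1 - l) * vol n B powr l) \<le> (\<integral>\<^sup>+x. indicator ?C x \<partial>lebn n)"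
  proof (rule prekopa_leindler[where f="indicator A" and g="indicator B" and N=1 and R=R, OF _ _ _ _ _ l R(1)])
    show "indicator A x \<le> ennreal 1 * indicator {x. \<forall>i<n. \<bar>x i\<bar> \<le> R} x"
      "indicator B x \<le> ennreal 1 * indicator {x. \<forall>i<n. \<bar>x i\<bar> \<le> R} x" for x
      using sub[OF R(2)] sub[OF R(3)] by (auto simp: indicator_def)
    fix x y and a b :: real
    assume *: "0 < a" "0 < b" "ennreal a \<le> indicator A x" "ennreal b \<le> indicator B y"
    then have xy: "x \<in> A" "y \<in> B" "a \<le> 1" "b \<le> 1" by (auto split: split_indicator_asm)
    have "a powr (1 - l) * b powr l \<le> 1 * 1"
      using * xy l by (intro mult_mono powr_le1) auto
    moreover have "(1 - l) *\<^sub>R x + l *\<^sub>R y \<in> ?C" using xy by (intro add_setI) auto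
    ultimately show "ennreal (a powr (1 - l) * b powr l) \<le> indicator ?C ((1 - l) *\<^sub>R x + l *\<^sub>R y)"
      by simp
  qed (use True emeasure_eq_vol[OF A] emeasure_eq_vol[OF B] in auto)
  then show ?thesis using emeasure_eq_vol[OF C] by simp
next
  case False
  then have "vol n A = 0 \<or> vol n B = 0" using vol_nonneg[of n A] vol_nonneg[of n B] by linarith
  then show ?thesis by auto
qed

section \<open>Parallel bodies and surface area\<close>

text \<open>Congruence rules for binders make the simplifier eta-expand vector-valued terms and unfold the
  pointwise operations, so these rules are only used on demand.\<close>

lemmas fun_apply = plus_fun_apply minus_apply uminus_apply zero_fun_apply scaleR_fun_apply

declare fun_apply [simp del]

lemma vol_translate:
  assumes [measurable]: "A \<in> sets borel" and a: "a \<in> rspace n"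
  shows "vol n (add_set {a} A) = vol n A"
proof -
  have "add_set {a} A = {x. x + (- a) \<in> A}"
    by (auto simp: add_set_eq) (metis diff_add_cancel add.commute)
  then show ?thesis using emeasure_lebn_translate[of A "- a" n] a by (simp add: vol_def measure_def)
qed

lemma vol_scale:
  assumes [measurable]: "A \<in> sets borel" and c: "c > 0"
  shows "vol n ((\<lambda>x. c *\<^sub>R x) ` A) = c ^ n * vol n A"
proof -
  let ?S = "(\<lambda>x::nat\<Rightarrow>real. c *\<^sub>R x) ` A"
  have S: "?S = {x. (1 / c) *\<^sub>R x \<in> A}" using c
    by (auto simp: image_iff intro!: bexI[of _ "(1 / c) *\<^sub>R _"])
  then have [measurable]: "?S \<in> sets borel" by simp
  have d: "(\<lambda>i. c * x i) = c *\<^sub>R x" for x :: "nat \<Rightarrow> real" by (simp add: fun_eq_iff fun_apply)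
  have "emeasure (lebn n) ?S = (\<integral>\<^sup>+x. indicator ?S x \<partial>lebn n)" by simp
  also have "\<dots> = ennreal (\<Prod>i<n. \<bar>c\<bar>) * (\<integral>\<^sup>+x. indicator ?S (\<lambda>i. c * x i) \<partial>lebn n)"
    by (rule nn_integral_lebn_diag) (use c in auto)
  also have "(\<lambda>x. indicator ?S (\<lambda>i. c * x i)) = (indicator A :: (nat \<Rightarrow> real) \<Rightarrow> ennreal)"
    unfolding d S using c by (auto simp: fun_eq_iff indicator_def)
  finally show ?thesis using c by (simp add: vol_def measure_def enn2real_mult)
qed

lemma vol_mono:
  assumes "A \<subseteq> B" "A \<in> sets borel" "compact B" "B \<subseteq> rspace n"
  shows "vol n A \<le> vol n B"
  unfolding vol_def
  using assms emeasure_compact_finite[of B n] sets_compact[of B]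
  by (intro measure_mono_fmeasurable) (auto simp: fmeasurable_def)

text \<open>A convex body together with a lower bound r for its inradius. The number r makes the
  surface area finite and is inherited, unchanged, by parallel bodies and projections.\<close>

definition cbody :: "nat \<Rightarrow> real \<Rightarrow> (nat \<Rightarrow> real) set \<Rightarrow> bool" where
  "cbody n r K \<longleftrightarrow> compact K \<and> convex K \<and> K \<subseteq> rspace n \<and> r > 0 \<and>
     (\<exists>a\<in>rspace n. add_set {a} (eball n r) \<subseteq> K)"

lemma cbodyD:
  assumes "cbody n r K"
  shows "compact K" "convex K" "K \<subseteq> rspace n" "r > 0" "K \<in> sets borel"
  using assms by (auto simp: cbody_def intro: sets_compact)

lemma convex_body_imp_cbody: "convex_body n K \<Longrightarrow> \<exists>r. cbody n r K"
  using convex_body_imp[of n K] by (auto simp: cbody_def)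

lemma compact_parallel: "compact K \<Longrightarrow> compact (add_set K (eball n e))"
  by (intro compact_add_set compact_eball)

lemma eball_subset_rspace: "eball n e \<subseteq> rspace n"
  by (auto simp: eball_iff)

lemma parallel_subset_rspace: "K \<subseteq> rspace n \<Longrightarrow> add_set K (eball n e) \<subseteq> rspace n"
  by (intro add_set_rspace eball_subset_rspace)

lemma eball_0: "eball n 0 = {0}"
  by (auto simp: eball_iff) (metis L2_set_nonneg antisym nm_eq_0)

lemma parallel_0 [simp]: "add_set K (eball n 0) = K"
  by (auto simp: eball_0 add_set_eq)

lemma subset_parallel: "e \<ge> 0 \<Longrightarrow> K \<subseteq> add_set K (eball n e)"
  using add_setI[of _ K 0 "eball n e"] by (auto simp: eball_iff)

lemma cbody_parallel:
  assumes "cbody n r K" "e \<ge> 0"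
  shows "cbody n r (add_set K (eball n e))"
proof -
  obtain a where a: "a \<in> rspace n" "add_set {a} (eball n r) \<subseteq> K" using assms by (auto simp: cbody_def)
  then have "add_set {a} (eball n r) \<subseteq> add_set K (eball n e)" using subset_parallel[OF assms(2), of K n] by blast
  then show ?thesis using a(1) cbodyD[OF assms(1)] unfolding cbody_def
    by (intro conjI compact_parallel convex_add_set convex_eball parallel_subset_rspace bexI[of _ a])
qed

lemma vol_eball_pos: "r > 0 \<Longrightarrow> vol n (eball n r) > 0"
  using emeasure_eball_pos[of r n] emeasure_eq_vol[OF compact_eball eball_subset_rspace, of n r] by simp

lemma vol_eball_le: "r \<ge> 0 \<Longrightarrow> vol n (eball n r) \<le> (2 * r) ^ n"
  using emeasure_eball_le[of r n] emeasure_eq_vol[OF compact_eball eball_subset_rspace, of n r] by simp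

lemma vol_eball_ge: "r \<ge> 0 \<Longrightarrow> (2 * r / sqrt (real n)) ^ n \<le> vol n (eball n r)"
  using emeasure_eball_ge[of r n] emeasure_eq_vol[OF compact_eball eball_subset_rspace, of n r] by simp

lemma vol_eball_scale: "r > 0 \<Longrightarrow> vol n (eball n r) = r ^ n * vol n (eball n 1)"
  using vol_scale[of "eball n 1" r n] scale_eball[of r n 1] by simp

lemma vol_cbody_pos:
  assumes "cbody n r K" shows "vol n K > 0"
proof -
  obtain a where a: "a \<in> rspace n" "add_set {a} (eball n r) \<subseteq> K" using assms by (auto simp: cbody_def)
  have "vol n (add_set {a} (eball n r)) \<le> vol n K"
    using a cbodyD[OF assms] by (intro vol_mono) (auto intro!: sets_compact compact_add_set compact_eball)
  then show ?thesis using vol_translate[of "eball n r" a n] a vol_eball_pos[of r n] cbodyD[OF assms] by simp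
qed

text \<open>A ball of radius e around 0 is contained in (e/r)(K - a), and K + (e/r) K = (1 + e/r) K
  by convexity.\<close>

lemma parallel_subset_homothet:
  assumes K: "convex K" and a: "add_set {a} (eball n r) \<subseteq> K" and r: "r > 0" and e: "e \<ge> 0"
  shows "add_set K (eball n e) \<subseteq> add_set {- (e / r) *\<^sub>R a} ((\<lambda>x. (1 + e / r) *\<^sub>R x) ` K)"
proof
  fix x assume "x \<in> add_set K (eball n e)"
  then obtain k b where x: "x = k + b" "k \<in> K" "b \<in> eball n e" by (auto elim: add_setE)
  define t where "t = 1 + e / r"
  have t: "t > 0" using r e by (simp add: t_def add_pos_nonneg)
  obtain k' where k': "k' \<in> K" "b = (e / r) *\<^sub>R (k' - a)"
  proof (cases "e = 0")
    case True
    then have "b = (e / r) *\<^sub>R (k - a)" using x by (simp add: eball_0)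
    then show ?thesis using that x by blast
  next
    case False
    then have ep: "e > 0" using e by simp
    have "r / e * nm n b \<le> r / e * e" using x(3) r ep by (intro mult_left_mono) (auto simp: eball_iff)
    then have "(r / e) *\<^sub>R b \<in> eball n r" using x(3) r ep by (auto simp: eball_iff)
    then have "a + (r / e) *\<^sub>R b \<in> K" using a add_setI[of a "{a}" "(r / e) *\<^sub>R b"] by auto
    moreover have "b = (e / r) *\<^sub>R ((a + (r / e) *\<^sub>R b) - a)" using r ep by simp
    ultimately show ?thesis using that by blast
  qed
  have "1 / t + e / r / t = t / t" unfolding add_divide_distrib[symmetric] by (simp only: t_def)
  then have "1 / t + e / r / t = 1" using t by simp
  then have "(1 / t) *\<^sub>R k + (e / r / t) *\<^sub>R k' \<in> K"
    using convexD[OF K x(2) k'(1), of "1 / t" "e / r / t"] t r e by auto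
  moreover have "x = - (e / r) *\<^sub>R a + t *\<^sub>R ((1 / t) *\<^sub>R k + (e / r / t) *\<^sub>R k')"
    using t unfolding x(1) k'(2) scaleR_add_right scaleR_scaleR by (simp add: algebra_simps)
  ultimately show "x \<in> add_set {- (e / r) *\<^sub>R a} ((\<lambda>x. (1 + e / r) *\<^sub>R x) ` K)"
    unfolding t_def[symmetric] by (metis add_setI imageI singletonI)
qed

lemma vol_parallel_le:
  assumes "cbody n r K" "e \<ge> 0"
  shows "vol n (add_set K (eball n e)) \<le> (1 + e / r) ^ n * vol n K"
proof -
  obtain a where a: "a \<in> rspace n" "add_set {a} (eball n r) \<subseteq> K" using assms by (auto simp: cbody_def)
  note K = cbodyD[OF assms(1)]
  let ?L = "(\<lambda>x. (1 + e / r) *\<^sub>R x) ` K"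
  have L: "compact ?L" "?L \<subseteq> rspace n" using K by (auto intro!: compact_scale_image)
  have "vol n (add_set K (eball n e)) \<le> vol n (add_set {- (e / r) *\<^sub>R a} ?L)"
    using L a K by (intro vol_mono parallel_subset_homothet[OF K(2) a(2) K(4) assms(2)])
       (auto intro!: sets_compact compact_add_set compact_parallel elim!: add_setE)
  also have "\<dots> = vol n ?L" using L a by (intro vol_translate sets_compact) auto
  also have "\<dots> = (1 + e / r) ^ n * vol n K" using K assms by (intro vol_scale) (auto simp: add_pos_nonneg)
  finally show ?thesis .
qed

lemma vol_parallel_mono:
  assumes "cbody n r K" "0 \<le> d" "d \<le> e"
  shows "vol n (add_set K (eball n d)) \<le> vol n (add_set K (eball n e))"
  using cbodyD[OF assms(1)] assms eball_mono[OF assms(3), of n]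
  by (intro vol_mono add_set_mono sets_compact compact_parallel parallel_subset_rspace) auto

lemma vol_parallel_pos: "cbody n r K \<Longrightarrow> e \<ge> 0 \<Longrightarrow> vol n (add_set K (eball n e)) > 0"
  using vol_cbody_pos cbody_parallel by blast

text \<open>Brunn--Minkowski for the two parallel bodies; convexity collapses (1 - l) K + l K to K,
  and the radii combine linearly by the triangle inequality.\<close>

lemma ln_vol_parallel_concave:
  assumes K: "cbody n r K" and e: "0 \<le> d" "0 \<le> e" and l: "0 < l" "l < 1"
  shows "(1 - l) * ln (vol n (add_set K (eball n d))) + l * ln (vol n (add_set K (eball n e)))
     \<le> ln (vol n (add_set K (eball n ((1 - l) * d + l * e))))"
proof -
  let ?V = "\<lambda>e. vol n (add_set K (eball n e))"
  note k = cbodyD[OF K]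
  have e': "0 \<le> (1 - l) * d + l * e" using e l by simp
  have pos: "?V d > 0" "?V e > 0" "?V ((1 - l) * d + l * e) > 0"
    using vol_parallel_pos[OF K] e e' by auto
  let ?C = "add_set ((\<lambda>x. (1 - l) *\<^sub>R x) ` add_set K (eball n d)) ((\<lambda>x. l *\<^sub>R x) ` add_set K (eball n e))"
  have "?V d powr (1 - l) * ?V e powr l \<le> vol n ?C"
    using k l by (intro brunn_minkowski compact_parallel parallel_subset_rspace) auto
  also have "?C \<subseteq> add_set K (eball n ((1 - l) * d + l * e))"
  proof
    fix x assume "x \<in> ?C"
    then obtain k1 b1 k2 b2 where x: "x = (1 - l) *\<^sub>R (k1 + b1) + l *\<^sub>R (k2 + b2)"
       "k1 \<in> K" "k2 \<in> K" "b1 \<in> eball n d" "b2 \<in> eball n e"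
      by (auto elim!: add_setE)
    have "(1 - l) *\<^sub>R k1 + l *\<^sub>R k2 \<in> K" using convexD[OF k(2) x(2,3), of "1 - l" l] l by auto
    moreover have "(1 - l) *\<^sub>R b1 + l *\<^sub>R b2 \<in> eball n ((1 - l) * d + l * e)"
    proof -
      have "nm n ((1 - l) *\<^sub>R b1 + l *\<^sub>R b2) \<le> (1 - l) * nm n b1 + l * nm n b2"
        using nm_triangle[of "(1 - l) *\<^sub>R b1" "l *\<^sub>R b2" n] l by simp
      also have "\<dots> \<le> (1 - l) * d + l * e" using x(4,5) l by (intro add_mono mult_left_mono) (auto simp: eball_iff)
      finally show ?thesis using x(4,5) by (auto simp: eball_iff)
    qed
    moreover have "x = ((1 - l) *\<^sub>R k1 + l *\<^sub>R k2) + ((1 - l) *\<^sub>R b1 + l *\<^sub>R b2)"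
      unfolding x(1) by (simp only: scaleR_add_right) (simp only: add_ac)
    ultimately show "x \<in> add_set K (eball n ((1 - l) * d + l * e))" by (auto intro: add_setI)
  qed
  then have "vol n ?C \<le> ?V ((1 - l) * d + l * e)"
    using k by (intro vol_mono sets_compact compact_add_set compact_scale_image compact_parallel compact_eball
      parallel_subset_rspace)
  finally have "ln (?V d powr (1 - l) * ?V e powr l) \<le> ln (?V ((1 - l) * d + l * e))"
    using pos by (subst ln_le_cancel_iff) auto
  then show ?thesis using pos by (simp add: ln_mult ln_powr)
qed

lemma tendsto_power_quotient:
  fixes c :: real assumes "c > 0"
  shows "((\<lambda>e. ((1 + e / c) ^ n - 1) / e) \<longlongrightarrow> real n / c) (at_right 0)"
proof -
  have "((\<lambda>e. (1 + e / c) ^ n) has_field_derivative (real n / c)) (at 0 within {0<..})"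
    using assms by (auto intro!: derivative_eq_intros)
  then show ?thesis by (simp add: has_field_derivative_iff)
qed

lemma tendsto_at_right_0_antimono:
  fixes q :: "real \<Rightarrow> real"
  assumes mono: "\<And>s t. 0 < s \<Longrightarrow> s \<le> t \<Longrightarrow> q t \<le> q s" and bd: "\<And>t. 0 < t \<Longrightarrow> q t \<le> C"
  shows "(q \<longlongrightarrow> (SUP t\<in>{0<..}. q t)) (at_right 0)"
proof (rule order_tendstoI)
  let ?S = "SUP t\<in>{0<..}. q t"
  have bdd: "bdd_above (q ` {0<..})" using bd by (auto intro: bdd_aboveI2[of _ _ C])
  fix a assume "a < ?S"
  then obtain t where t: "t > 0" "a < q t" by (subst (asm) less_cSUP_iff[OF _ bdd]) auto
  have "\<forall>\<^sub>F s in at_right 0. 0 < s \<and> s < t" using t(1) by (auto simp: eventually_at_right[OF t(1)])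
  then show "\<forall>\<^sub>F s in at_right 0. a < q s"
    by eventually_elim (use mono[of _ t] t in force)
next
  let ?S = "SUP t\<in>{0<..}. q t"
  have bdd: "bdd_above (q ` {0<..})" using bd by (auto intro: bdd_aboveI2[of _ _ C])
  fix a assume a: "?S < a"
  have "\<forall>\<^sub>F s in at_right (0::real). 0 < s" by (simp add: eventually_at_right_less)
  then show "\<forall>\<^sub>F s in at_right 0. q s < a"
    by eventually_elim (use cSUP_upper[OF _ bdd] a in force)
qed

text \<open>The volume of the parallel body is log-concave in the radius, so its logarithm has a one-sided
  derivative, which is finite because \<open>K\<close> contains a ball.\<close>

lemma surface_area_tendsto:
  assumes K: "cbody n r K"
  shows "((\<lambda>e. (vol n (add_set K (eball n e)) - vol n K) / e) \<longlongrightarrow> surface_area n K) (at_right 0)"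
proof -
  define V where "V = (\<lambda>e. vol n (add_set K (eball n e)))"
  define p where "p = (\<lambda>e. ln (V e))"
  have pos: "V e > 0" if "e \<ge> 0" for e using vol_parallel_pos[OF K that] by (simp add: V_def)
  have r: "r > 0" using cbodyD[OF K] by simp
  have conc: "(p t - p 0) / t \<le> (p s - p 0) / s" if "0 < s" "s \<le> t" for s t
  proof (cases "s = t")
    case False
    define l where "l = s / t"
    have l: "0 < l" "l < 1" using that False by (auto simp: l_def)
    have "(1 - l) * p 0 + l * p t \<le> p s"
      using ln_vol_parallel_concave[OF K, of 0 t l] l that by (simp add: p_def V_def l_def)
    then have "l * (p t - p 0) \<le> p s - p 0" by (simp add: algebra_simps)
    then show ?thesis using that by (simp add: l_def field_simps)
  qed simp
  have bd: "(p t - p 0) / t \<le> real n / r" if "0 < t" for t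
  proof -
    have "V t \<le> (1 + t / r) ^ n * V 0" using vol_parallel_le[OF K, of t] that by (simp add: V_def)
    then have "p t \<le> ln ((1 + t / r) ^ n * V 0)" unfolding p_def
      using pos[of t] pos[of 0] that r by (subst ln_le_cancel_iff) (auto simp: add_pos_nonneg)
    also have "\<dots> = real n * ln (1 + t / r) + p 0"
    proof -
      have "1 + t / r > 0" using that r by (simp add: add_pos_pos)
      then show ?thesis using pos[of 0] by (simp add: p_def ln_mult_pos ln_realpow)
    qed
    also have "\<dots> \<le> real n * (t / r) + p 0"
      using ln_add_one_self_le_self[of "t / r"] that r by (intro add_right_mono mult_left_mono) auto
    finally show ?thesis using that by (simp add: field_simps)
  qed
  obtain D where "((\<lambda>e. (p e - p 0) / e) \<longlongrightarrow> D) (at_right 0)"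
    using tendsto_at_right_0_antimono[of "\<lambda>t. (p t - p 0) / t" "real n / r"] conc bd by blast
  then have "(p has_field_derivative D) (at 0 within {0<..})"
    by (simp add: has_field_derivative_iff)
  then have "((\<lambda>e. exp (p e)) has_field_derivative exp (p 0) * D) (at 0 within {0<..})"
    by (rule DERIV_chain2[OF DERIV_exp])
  then have "((\<lambda>e. (exp (p e) - exp (p 0)) / e) \<longlongrightarrow> exp (p 0) * D) (at_right 0)"
    by (simp add: has_field_derivative_iff)
  then have lim: "((\<lambda>e. (V e - V 0) / e) \<longlongrightarrow> exp (p 0) * D) (at_right 0)"
  proof (rule Lim_transform_eventually)
    have "\<forall>\<^sub>F s in at_right (0::real). 0 < s" by (simp add: eventually_at_right_less)
    then show "\<forall>\<^sub>F e in at_right 0. (exp (p e) - exp (p 0)) / e = (V e - V 0) / e"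
      by eventually_elim (use pos in \<open>simp add: p_def\<close>)
  qed
  then have "surface_area n K = exp (p 0) * D"
    unfolding surface_area_def by (intro tendsto_Lim) (auto simp: V_def)
  then show ?thesis using lim by (simp add: V_def)
qed

lemma surface_area_nonneg:
  assumes K: "cbody n r K" shows "surface_area n K \<ge> 0"
proof (rule tendsto_lowerbound[OF surface_area_tendsto[OF K]])
  have "\<forall>\<^sub>F s in at_right (0::real). 0 < s" by (simp add: eventually_at_right_less)
  then show "\<forall>\<^sub>F e in at_right 0. 0 \<le> (vol n (add_set K (eball n e)) - vol n K) / e"
    by eventually_elim (use vol_parallel_mono[OF K, of 0] in simp)
qed simp

text \<open>The derivative at 0 of the homothety bound for the parallel volume. It is the bridge
  from inradius bounds to bounds on the surface area.\<close>

lemma surface_area_le_vol: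
  assumes K: "cbody n r K"
  shows "surface_area n K \<le> real n / r * vol n K"
proof (rule tendsto_le[OF _ _ surface_area_tendsto[OF K]])
  have r: "r > 0" using cbodyD[OF K] by simp
  show "((\<lambda>e. ((1 + e / r) ^ n - 1) / e * vol n K) \<longlongrightarrow> real n / r * vol n K) (at_right 0)"
    by (intro tendsto_mult tendsto_power_quotient r tendsto_const)
  have "\<forall>\<^sub>F s in at_right (0::real). 0 < s" by (simp add: eventually_at_right_less)
  then show "\<forall>\<^sub>F e in at_right 0. (vol n (add_set K (eball n e)) - vol n K) / e \<le> ((1 + e / r) ^ n - 1) / e * vol n K"
  proof eventually_elim
    case (elim e)
    then show ?case using vol_parallel_le[OF K, of e] by (simp add: divide_right_mono algebra_simps)
  qed
qed simp

text \<open>\<open>\<rho>\<close> is the radius for which the inscribed cube of the ball has the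
  volume of K. Then K + eB is the combination of (1 + e/\<rho>) K and the ball of radius \<rho> + e
  = (1 + e/\<rho>) \<rho> with weight l = e / (\<rho> + e). Both have volume at least (1 +
  e/\<rho>)^n |K|, so their geometric mean has this lower bound too.\<close>

lemma vol_parallel_ge:
  assumes K: "cbody n r K" and n: "n \<ge> 1" and e: "e > 0"
  defines "\<rho> \<equiv> vol n K powr (1 / real n) * sqrt (real n) / 2"
  shows "(1 + e / \<rho>) ^ n * vol n K \<le> vol n (add_set K (eball n e))"
proof -
  note k = cbodyD[OF K]
  have vp: "vol n K > 0" by (rule vol_cbody_pos[OF K])
  have \<rho>: "\<rho> > 0" using vp n by (simp add: \<rho>_def)
  define l where "l = e / (\<rho> + e)"
  have l: "0 < l" "l < 1" "1 - l = \<rho> / (\<rho> + e)" using e \<rho> by (simp_all add: l_def divide_simps)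
  have il: "1 / (1 - l) = 1 + e / \<rho>" using \<rho> e unfolding l(3) by (simp add: divide_simps)
  let ?A = "(\<lambda>x. (1 + e / \<rho>) *\<^sub>R x) ` K" and ?B = "eball n (\<rho> + e)"
  have t: "1 + e / \<rho> > 0" using \<rho> e by (simp add: add_pos_pos)
  have A: "vol n ?A = (1 + e / \<rho>) ^ n * vol n K" using t k by (intro vol_scale) auto
  have B: "vol n ?B \<ge> (1 + e / \<rho>) ^ n * vol n K"
  proof -
    have eq: "2 * (\<rho> + e) / sqrt (real n) = (1 + e / \<rho>) * vol n K powr (1 / real n)"
    proof -
      have "2 * \<rho> / sqrt (real n) = vol n K powr (1 / real n)" using n by (simp add: \<rho>_def)
      moreover have "(1 + e / \<rho>) * \<rho> = \<rho> + e" using \<rho> by (simp add: field_simps)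
      then have "2 * (\<rho> + e) / sqrt (real n) = (1 + e / \<rho>) * (2 * \<rho> / sqrt (real n))"
        by (metis mult.assoc mult.left_commute times_divide_eq_right)
      ultimately show ?thesis by simp
    qed
    have "(vol n K powr (1 / real n)) ^ n = vol n K"
      using vp n by (simp add: powr_realpow[symmetric] powr_powr)
    then have "(1 + e / \<rho>) ^ n * vol n K = (2 * (\<rho> + e) / sqrt (real n)) ^ n"
      unfolding eq by (simp add: power_mult_distrib)
    also have "\<dots> \<le> vol n ?B" using \<rho> e by (intro vol_eball_ge) auto
    finally show ?thesis .
  qed
  let ?w = "(1 + e / \<rho>) ^ n * vol n K"
  have w: "?w > 0" using t vp by simp
  have "?w = ?w powr (1 - l) * ?w powr l" using w by (simp add: powr_add[symmetric])
  also have "\<dots> \<le> vol n ?A powr (1 - l) * vol n ?B powr l"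
    using A B w l by (intro mult_mono powr_mono2) auto
  also have "\<dots> \<le> vol n (add_set ((\<lambda>x. (1 - l) *\<^sub>R x) ` ?A) ((\<lambda>x. l *\<^sub>R x) ` ?B))"
    using k l by (intro brunn_minkowski compact_scale_image compact_eball eball_subset_rspace) auto
  also have "(\<lambda>x. (1 - l) *\<^sub>R x) ` ?A = K"
  proof -
    have "(1 - l) * (1 + e / \<rho>) = 1" unfolding il[symmetric] using l(1,2) by simp
    then show ?thesis by (simp add: image_image)
  qed
  also have "(\<lambda>x. l *\<^sub>R x) ` ?B = eball n e"
  proof -
    have "l * (\<rho> + e) = e" using \<rho> e by (simp add: l_def)
    then show ?thesis using l by (simp only: scale_eball)
  qed
  finally show ?thesis .
qed

text \<open>The derivative of the preceding bound at e = 0. The constant 2 reflects the replacement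
  of the ball by its inscribed cube.\<close>

lemma isoperimetric:
  assumes K: "cbody n r K" and n: "n \<ge> 1"
  shows "2 * sqrt (real n) * vol n K powr (1 - 1 / real n) \<le> surface_area n K"
proof -
  define \<rho> where "\<rho> = vol n K powr (1 / real n) * sqrt (real n) / 2"
  have vp: "vol n K > 0" by (rule vol_cbody_pos[OF K])
  have \<rho>: "\<rho> > 0" using vp n by (simp add: \<rho>_def)
  have "real n / \<rho> * vol n K \<le> surface_area n K"
  proof (rule tendsto_le[OF _ surface_area_tendsto[OF K]])
    show "((\<lambda>e. ((1 + e / \<rho>) ^ n - 1) / e * vol n K) \<longlongrightarrow> real n / \<rho> * vol n K) (at_right 0)"
      by (intro tendsto_mult tendsto_power_quotient \<rho> tendsto_const)
    have "\<forall>\<^sub>F s in at_right (0::real). 0 < s" by (simp add: eventually_at_right_less)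
    then show "\<forall>\<^sub>F e in at_right 0. ((1 + e / \<rho>) ^ n - 1) / e * vol n K \<le> (vol n (add_set K (eball n e)) - vol n K) / e"
    proof eventually_elim
      case (elim e)
      then show ?case using vol_parallel_ge[OF K n, of e]
        by (simp add: divide_right_mono algebra_simps \<rho>_def)
    qed
  qed simp
  moreover have "real n / \<rho> * vol n K = 2 * sqrt (real n) * vol n K powr (1 - 1 / real n)"
  proof -
    have "vol n K powr (1 - 1 / real n) = vol n K / vol n K powr (1 / real n)"
      using vp by (simp add: powr_diff)
    moreover have "real n = sqrt (real n) * sqrt (real n)" by simp
    ultimately show ?thesis using vp n by (simp add: \<rho>_def field_simps)
  qed
  ultimately show ?thesis by simp
qed

section \<open>Orthonormal coordinates and projections\<close>

definition orthonormal :: "nat \<Rightarrow> (nat \<Rightarrow> nat \<Rightarrow> real) \<Rightarrow> bool" where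
  "orthonormal n b \<longleftrightarrow> (\<forall>j<n. b j \<in> rspace n) \<and> (\<forall>j<n. \<forall>k<n. ip n (b j) (b k) = (if j = k then 1 else 0))"

text \<open>For orthonormal b and m = n this is an isometry of \<open>rspace n\<close>; for m < n it
  is the projection onto the span of the first m vectors, read in coordinates.\<close>

definition coords :: "nat \<Rightarrow> nat \<Rightarrow> (nat \<Rightarrow> nat \<Rightarrow> real) \<Rightarrow> (nat \<Rightarrow> real) \<Rightarrow> nat \<Rightarrow> real" where
  "coords m n b x = (\<lambda>j. if j < m then ip n x (b j) else 0)"

definition combi :: "nat \<Rightarrow> (nat \<Rightarrow> nat \<Rightarrow> real) \<Rightarrow> (nat \<Rightarrow> real) \<Rightarrow> nat \<Rightarrow> real" where
  "combi n b y = (\<Sum>j<n. y j *\<^sub>R b j)"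

lemma coords_rspace [simp]: "coords m n b x \<in> rspace m"
  by (simp add: coords_def rspace_iff)

lemma coords_linear:
  "coords m n b (x + y) = coords m n b x + coords m n b y"
  "coords m n b (c *\<^sub>R x) = c *\<^sub>R coords m n b x"
  by (simp_all add: coords_def fun_eq_iff ip_simps fun_apply)

lemma convex_coords:
  assumes "convex K" shows "convex (coords m n b ` K)"
proof (rule convexI)
  fix x y and u v :: real
  assume *: "x \<in> coords m n b ` K" "y \<in> coords m n b ` K" "0 \<le> u" "0 \<le> v" "u + v = 1"
  then obtain x' y' where xy: "x' \<in> K" "x = coords m n b x'" "y' \<in> K" "y = coords m n b y'" by auto
  have "u *\<^sub>R x + v *\<^sub>R y = coords m n b (u *\<^sub>R x' + v *\<^sub>R y')" by (simp only: xy coords_linear)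
  then show "u *\<^sub>R x + v *\<^sub>R y \<in> coords m n b ` K"
    using convexD[OF assms xy(1,3) *(3-5)] by (metis image_eqI)
qed

lemma combi_linear:
  "combi n b (x + y) = combi n b x + combi n b y"
  by (simp add: combi_def fun_apply scaleR_add_left sum.distrib)

lemma combi_rspace: "orthonormal n b \<Longrightarrow> combi n b y \<in> rspace n"
  unfolding combi_def orthonormal_def by (intro rspace_sum) auto

lemma measurable_coords [measurable]: "coords m n b \<in> borel_measurable borel"
  unfolding coords_def by (rule measurable_funI) measurable

lemma measurable_combi [measurable]: "combi n b \<in> borel_measurable borel"
proof (rule measurable_funI)
  fix i
  have "(\<lambda>y. combi n b y i) = (\<lambda>y. \<Sum>j<n. y j * b j i)" by (simp add: combi_def sum_fun_apply fun_apply)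
  then show "(\<lambda>y. combi n b y i) \<in> borel_measurable borel" by simp
qed

lemma continuous_on_coords: "continuous_on S (coords m n b)"
proof (rule continuous_on_coordinatewise_then_product)
  fix i
  have "continuous_on S (\<lambda>x. ip n x (b i))" by (intro fun_cont)
  then show "continuous_on S (\<lambda>x. coords m n b x i)" by (cases "i < m") (auto simp: coords_def)
qed

lemma ip_combi:
  assumes "orthonormal n b" shows "ip n (combi n b y) (combi n b z) = ip n y z"
proof -
  have "ip n (combi n b y) (combi n b z) = (\<Sum>k<n. \<Sum>j<n. z k * (y j * ip n (b j) (b k)))"
    unfolding combi_def ip_sum_left ip_sum_right ip_scale_left ip_scale_right by (simp add: sum_distrib_left)
  also have "\<dots> = (\<Sum>k<n. \<Sum>j<n. if j = k then y j * z k else 0)"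
    using assms by (intro sum.cong refl) (auto simp: orthonormal_def)
  also have "\<dots> = ip n y z" by (simp add: ip_def)
  finally show ?thesis .
qed

lemma nm_combi: "orthonormal n b \<Longrightarrow> nm n (combi n b y) = nm n y"
  by (simp only: nm_eq_sqrt ip_combi)

lemma coords_combi:
  assumes b: "orthonormal n b" and y: "y \<in> rspace n"
  shows "coords n n b (combi n b y) = y"
proof
  fix i
  have "ip n (combi n b y) (b i) = y i" if "i < n"
  proof -
    have "ip n (combi n b y) (b i) = (\<Sum>j<n. y j * ip n (b j) (b i))"
      by (simp add: combi_def ip_sum_left ip_scale_left)
    also have "\<dots> = (\<Sum>j<n. if j = i then y j else 0)"
      using b that by (intro sum.cong refl) (auto simp: orthonormal_def)
    also have "\<dots> = y i" using that by simp
    finally show ?thesis .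
  qed
  then show "coords n n b (combi n b y) i = y i" using rspaceD[OF y] by (simp add: coords_def)
qed

text \<open>Completeness of n orthonormal vectors: with the vectors as rows of B, orthonormality
  says that the transpose C is a right inverse, and for square matrices it is then a left inverse as
  well.\<close>

lemma combi_coords:
  assumes b: "orthonormal n b" and x: "x \<in> rspace n"
  shows "combi n b (coords n n b x) = x"
proof
  fix i
  define B where "B = mat n n (\<lambda>(j, k). b j k)"
  define C where "C = mat n n (\<lambda>(k, j). b j k)"
  have BC: "B * C = 1\<^sub>m n"
  proof (rule eq_matI)
    fix j k assume "j < dim_row (1\<^sub>m n)" "k < dim_col (1\<^sub>m n)"
    then have jk: "j < n" "k < n" by auto
    then have "(B * C) $$ (j, k) = (\<Sum>i = 0..<n. b j i * b k i)"
      by (simp add: B_def C_def scalar_prod_def)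
    also have "\<dots> = ip n (b j) (b k)" by (simp add: ip_def atLeast0LessThan)
    finally show "(B * C) $$ (j, k) = 1\<^sub>m n $$ (j, k)" using b jk by (simp add: orthonormal_def)
  qed (auto simp: B_def C_def)
  have CB: "C * B = 1\<^sub>m n"
    by (rule mat_mult_left_right_inverse[OF _ _ BC]) (auto simp: B_def C_def)
  show "combi n b (coords n n b x) i = x i"
  proof (cases "i < n")
    case True
    have d: "(\<Sum>j<n. b j k * b j i) = (if k = i then 1 else 0)" if "k < n" for k
    proof -
      have "(C * B) $$ (k, i) = (\<Sum>j = 0..<n. b j k * b j i)"
        using that True by (simp add: B_def C_def scalar_prod_def)
      then show ?thesis using CB that True by (simp add: atLeast0LessThan)
    qed
    have "combi n b (coords n n b x) i = (\<Sum>j<n. (\<Sum>k<n. x k * b j k) * b j i)"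
      by (simp add: combi_def sum_fun_apply fun_apply coords_def ip_def)
    also have "\<dots> = (\<Sum>k<n. x k * (\<Sum>j<n. b j k * b j i))"
      by (simp add: sum_distrib_left sum_distrib_right mult.assoc) (rule sum.swap)
    also have "\<dots> = (\<Sum>k<n. if k = i then x k else 0)" by (intro sum.cong refl) (simp add: d)
    also have "\<dots> = x i" using True by simp
    finally show ?thesis .
  next
    case False
    then show ?thesis using rspaceD[OF x] rspaceD[OF combi_rspace[OF b]] by auto
  qed
qed

lemma nm_coords: "orthonormal n b \<Longrightarrow> x \<in> rspace n \<Longrightarrow> nm n (coords n n b x) = nm n x"
  using nm_combi[of n b "coords n n b x"] combi_coords[of n b x] by simp

lemma distr_coords: "orthonormal n b \<Longrightarrow> distr (lebn n) borel (coords n n b) = lebn n"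
  by (rule distr_lebn_isometry[where V="combi n b"])
     (auto simp: coords_linear combi_linear combi_rspace coords_combi combi_coords nm_coords)

lemma distr_combi: "orthonormal n b \<Longrightarrow> distr (lebn n) borel (combi n b) = lebn n"
  by (rule distr_lebn_isometry[where V="coords n n b"])
     (auto simp: coords_linear combi_linear combi_rspace coords_combi combi_coords nm_combi)

lemma emeasure_distr_eq:
  assumes "distr (lebn n) borel U = lebn n" and [measurable]: "U \<in> borel_measurable borel" "A \<in> sets borel"
  shows "emeasure (lebn n) {x. U x \<in> A} = emeasure (lebn n) A"
proof -
  have "emeasure (lebn n) A = emeasure (distr (lebn n) borel U) A" using assms(1) by simp
  also have "\<dots> = emeasure (lebn n) {x. U x \<in> A}" by (simp add: emeasure_distr vimage_def)
  finally show ?thesis by simp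
qed

lemma compact_coords: "compact K \<Longrightarrow> compact (coords m n b ` K)"
  by (intro compact_continuous_image continuous_on_coords)

lemma vol_coords:
  assumes b: "orthonormal n b" and K: "compact K" "K \<subseteq> rspace n"
  shows "vol n (coords n n b ` K) = vol n K"
proof -
  note [measurable] = sets_compact[OF K(1)] sets_compact[OF compact_coords[OF K(1), of n n b]]
  have "emeasure (lebn n) (coords n n b ` K) = emeasure (lebn n) {x. combi n b x \<in> K}"
  proof (rule emeasure_eq_AE)
    show "AE x in lebn n. x \<in> coords n n b ` K \<longleftrightarrow> x \<in> {x. combi n b x \<in> K}"
      using AE_rspace
    proof eventually_elim
      case (elim x)
      show ?case
      proof
        assume "x \<in> coords n n b ` K"
        then show "x \<in> {x. combi n b x \<in> K}" using K combi_coords[OF b] by auto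
      next
        assume "x \<in> {x. combi n b x \<in> K}"
        then show "x \<in> coords n n b ` K" using coords_combi[OF b elim] by (metis image_eqI mem_Collect_eq)
      qed
    qed
  qed measurable
  also have "\<dots> = emeasure (lebn n) K"
    by (rule emeasure_distr_eq[OF distr_combi[OF b]]) measurable
  finally show ?thesis by (simp add: vol_def measure_def)
qed

subsection \<open>Reflections\<close>

text \<open>For \<open>v = 0\<close> the quotient is \<open>0\<close> and the map is the identity.\<close>

definition mirror :: "nat \<Rightarrow> (nat \<Rightarrow> real) \<Rightarrow> (nat \<Rightarrow> real) \<Rightarrow> nat \<Rightarrow> real" where
  "mirror n v x = x - (2 * ip n v x / ip n v v) *\<^sub>R v"

lemma ip_mirror: "ip n (mirror n v x) (mirror n v y) = ip n x y"
proof (cases "ip n v v = 0")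
  case False
  then show ?thesis
    by (simp add: mirror_def ip_simps ip_commute[of n x v] right_diff_distrib left_diff_distrib)
qed (simp add: mirror_def)

lemma mirror_rspace: "v \<in> rspace n \<Longrightarrow> x \<in> rspace n \<Longrightarrow> mirror n v x \<in> rspace n"
  by (auto simp: mirror_def)

lemma mirror_add: "mirror n v (x + y) = mirror n v x + mirror n v y"
  by (simp add: mirror_def ip_simps distrib_left add_divide_distrib scaleR_add_left algebra_simps)

lemma mirror_mirror: "mirror n v (mirror n v x) = x"
  by (cases "ip n v v = 0")
     (simp_all add: mirror_def ip_simps diff_divide_distrib scaleR_diff_left algebra_simps)

lemma nm_mirror: "nm n (mirror n v x) = nm n x"
  by (simp only: nm_eq_sqrt ip_mirror)

lemma measurable_mirror [measurable]: "mirror n v \<in> borel_measurable borel"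
  unfolding mirror_def by measurable

lemma distr_mirror: "v \<in> rspace n \<Longrightarrow> distr (lebn n) borel (mirror n v) = lebn n"
  by (rule distr_lebn_isometry[where V="mirror n v"])
     (auto simp: mirror_add mirror_mirror nm_mirror mirror_rspace)

text \<open>The Householder reflection exchanging the last standard unit vector and u carries the
  standard basis to one that ends in u. If the two vectors agree, then v = 0 and the reflection is
  the identity.\<close>

lemma orthonormal_exists:
  assumes u: "u \<in> usphere n" and n: "n \<ge> 1"
  obtains b where "orthonormal n b" "b (n - 1) = u"
proof
  define e :: "nat \<Rightarrow> nat \<Rightarrow> real" where "e = (\<lambda>i j. if j = i then 1 else 0)"
  have ipe: "ip n x (e i) = x i" if "i < n" for x i
    using that by (simp add: ip_def e_def if_distrib cong: if_cong)
  have er: "e i \<in> rspace n" if "i < n" for i using that by (simp add: rspace_iff e_def)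
  define v where "v = u - e (n - 1)"
  have v: "v \<in> rspace n" using u er[of "n - 1"] n by (auto simp: v_def usphere_iff)
  define b where "b = (\<lambda>j. mirror n v (e j))"
  have "ip n (b j) (b k) = (if j = k then 1 else 0)" if "j < n" "k < n" for j k
    unfolding b_def ip_mirror using that by (auto simp: ipe) (auto simp: e_def)
  then show "orthonormal n b" unfolding orthonormal_def b_def using mirror_rspace[OF v er] by auto
  have vv: "ip n v v = 2 * (1 - u (n - 1))"
    using n usphere_ip[OF u] ip_commute[of n "e (n - 1)" u] unfolding v_def
    by (simp add: ip_simps ipe) (simp add: e_def)
  have ve: "ip n v (e (n - 1)) = u (n - 1) - 1"
    using n by (simp add: ipe v_def fun_apply) (simp add: e_def)
  show "b (n - 1) = u"
  proof (cases "u (n - 1) = 1")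
    case True
    then have "nm n v = 0" using vv by (simp add: nm_eq_sqrt)
    then have "v = 0" using nm_eq_0[OF v] by simp
    then show ?thesis by (simp add: b_def mirror_def v_def)
  next
    case False
    then have "2 * ip n v (e (n - 1)) / ip n v v = - 1" unfolding vv ve by (simp add: divide_simps)
    then show ?thesis by (simp add: b_def mirror_def) (simp add: v_def)
  qed
qed

subsection \<open>Volume of the sum with a segment\<close>

definition seg :: "(nat \<Rightarrow> real) \<Rightarrow> real \<Rightarrow> (nat \<Rightarrow> real) set" where
  "seg \<xi> e = (\<lambda>s. s *\<^sub>R \<xi>) ` {-e..e}"

lemma compact_seg: "compact (seg \<xi> e)"
  unfolding seg_def by (intro compact_continuous_image fun_cont) auto

lemma seg_subset_rspace: "\<xi> \<in> rspace n \<Longrightarrow> seg \<xi> e \<subseteq> rspace n"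
  by (auto simp: seg_def)

text \<open>Fubini in the last coordinate: over a point of the shadow \<open>?H\<close> the fibre of
  L is a nonempty compact interval, which the segment lengthens by e at either end; empty fibres
  stay empty.\<close>

lemma vol_vertical_segment:
  assumes L: "compact L" "convex L" "L \<subseteq> rspace (Suc m)" and e: "e \<ge> 0"
  shows "vol (Suc m) {x(m := x m + s) | x s. x \<in> L \<and> \<bar>s\<bar> \<le> e} =
    vol (Suc m) L + 2 * e * vol m ((\<lambda>x. x(m := 0)) ` L)"
proof -
  let ?S = "{x(m := x m + s) | x s. x \<in> L \<and> \<bar>s\<bar> \<le> e}" and ?H = "(\<lambda>x. x(m := 0)) ` L"
  have contu: "continuous_on T (\<lambda>p. (f p)(m := g p))"
    if "continuous_on T f" "continuous_on T g" for T :: "'b::topological_space set" and f :: "'b \<Rightarrow> nat \<Rightarrow> real" and g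
  proof (rule continuous_on_coordinatewise_then_product)
    fix i show "continuous_on T (\<lambda>p. ((f p)(m := g p)) i)"
      using that continuous_on_fun_apply[OF that(1), of i] by (cases "i = m") auto
  qed
  have S: "?S = (\<lambda>(x, s). x(m := x m + s)) ` (L \<times> {-e..e})"
    by (auto simp: image_iff abs_le_iff minus_le_iff Bex_def) blast
  have "compact ?S" unfolding S case_prod_unfold
    by (intro compact_continuous_image contu continuous_on_add continuous_on_fun_apply[OF continuous_on_fst]
      fun_cont compact_Times L(1)) auto
  moreover have "?S \<subseteq> rspace (Suc m)" using L(3) by (auto simp: rspace_iff)
  ultimately have cS: "compact ?S" "?S \<subseteq> rspace (Suc m)" by auto
  have "?H \<subseteq> rspace m"
  proof
    fix y assume "y \<in> ?H"
    then obtain x where "x \<in> rspace (Suc m)" "y = x(m := 0)" using L(3) by auto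
    then show "y \<in> rspace m" by (auto simp: rspace_iff)
  qed
  moreover have "compact ?H" by (intro compact_continuous_image contu fun_cont L(1))
  ultimately have cH: "compact ?H" "?H \<subseteq> rspace m" by auto
  note [measurable] = sets_compact[OF L(1)] sets_compact[OF cS(1)] sets_compact[OF cH(1)]
  obtain R where R: "L \<subseteq> eball (Suc m) R" using eball_bounds[OF L(1,3)] by blast
  have sect: "emeasure lborel {t. y(m := t) \<in> ?S} = emeasure lborel {t. y(m := t) \<in> L} + ennreal (2 * e) * indicator ?H y"
    if y: "y \<in> rspace m" for y
  proof (cases "y \<in> ?H")
    case True
    let ?T = "{t. y(m := t) \<in> L}"
    have "convex ?T"
    proof (rule convexI)
      fix s t u v :: real assume *: "s \<in> ?T" "t \<in> ?T" "0 \<le> u" "0 \<le> v" "u + v = 1"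
      have "y(m := u *\<^sub>R s + v *\<^sub>R t) = u *\<^sub>R y(m := s) + v *\<^sub>R y(m := t)"
        using * by (auto simp: fun_eq_iff fun_apply distrib_right[symmetric])
      then show "u *\<^sub>R s + v *\<^sub>R t \<in> ?T" using convexD[OF L(2), of "y(m := s)" "y(m := t)" u v] * by simp
    qed
    moreover have "closed ?T"
    proof -
      have "closed ((\<lambda>t. y(m := t)) -` L)"
        by (rule closed_vimage[OF compact_imp_closed[OF L(1)] contu[OF continuous_on_const continuous_on_id]])
      then show ?thesis by (simp add: vimage_def)
    qed
    moreover have "bounded ?T"
    proof -
      have "\<bar>t\<bar> \<le> R" if "t \<in> ?T" for t
      proof -
        have "\<bar>(y(m := t)) m\<bar> \<le> nm (Suc m) (y(m := t))" by (rule abs_le_nm) simp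
        then show ?thesis using that R by (auto simp: eball_iff)
      qed
      then show ?thesis by (auto simp: bounded_iff)
    qed
    ultimately obtain a b where ab: "?T = {a..b}"
      using connected_compact_interval_1[of ?T] convex_connected compact_eq_bounded_closed by blast
    obtain x where x: "x \<in> L" "y = x(m := 0)" using True by auto
    then have "x m \<in> ?T" by simp
    then have abl: "a \<le> b" using ab by auto
    have "{t. y(m := t) \<in> ?S} = {a - e..b + e}"
    proof (intro equalityI subsetI)
      fix t assume "t \<in> {t. y(m := t) \<in> ?S}"
      then obtain x s where xs: "y(m := t) = x(m := x m + s)" "x \<in> L" "\<bar>s\<bar> \<le> e" by auto
      then have "t = x m + s" by (metis fun_upd_same)
      moreover have "y(m := x m) = x"
        using xs(1) by (metis fun_upd_triv fun_upd_upd)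
      ultimately have "t - s \<in> ?T" using xs(2) by simp
      then show "t \<in> {a - e..b + e}" using ab xs(3) by auto
    next
      fix t assume t: "t \<in> {a - e..b + e}"
      \<comment> \<open>The signed displacement of t from its nearest point in [a, b].\<close>
      define s where "s = (if t < a then t - a else if t > b then t - b else 0)"
      have s: "\<bar>s\<bar> \<le> e" "t - s \<in> {a..b}" using t abl e by (auto simp: s_def)
      have "y(m := t - s) \<in> L" using s(2) unfolding ab[symmetric] by simp
      moreover have "y(m := t) = (y(m := t - s))(m := (y(m := t - s)) m + s)" by simp
      ultimately show "t \<in> {t. y(m := t) \<in> ?S}" using s(1) by blast
    qed
    then show ?thesis using ab abl e True by (simp add: ennreal_plus[symmetric] del: ennreal_plus)
  next
    case False
    have "y = (y(m := t))(m := 0)" for t using rspaceD[OF y, of m] by (auto simp: fun_eq_iff)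
    then have n: "y(m := t) \<notin> L" for t using False by (metis imageI)
    have "y(m := t) \<notin> ?S" for t
    proof
      assume "y(m := t) \<in> ?S"
      then obtain x s where "y(m := t) = x(m := x m + s)" "x \<in> L" by auto
      then have "y(m := x m) \<in> L" by (metis fun_upd_triv fun_upd_upd)
      then show False using n by blast
    qed
    then have "{t. y(m := t) \<in> ?S} = {}" "{t. y(m := t) \<in> L} = {}" using n by blast+
    then show ?thesis using False by (simp only: emeasure_empty) simp
  qed
  have "emeasure (lebn (Suc m)) ?S = (\<integral>\<^sup>+y. emeasure lborel {t. y(m := t) \<in> ?S} \<partial>lebn m)"
    by (rule emeasure_lebn_Suc) measurable
  also have "\<dots> = (\<integral>\<^sup>+y. emeasure lborel {t. y(m := t) \<in> L} + ennreal (2 * e) * indicator ?H y \<partial>lebn m)"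
  proof (rule nn_integral_cong_AE)
    show "AE y in lebn m. emeasure lborel {t. y(m := t) \<in> ?S} =
        emeasure lborel {t. y(m := t) \<in> L} + ennreal (2 * e) * indicator ?H y"
      using AE_rspace[of m] by eventually_elim (rule sect)
  qed
  also have "\<dots> = (\<integral>\<^sup>+y. emeasure lborel {t. y(m := t) \<in> L} \<partial>lebn m) + ennreal (2 * e) * emeasure (lebn m) ?H"
  proof (subst nn_integral_add)
    have "(\<lambda>y. emeasure lborel (Pair y -` {p. (fst p)(m := snd p) \<in> L})) \<in> borel_measurable (lebn m)"
    proof (rule lborel.measurable_emeasure_Pair)
      have "{p \<in> space (lebn m \<Otimes>\<^sub>M lborel). (fst p)(m := snd p) \<in> L} \<in> sets (lebn m \<Otimes>\<^sub>M lborel)" by measurable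
      then show "{p. (fst p)(m := snd p) \<in> L} \<in> sets (lebn m \<Otimes>\<^sub>M lborel)" by (simp add: space_pair_measure)
    qed
    then show "(\<lambda>y. emeasure lborel {t. y(m := t) \<in> L}) \<in> borel_measurable (lebn m)" by (simp add: vimage_def)
  qed (simp_all add: nn_integral_cmult)
  also have "(\<integral>\<^sup>+y. emeasure lborel {t. y(m := t) \<in> L} \<partial>lebn m) = emeasure (lebn (Suc m)) L"
    by (rule emeasure_lebn_Suc[symmetric]) measurable
  finally have "ennreal (vol (Suc m) ?S) = ennreal (vol (Suc m) L + 2 * e * vol m ?H)"
    unfolding emeasure_eq_vol[OF cS] emeasure_eq_vol[OF cH] emeasure_eq_vol[OF L(1,3)]
    using e by (simp add: ennreal_mult)
  then show ?thesis using e by (subst (asm) ennreal_inj) auto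
qed

lemma vol_add_seg:
  assumes b: "orthonormal (Suc m) b" and K: "compact K" "convex K" "K \<subseteq> rspace (Suc m)" and e: "e \<ge> 0"
  shows "vol (Suc m) (add_set K (seg (b m) e)) = vol (Suc m) K + 2 * e * vol m (coords m (Suc m) b ` K)"
proof -
  let ?c = "coords (Suc m) (Suc m) b"
  let ?L = "?c ` K"
  have bm: "b m \<in> rspace (Suc m)" using b by (simp add: orthonormal_def)
  have L: "compact ?L" "?L \<subseteq> rspace (Suc m)" using K by (auto intro: compact_coords)
  have cL: "convex ?L" by (rule convex_coords[OF K(2)])
  have cb: "?c (x + s *\<^sub>R b m) = (?c x)(m := ?c x m + s)" for x s
  proof
    fix i show "?c (x + s *\<^sub>R b m) i = ((?c x)(m := ?c x m + s)) i"
      using b by (auto simp: coords_def ip_simps orthonormal_def)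
  qed
  have "vol (Suc m) (add_set K (seg (b m) e)) = vol (Suc m) (?c ` add_set K (seg (b m) e))"
    by (rule vol_coords[OF b, symmetric])
       (intro compact_add_set K compact_seg add_set_rspace seg_subset_rspace bm)+
  also have "?c ` add_set K (seg (b m) e) = {x(m := x m + s) | x s. x \<in> ?L \<and> \<bar>s\<bar> \<le> e}"
  proof (intro equalityI subsetI)
    fix z assume "z \<in> ?c ` add_set K (seg (b m) e)"
    then obtain k s where ks: "k \<in> K" "s \<in> {-e..e}" "z = ?c (k + s *\<^sub>R b m)" by (auto simp: seg_def add_set_eq)
    then have "\<bar>s\<bar> \<le> e" by auto
    then show "z \<in> {x(m := x m + s) | x s. x \<in> ?L \<and> \<bar>s\<bar> \<le> e}" using ks cb by blast
  next
    fix z assume "z \<in> {x(m := x m + s) | x s. x \<in> ?L \<and> \<bar>s\<bar> \<le> e}"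
    then obtain k s where ks: "k \<in> K" "\<bar>s\<bar> \<le> e" "z = (?c k)(m := ?c k m + s)" by auto
    then have "z = ?c (k + s *\<^sub>R b m)" using cb by simp
    moreover have "s *\<^sub>R b m \<in> seg (b m) e" using ks(2) unfolding seg_def by (intro imageI) auto
    ultimately show "z \<in> ?c ` add_set K (seg (b m) e)" using ks(1) by (blast intro: add_setI)
  qed
  also have "vol (Suc m) \<dots> = vol (Suc m) ?L + 2 * e * vol m ((\<lambda>x. x(m := 0)) ` ?L)"
    by (rule vol_vertical_segment[OF L(1) cL L(2) e])
  also have "(\<lambda>x. x(m := 0)) ` ?L = coords m (Suc m) b ` K"
  proof -
    have "(?c x)(m := 0) = coords m (Suc m) b x" for x by (auto simp: coords_def fun_eq_iff)
    then show ?thesis by (simp add: image_image)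
  qed
  finally show ?thesis using vol_coords[OF b K(1,3)] by simp
qed

subsection \<open>Projections of convex bodies\<close>

lemma coords_image_add_set: "coords m n b ` add_set A B = add_set (coords m n b ` A) (coords m n b ` B)"
proof (intro equalityI subsetI)
  fix x assume "x \<in> coords m n b ` add_set A B"
  then obtain y z where "y \<in> A" "z \<in> B" "x = coords m n b (y + z)" by (auto simp: add_set_eq)
  then show "x \<in> add_set (coords m n b ` A) (coords m n b ` B)" by (auto simp: coords_linear intro: add_setI)
next
  fix x assume "x \<in> add_set (coords m n b ` A) (coords m n b ` B)"
  then obtain y z where "y \<in> A" "z \<in> B" "x = coords m n b (y + z)" by (auto simp: add_set_eq coords_linear)
  then show "x \<in> coords m n b ` add_set A B" by (auto intro: add_setI)
qed

lemma coords_image_eball: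
  assumes b: "orthonormal n b" and m: "m \<le> n"
  shows "coords m n b ` eball n r = eball m r"
proof (intro equalityI subsetI)
  fix y assume "y \<in> coords m n b ` eball n r"
  then obtain x where x: "x \<in> eball n r" "y = coords m n b x" by auto
  have "nm m y \<le> nm n (coords n n b x)" unfolding x(2) L2_set_def
  proof (rule real_sqrt_le_mono)
    have "(\<Sum>i<m. (coords m n b x i)\<^sup>2) = (\<Sum>i<m. (coords n n b x i)\<^sup>2)"
      using m by (intro sum.cong refl) (auto simp: coords_def)
    also have "\<dots> \<le> (\<Sum>i<n. (coords n n b x i)\<^sup>2)" using m by (intro sum_mono2) auto
    finally show "(\<Sum>i<m. (coords m n b x i)\<^sup>2) \<le> (\<Sum>i<n. (coords n n b x i)\<^sup>2)" .
  qed
  then show "y \<in> eball m r" using x nm_coords[OF b, of x] by (auto simp: eball_iff)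
next
  fix y assume y: "y \<in> eball m r"
  then have yn: "y \<in> rspace n" using m by (auto simp: eball_iff rspace_iff)
  have "nm n y = nm m y" unfolding L2_set_def
  proof (rule arg_cong[where f=sqrt])
    show "(\<Sum>i<n. (y i)\<^sup>2) = (\<Sum>i<m. (y i)\<^sup>2)"
      using y m by (intro sum.mono_neutral_right) (auto simp: eball_iff rspace_iff)
  qed
  then have "combi n b y \<in> eball n r" using y by (simp add: eball_iff nm_combi[OF b] combi_rspace[OF b])
  moreover have "coords m n b (combi n b y) = y"
  proof
    fix i
    have "coords n n b (combi n b y) i = y i" using coords_combi[OF b yn] by simp
    then show "coords m n b (combi n b y) i = y i" using y m by (auto simp: coords_def eball_iff rspace_iff split: if_splits)
  qed
  ultimately show "y \<in> coords m n b ` eball n r" by (metis image_eqI)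
qed

lemma cbody_coords:
  assumes K: "cbody n r K" and b: "orthonormal n b" and m: "m \<le> n"
  shows "cbody m r (coords m n b ` K)"
proof -
  note k = cbodyD[OF K]
  obtain a where a: "a \<in> rspace n" "add_set {a} (eball n r) \<subseteq> K" using K by (auto simp: cbody_def)
  have "coords m n b ` add_set {a} (eball n r) \<subseteq> coords m n b ` K" using a by blast
  then have ball: "add_set {coords m n b a} (eball m r) \<subseteq> coords m n b ` K"
    by (simp add: coords_image_add_set coords_image_eball[OF b m])
  have cv: "convex (coords m n b ` K)" by (rule convex_coords[OF k(2)])
  show ?thesis unfolding cbody_def
    using ball cv k by (intro conjI compact_coords bexI[of _ "coords m n b a"]) auto
qed

text \<open>Once some orthonormal basis of the hyperplane exists, the one selected by
  \<open>SOME\<close> is such a basis; appending \<xi> as vector number m completes it. Its vectors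
  are orthogonal to \<xi>, so taking coordinates already performs the projection.\<close>

lemma perp_coords_eq:
  assumes \<xi>: "\<xi> \<in> usphere (Suc m)"
  obtains b where "orthonormal (Suc m) b" "b m = \<xi>"
    "\<And>A. perp_coords (Suc m) \<xi> ` proj (Suc m) \<xi> ` A = coords m (Suc m) b ` A"
proof -
  let ?n = "Suc m"
  define b0 where "b0 = (SOME b. orthonormal_basis_perp ?n \<xi> b)"
  obtain b1 where b1: "orthonormal ?n b1" "b1 (?n - 1) = \<xi>" using orthonormal_exists[OF \<xi>] by auto
  have "orthonormal_basis_perp ?n \<xi> b1"
    unfolding orthonormal_basis_perp_def hyperplane_def using b1 unfolding orthonormal_def by auto
  then have b0: "orthonormal_basis_perp ?n \<xi> b0" unfolding b0_def by (rule someI[of _ b1])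
  define b where "b = b0(m := \<xi>)"
  have h: "b0 j \<in> rspace ?n" "ip ?n (b0 j) \<xi> = 0" "ip ?n \<xi> (b0 j) = 0" if "j < m" for j
    using b0 that ip_commute[of ?n \<xi>] by (auto simp: orthonormal_basis_perp_def hyperplane_def)
  have "orthonormal ?n b"
    unfolding orthonormal_def
  proof (intro conjI allI impI)
    fix j assume "j < ?n" then show "b j \<in> rspace ?n" using h(1)[of j] \<xi> by (auto simp: b_def usphere_iff less_Suc_eq)
    fix k assume "k < ?n"
    then show "ip ?n (b j) (b k) = (if j = k then 1 else 0)"
      using h(2)[of j] h(3)[of k] b0 usphere_ip[OF \<xi>] \<open>j < ?n\<close>
      by (auto simp: b_def less_Suc_eq orthonormal_basis_perp_def)
  qed
  moreover have "b m = \<xi>" by (simp add: b_def)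
  moreover have "perp_coords ?n \<xi> (proj ?n \<xi> x) = coords m ?n b x" for x
  proof
    fix j
    have "proj ?n \<xi> x = x - ip ?n x \<xi> *\<^sub>R \<xi>" by (simp add: proj_def fun_eq_iff fun_apply)
    then show "perp_coords ?n \<xi> (proj ?n \<xi> x) j = coords m ?n b x j"
      using h(3)[of j] by (simp add: perp_coords_def Let_def b0_def[symmetric] coords_def b_def ip_simps)
  qed
  then have "perp_coords ?n \<xi> ` proj ?n \<xi> ` A = coords m ?n b ` A" for A by (simp add: image_image)
  ultimately show ?thesis using that by blast
qed

section \<open>The uniform measure on the sphere\<close>

lemma sets_sphere_measure [simp, measurable_cong]: "sets (sphere_measure n) = sets borel"
  by (simp add: sphere_measure_def)

lemma space_sphere_measure [simp]: "space (sphere_measure n) = UNIV"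
  by (simp add: sphere_measure_def)

lemma sphere_measure_eq:
  "sphere_measure n = distr (uniform_measure (lebn n) (eball n 1)) borel (\<lambda>x. (1 / nm n x) *\<^sub>R x)"
proof -
  have "(\<lambda>i. x i / nm n x) = (1 / nm n x) *\<^sub>R x" for x by (simp add: fun_eq_iff fun_apply)
  then show ?thesis by (simp add: sphere_measure_def)
qed

lemma prob_space_uniform_ball: "prob_space (uniform_measure (lebn n) (eball n 1))"
  using emeasure_eball_pos[of 1 n] emeasure_eball_finite[of n 1] by (intro prob_space_uniform_measure) auto

lemma prob_space_sphere_measure: "prob_space (sphere_measure n)"
  unfolding sphere_measure_eq
  by (rule prob_space.prob_space_distr[OF prob_space_uniform_ball]) measurable

lemma pair_sphere_lebn: "pair_sigma_finite (sphere_measure n) (lebn n)"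
  by (intro pair_sigma_finite.intro sigma_finite_lebn prob_space_imp_sigma_finite prob_space_sphere_measure)

text \<open>The unit ball contains a cylinder of height 2t over the m-ball of radius \<rho>, where
  \<rho>^2 + t^2 = 1 and t^2 = 1/(m + 1). The loss \<rho>^m is at least 1/2, because \<rho>^(-2m) =
  (1 + 1/m)^m \<le> e < 4.\<close>

lemma vol_eball_Suc_ge:
  assumes m: "m \<ge> 1"
  shows "vol m (eball m 1) / sqrt (real (Suc m)) \<le> vol (Suc m) (eball (Suc m) 1)"
proof -
  define \<rho> where "\<rho> = sqrt (real m / real (Suc m))"
  define t where "t = 1 / sqrt (real (Suc m))"
  have \<rho>: "\<rho> > 0" "\<rho>\<^sup>2 = real m / real (Suc m)" using m by (auto simp: \<rho>_def)
  have t: "t > 0" "t\<^sup>2 = 1 / real (Suc m)" by (auto simp: t_def power_divide)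
  have sub: "ennreal (2 * t) * indicator (eball m \<rho>) y \<le> emeasure lborel {s. y(m := s) \<in> eball (Suc m) 1}" for y
  proof (cases "y \<in> eball m \<rho>")
    case True
    have "{-t..t} \<subseteq> {s. y(m := s) \<in> eball (Suc m) 1}"
    proof
      fix s assume "s \<in> {-t..t}"
      then have "s\<^sup>2 \<le> t\<^sup>2" using t by (intro abs_le_square_iff[THEN iffD1]) auto
      moreover have "ip m y y \<le> \<rho>\<^sup>2" using True \<rho>(1) by (simp add: eball_iff nm_le_iff[symmetric])
      moreover have "ip (Suc m) (y(m := s)) (y(m := s)) = ip m y y + s\<^sup>2"
        by (simp add: ip_def power2_eq_square)
      moreover have "\<rho>\<^sup>2 + t\<^sup>2 = 1" unfolding \<rho>(2) t(2) by (simp add: add_divide_distrib[symmetric])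
      ultimately have "nm (Suc m) (y(m := s)) \<le> 1" by (simp add: nm_le_iff)
      then show "s \<in> {s. y(m := s) \<in> eball (Suc m) 1}" using True by (auto simp: eball_iff rspace_iff)
    qed
    then have "emeasure lborel {-t..t} \<le> emeasure lborel {s. y(m := s) \<in> eball (Suc m) 1}"
      by (rule emeasure_mono) measurable
    then show ?thesis using t True by simp
  qed simp
  have "ennreal (2 * t) * emeasure (lebn m) (eball m \<rho>) = (\<integral>\<^sup>+y. ennreal (2 * t) * indicator (eball m \<rho>) y \<partial>lebn m)"
    by (simp add: nn_integral_cmult)
  also have "\<dots> \<le> (\<integral>\<^sup>+y. emeasure lborel {s. y(m := s) \<in> eball (Suc m) 1} \<partial>lebn m)"
    by (intro nn_integral_mono sub)
  also have "\<dots> = emeasure (lebn (Suc m)) (eball (Suc m) 1)" by (rule emeasure_lebn_Suc[symmetric]) measurable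
  finally have "2 * t * vol m (eball m \<rho>) \<le> vol (Suc m) (eball (Suc m) 1)"
    unfolding emeasure_eq_vol[OF compact_eball eball_subset_rspace]
    using t by (simp add: ennreal_mult[symmetric] ennreal_le_iff)
  moreover have "vol m (eball m \<rho>) = \<rho> ^ m * vol m (eball m 1)" by (rule vol_eball_scale[OF \<rho>(1)])
  moreover have "1 / 2 \<le> \<rho> ^ m"
  proof -
    have "(1 + 1 / real m) ^ m \<le> exp (1 / real m) ^ m"
      by (intro power_mono exp_ge_add_one_self) auto
    also have "\<dots> = exp 1" using m by (simp add: exp_of_nat_mult[symmetric])
    also have "\<dots> \<le> 4" using exp_le by simp
    finally have e: "(1 + 1 / real m) ^ m \<le> 4" .
    have "\<rho>\<^sup>2 = 1 / (1 + 1 / real m)" unfolding \<rho>(2) using m by (simp add: divide_simps)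
    then have "(\<rho> ^ m)\<^sup>2 = 1 / (1 + 1 / real m) ^ m"
      by (metis power_mult mult.commute power_one_over)
    also have "\<dots> \<ge> 1 / 4" using e m by (intro divide_left_mono) (auto simp: add_pos_pos)
    finally have "(1 / 2)\<^sup>2 \<le> (\<rho> ^ m)\<^sup>2" by (simp add: power2_eq_square)
    then show ?thesis by (rule power2_le_imp_le) (use \<rho>(1) in simp)
  qed
  ultimately have "2 * t * (1 / 2 * vol m (eball m 1)) \<le> vol (Suc m) (eball (Suc m) 1)"
    using t by (smt (verit, best) mult_left_mono mult_right_mono vol_nonneg)
  then show ?thesis by (simp add: t_def)
qed

text \<open>After rotating \<nu> to the last axis, the slab of the ball lies in the cylinder of
  height 2t over the unit m-ball.\<close>

lemma vol_slab_le:
  assumes \<nu>: "\<nu> \<in> usphere (Suc m)" and t: "t \<ge> 0"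
  shows "emeasure (lebn (Suc m)) {x \<in> eball (Suc m) 1. \<bar>ip (Suc m) x \<nu>\<bar> \<le> t} \<le> ennreal (2 * t * vol m (eball m 1))"
proof -
  let ?n = "Suc m"
  obtain b where b: "orthonormal ?n b" "b m = \<nu>" using orthonormal_exists[OF \<nu>] by auto
  let ?A = "{y \<in> eball ?n 1. \<bar>y m\<bar> \<le> t}"
  have [measurable]: "?A \<in> sets borel" by measurable
  have "emeasure (lebn ?n) {x \<in> eball ?n 1. \<bar>ip ?n x \<nu>\<bar> \<le> t} \<le> emeasure (lebn ?n) {x. coords ?n ?n b x \<in> ?A}"
  proof (rule emeasure_mono)
    show "{x \<in> eball ?n 1. \<bar>ip ?n x \<nu>\<bar> \<le> t} \<subseteq> {x. coords ?n ?n b x \<in> ?A}"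
      using b nm_coords[OF b(1)] by (auto simp: eball_iff) (simp add: coords_def)
  qed measurable
  also have "\<dots> = emeasure (lebn ?n) ?A"
    by (rule emeasure_distr_eq[OF distr_coords[OF b(1)]]) measurable
  also have "\<dots> = (\<integral>\<^sup>+y. emeasure lborel {s. y(m := s) \<in> ?A} \<partial>lebn m)"
    by (rule emeasure_lebn_Suc) measurable
  also have "\<dots> \<le> (\<integral>\<^sup>+y. ennreal (2 * t) * indicator (eball m 1) y \<partial>lebn m)"
  proof (rule nn_integral_mono_AE)
    show "AE y in lebn m. emeasure lborel {s. y(m := s) \<in> ?A} \<le> ennreal (2 * t) * indicator (eball m 1) y"
      using AE_rspace[of m]
    proof eventually_elim
      case (elim y)
      show ?case
      proof (cases "y \<in> eball m 1")
        case True
        have "emeasure lborel {s. y(m := s) \<in> ?A} \<le> emeasure lborel {-t..t}" by (rule emeasure_mono) auto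
        then show ?thesis using True t by simp
      next
        case False
        have "y(m := s) \<notin> ?A" for s
        proof
          assume "y(m := s) \<in> ?A"
          then have "ip ?n (y(m := s)) (y(m := s)) \<le> 1\<^sup>2" by (auto simp: eball_iff ip_self intro!: power_le_one)
          moreover have "ip ?n (y(m := s)) (y(m := s)) = ip m y y + s\<^sup>2"
            by (simp add: ip_def power2_eq_square)
          ultimately have "ip m y y \<le> 1\<^sup>2" using zero_le_power2[of s] by linarith
          then show False using False elim by (simp add: eball_iff nm_le_iff)
        qed
        then have "{s. y(m := s) \<in> ?A} = {}" by blast
        then show ?thesis by (simp only: emeasure_empty) simp
      qed
    qed
  qed
  also have "\<dots> = ennreal (2 * t * vol m (eball m 1))"
    using t by (simp add: nn_integral_cmult emeasure_eq_vol[OF compact_eball eball_subset_rspace] ennreal_mult)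
  finally show ?thesis .
qed

lemma emeasure_sphere_measure:
  assumes [measurable]: "B \<in> sets borel"
  shows "emeasure (sphere_measure n) B =
    emeasure (lebn n) (eball n 1 \<inter> {x. (1 / nm n x) *\<^sub>R x \<in> B}) / emeasure (lebn n) (eball n 1)"
proof -
  have [measurable]: "{x. (1 / nm n x) *\<^sub>R x \<in> B} \<in> sets borel" by measurable
  have "emeasure (sphere_measure n) B = emeasure (uniform_measure (lebn n) (eball n 1)) {x. (1 / nm n x) *\<^sub>R x \<in> B}"
    unfolding sphere_measure_eq by (subst emeasure_distr) (auto simp: vimage_def)
  also have "\<dots> = emeasure (lebn n) (eball n 1 \<inter> {x. (1 / nm n x) *\<^sub>R x \<in> B}) / emeasure (lebn n) (eball n 1)"
    by (rule emeasure_uniform_measure) auto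
  finally show ?thesis .
qed

lemma normalize_usphere: "x \<in> rspace n \<Longrightarrow> x \<noteq> 0 \<Longrightarrow> (1 / nm n x) *\<^sub>R x \<in> usphere n"
  using nm_eq_0[of x n] by (simp add: usphere_iff)

text \<open>Passing from a nonzero point x of the unit ball to its direction can only increase the
  modulus of the component along \<nu>. So the points whose direction is outside the cap lie in the
  slab of half width t = 1/(4 sqrt n), which by the last two volume bounds takes at most half of the
  ball.\<close>

lemma sphere_measure_cap_ge:
  assumes m: "m \<ge> 1" and \<nu>: "\<nu> \<in> usphere (Suc m)"
  shows "1 / 2 \<le> measure (sphere_measure (Suc m))
     {\<xi> \<in> usphere (Suc m). 1 / (4 * sqrt (real (Suc m))) \<le> \<bar>ip (Suc m) \<nu> \<xi>\<bar>}" (is "_ \<le> measure ?\<sigma> ?G")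
proof -
  let ?n = "Suc m"
  define t where "t = 1 / (4 * sqrt (real ?n))"
  have t: "t > 0" by (simp add: t_def)
  interpret prob_space ?\<sigma> by (rule prob_space_sphere_measure)
  have [measurable]: "?G \<in> sets borel" by measurable
  have [measurable]: "- ?G \<in> sets borel" by (rule borel_comp) measurable
  have [measurable]: "{x \<in> eball ?n 1. \<bar>ip ?n x \<nu>\<bar> \<le> t} \<in> sets borel" by measurable
  let ?w = "vol ?n (eball ?n 1)"
  have w: "?w > 0" by (rule vol_eball_pos) simp
  have "eball ?n 1 \<inter> {x. (1 / nm ?n x) *\<^sub>R x \<in> - ?G} \<subseteq> {x \<in> eball ?n 1. \<bar>ip ?n x \<nu>\<bar> \<le> t}"
  proof
    fix x assume x: "x \<in> eball ?n 1 \<inter> {x. (1 / nm ?n x) *\<^sub>R x \<in> - ?G}"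
    show "x \<in> {x \<in> eball ?n 1. \<bar>ip ?n x \<nu>\<bar> \<le> t}"
    proof (cases "x = 0")
      case False
      have xr: "x \<in> rspace ?n" "nm ?n x \<le> 1" using x by (auto simp: eball_iff)
      have p: "nm ?n x > 0" using nm_eq_0[OF xr(1)] False L2_set_nonneg[of x "{..<?n}"] by linarith
      have "\<bar>ip ?n \<nu> ((1 / nm ?n x) *\<^sub>R x)\<bar> < t"
        using x normalize_usphere[OF xr(1) False] by (auto simp: t_def not_le)
      then have "\<bar>ip ?n \<nu> x\<bar> < t * nm ?n x" using p by (simp add: ip_simps abs_mult field_simps)
      also have "\<dots> \<le> t * 1" using xr t by (intro mult_left_mono) auto
      finally show ?thesis using x by (simp add: ip_commute)
    qed (use x t in auto)
  qed
  then have "emeasure (lebn ?n) (eball ?n 1 \<inter> {x. (1 / nm ?n x) *\<^sub>R x \<in> - ?G}) \<le> emeasure (lebn ?n) {x \<in> eball ?n 1. \<bar>ip ?n x \<nu>\<bar> \<le> t}"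
    by (rule emeasure_mono) simp
  also have "\<dots> \<le> ennreal (2 * t * vol m (eball m 1))" by (rule vol_slab_le[OF \<nu>]) (use t in simp)
  also have "\<dots> \<le> ennreal (?w / 2)"
    using vol_eball_Suc_ge[OF m] by (intro ennreal_leI) (simp add: t_def)
  finally have "emeasure ?\<sigma> (- ?G) \<le> ennreal (?w / 2) / ennreal ?w"
    unfolding emeasure_sphere_measure[OF \<open>- ?G \<in> sets borel\<close>] emeasure_eq_vol[OF compact_eball eball_subset_rspace]
    by (rule divide_right_mono_ennreal)
  also have "\<dots> = ennreal (1 / 2)" using w by (simp add: divide_ennreal)
  finally have "measure ?\<sigma> (- ?G) \<le> 1 / 2" unfolding emeasure_eq_measure by (subst (asm) ennreal_le_iff) auto
  moreover have "measure ?\<sigma> (- ?G) = 1 - measure ?\<sigma> ?G"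
    using prob_compl[of ?G] by (simp add: Compl_eq_Diff_UNIV)
  ultimately show ?thesis by simp
qed

section \<open>Surface area and the mean projection\<close>

text \<open>The volume of the projection along a unit vector \<xi>, expressed by volumes in the
  ambient space. No basis is chosen, which makes measurability in \<xi> accessible and allows Fubini
  with sums K + segment.\<close>

definition proj_vol :: "nat \<Rightarrow> (nat \<Rightarrow> real) set \<Rightarrow> (nat \<Rightarrow> real) \<Rightarrow> real" where
  "proj_vol n K \<xi> = (vol n (add_set K (seg \<xi> 1)) - vol n K) / 2"

lemma proj_vol_coords:
  assumes b: "orthonormal (Suc m) b" "b m = \<xi>" and K: "compact K" "convex K" "K \<subseteq> rspace (Suc m)"
  shows "proj_vol (Suc m) K \<xi> = vol m (coords m (Suc m) b ` K)"
  using vol_add_seg[OF b(1) K, of 1] b(2) by (simp add: proj_vol_def)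

lemma vol_add_seg_proj_vol:
  assumes \<xi>: "\<xi> \<in> usphere (Suc m)" and K: "compact K" "convex K" "K \<subseteq> rspace (Suc m)" and e: "e \<ge> 0"
  shows "vol (Suc m) (add_set K (seg \<xi> e)) = vol (Suc m) K + 2 * e * proj_vol (Suc m) K \<xi>"
proof -
  obtain b where b: "orthonormal (Suc m) b" "b m = \<xi>" using orthonormal_exists[OF \<xi>] by auto
  then show ?thesis using vol_add_seg[OF b(1) K e] proj_vol_coords[OF b K] by simp
qed

lemma proj_vol_pos:
  assumes K: "cbody (Suc m) r K" and \<xi>: "\<xi> \<in> usphere (Suc m)"
  shows "proj_vol (Suc m) K \<xi> > 0"
proof -
  obtain b where b: "orthonormal (Suc m) b" "b m = \<xi>" using orthonormal_exists[OF \<xi>] by auto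
  then show ?thesis using proj_vol_coords[OF b cbodyD(1-3)[OF K]]
      vol_cbody_pos[OF cbody_coords[OF K b(1)], of m] by simp
qed

lemma proj_vol_parallel:
  assumes K: "cbody (Suc m) r K" and b: "orthonormal (Suc m) b" "b m = \<xi>" and e: "e \<ge> 0"
  shows "proj_vol (Suc m) (add_set K (eball (Suc m) e)) \<xi> = vol m (add_set (coords m (Suc m) b ` K) (eball m e))"
  using proj_vol_coords[OF b cbodyD(1-3)[OF cbody_parallel[OF K e]]]
  by (simp add: coords_image_add_set coords_image_eball[OF b(1)])

lemma proj_vol_parallel_le:
  assumes K: "cbody (Suc m) r K" and \<xi>: "\<xi> \<in> usphere (Suc m)" and e: "e \<ge> 0"
  shows "proj_vol (Suc m) (add_set K (eball (Suc m) e)) \<xi> \<le> (1 + e / r) ^ m * proj_vol (Suc m) K \<xi>"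
proof -
  obtain b where b: "orthonormal (Suc m) b" "b m = \<xi>" using orthonormal_exists[OF \<xi>] by auto
  have "cbody m r (coords m (Suc m) b ` K)" by (rule cbody_coords[OF K b(1)]) simp
  from vol_parallel_le[OF this e] show ?thesis
    by (simp add: proj_vol_parallel[OF K b e] proj_vol_coords[OF b cbodyD(1-3)[OF K]])
qed

lemma seg_subset_eball: "\<xi> \<in> usphere n \<Longrightarrow> seg \<xi> e \<subseteq> eball n e"
  by (auto simp: seg_def eball_iff usphere_iff abs_le_iff)

text \<open>The segment from -e \<xi> to e \<xi> lies in the ball of radius e, so the parallel body
  grows at least as fast as K + segment.\<close>

lemma proj_vol_le_surface_area:
  assumes K: "cbody (Suc m) r K" and \<xi>: "\<xi> \<in> usphere (Suc m)"
  shows "2 * proj_vol (Suc m) K \<xi> \<le> surface_area (Suc m) K"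
proof (rule tendsto_lowerbound[OF surface_area_tendsto[OF K]])
  note k = cbodyD[OF K]
  have "\<forall>\<^sub>F s in at_right (0::real). 0 < s" by (simp add: eventually_at_right_less)
  then show "\<forall>\<^sub>F e in at_right 0. 2 * proj_vol (Suc m) K \<xi> \<le> (vol (Suc m) (add_set K (eball (Suc m) e)) - vol (Suc m) K) / e"
  proof eventually_elim
    case (elim e)
    have "vol (Suc m) (add_set K (seg \<xi> e)) \<le> vol (Suc m) (add_set K (eball (Suc m) e))"
      using k by (intro vol_mono add_set_mono seg_subset_eball \<xi> sets_compact compact_add_set compact_seg
        compact_eball parallel_subset_rspace order_refl)
    then show ?case using vol_add_seg_proj_vol[OF \<xi> k(1-3), of e] elim by (simp add: field_simps)
  qed
qed simp

text \<open>The graph is a continuous image of a product of three compact sets, hence closed. This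
  is the measurability needed to apply Fubini to sphere and space jointly.\<close>

lemma sets_seg_graph:
  assumes K: "compact K"
  shows "{(\<xi>, x). \<xi> \<in> usphere n \<and> x \<in> add_set K (seg \<xi> e)} \<in> sets (borel \<Otimes>\<^sub>M borel)"
proof -
  let ?E = "{(\<xi>, x). \<xi> \<in> usphere n \<and> x \<in> add_set K (seg \<xi> e)}"
  have E: "?E = (\<lambda>p. (fst p, fst (snd p) + snd (snd p) *\<^sub>R fst p)) ` (usphere n \<times> K \<times> {-e..e})"
  proof (intro equalityI subsetI)
    fix p assume "p \<in> ?E"
    then obtain \<xi> k s where "p = (\<xi>, k + s *\<^sub>R \<xi>)" "\<xi> \<in> usphere n" "k \<in> K" "s \<in> {-e..e}"
      by (auto simp: seg_def add_set_eq)
    then show "p \<in> (\<lambda>p. (fst p, fst (snd p) + snd (snd p) *\<^sub>R fst p)) ` (usphere n \<times> K \<times> {-e..e})"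
      by (intro image_eqI[of _ _ "(\<xi>, k, s)"]) auto
  qed (auto simp: seg_def intro!: add_setI)
  have "compact ?E" unfolding E
    by (intro compact_continuous_image continuous_on_Pair fun_cont compact_Times compact_usphere K compact_Icc)
  then have "?E \<in> sets borel" by (intro borel_closed compact_imp_closed)
  then show ?thesis unfolding borel_prod .
qed

lemma measurable_proj_vol:
  assumes K: "compact K" "K \<subseteq> rspace n"
  shows "(\<lambda>\<xi>. indicator (usphere n) \<xi> * proj_vol n K \<xi>) \<in> borel_measurable borel"
proof -
  let ?E = "{(\<xi>, x). \<xi> \<in> usphere n \<and> x \<in> add_set K (seg \<xi> 1)}"
  have "(\<lambda>\<xi>. emeasure (lebn n) (Pair \<xi> -` ?E)) \<in> borel_measurable borel"
    by (rule lebn.measurable_emeasure_Pair) (use sets_seg_graph[OF K(1)] in \<open>simp cong: sets_pair_measure_cong\<close>)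
  then have [measurable]: "(\<lambda>\<xi>. enn2real (emeasure (lebn n) (Pair \<xi> -` ?E))) \<in> borel_measurable borel" by measurable
  have "(\<lambda>\<xi>. indicator (usphere n) \<xi> * proj_vol n K \<xi>) =
     (\<lambda>\<xi>. indicator (usphere n) \<xi> * ((enn2real (emeasure (lebn n) (Pair \<xi> -` ?E)) - vol n K) / 2))"
  proof
    fix \<xi>
    have "Pair \<xi> -` ?E = add_set K (seg \<xi> 1)" if "\<xi> \<in> usphere n" using that by auto
    then show "indicator (usphere n) \<xi> * proj_vol n K \<xi> =
       indicator (usphere n) \<xi> * ((enn2real (emeasure (lebn n) (Pair \<xi> -` ?E)) - vol n K) / 2)"
      by (auto simp: indicator_def proj_vol_def vol_def measure_def)
  qed
  also have "\<dots> \<in> borel_measurable borel" by measurable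
  finally show ?thesis .
qed

definition mean_proj :: "nat \<Rightarrow> (nat \<Rightarrow> real) set \<Rightarrow> real" where
  "mean_proj n K = (\<integral>\<xi>. indicator (usphere n) \<xi> * proj_vol n K \<xi> \<partial>sphere_measure n)"

lemma integrable_proj_vol:
  assumes K: "cbody (Suc m) r K"
  shows "integrable (sphere_measure (Suc m)) (\<lambda>\<xi>. indicator (usphere (Suc m)) \<xi> * proj_vol (Suc m) K \<xi>)"
proof -
  interpret prob_space "sphere_measure (Suc m)" by (rule prob_space_sphere_measure)
  have "\<bar>indicator (usphere (Suc m)) \<xi> * proj_vol (Suc m) K \<xi>\<bar> \<le> surface_area (Suc m) K" for \<xi>
    using proj_vol_le_surface_area[OF K, of \<xi>] proj_vol_pos[OF K, of \<xi>] surface_area_nonneg[OF K]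
    by (auto simp: indicator_def)
  then show ?thesis
    using measurable_proj_vol[OF cbodyD(1,3)[OF K]]
    by (intro integrable_const_bound[of _ "surface_area (Suc m) K"]) auto
qed

text \<open>A point \<open>x = k + y\<close> with \<open>\<rho> < \<parallel>y\<parallel> \<le> \<rho> + \<kappa>\<epsilon>\<close> is moved into the parallel body of radius \<open>\<rho>\<close> by
  a step of length \<open>\<epsilon>\<close> in direction \<open>\<plusminus>\<xi>\<close> whenever \<open>\<xi>\<close> makes a not too small angle with \<open>y\<^sup>\<bottom>\<close>.\<close>

lemma shell_point_cap:
  assumes m: "m \<ge> 1" and K: "compact K" "K \<subseteq> rspace (Suc m)"
  defines "\<kappa> \<equiv> 1 / (8 * sqrt (real (Suc m)))"
  assumes \<rho>: "\<rho> > 0" and e: "e > 0" and e\<rho>: "e * (1 + \<kappa>\<^sup>2) \<le> 2 * \<kappa> * \<rho>"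
  assumes x: "x \<in> add_set K (eball (Suc m) (\<rho> + \<kappa> * e))" "x \<notin> add_set K (eball (Suc m) \<rho>)"
  shows "1 / 2 \<le> measure (sphere_measure (Suc m))
    {\<xi> \<in> usphere (Suc m). x \<in> add_set (add_set K (eball (Suc m) \<rho>)) (seg \<xi> e)}"
proof -
  let ?n = "Suc m"
  interpret prob_space "sphere_measure ?n" by (rule prob_space_sphere_measure)
  have \<kappa>: "\<kappa> > 0" by (simp add: \<kappa>_def)
  obtain k y where ky: "x = k + y" "k \<in> K" "y \<in> rspace ?n" "nm ?n y \<le> \<rho> + \<kappa> * e"
    using x(1) by (auto simp: add_set_eq eball_iff)
  let ?R = "nm ?n y"
  have R: "?R > \<rho>"
  proof (rule ccontr)
    assume "\<not> ?R > \<rho>"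
    then have "y \<in> eball ?n \<rho>" using ky by (simp add: eball_iff)
    then show False using x(2) ky by (auto intro: add_setI)
  qed
  then have "y \<noteq> 0" using \<rho> by auto
  then have \<nu>: "(1 / ?R) *\<^sub>R y \<in> usphere ?n" by (rule normalize_usphere[OF ky(3)])
  let ?G = "{\<xi> \<in> usphere ?n. 1 / (4 * sqrt (real ?n)) \<le> \<bar>ip ?n ((1 / ?R) *\<^sub>R y) \<xi>\<bar>}"
  let ?H = "{\<xi> \<in> usphere ?n. x \<in> add_set (add_set K (eball ?n \<rho>)) (seg \<xi> e)}"
  have "?G \<subseteq> ?H"
  proof
    fix \<xi> assume \<xi>: "\<xi> \<in> ?G"
    then have u: "\<xi> \<in> usphere ?n" "\<xi> \<in> rspace ?n" and t: "2 * \<kappa> * ?R \<le> \<bar>ip ?n y \<xi>\<bar>"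
      using R \<rho> by (auto simp: \<kappa>_def ip_simps abs_mult field_simps usphere_iff)
    \<comment> \<open>The sign is that of the component of y along \<xi>, so that subtracting
      \<open>s *\<^sub>R \<xi>\<close> shortens y.\<close>
    define s where "s = (if ip ?n y \<xi> \<ge> 0 then e else - e)"
    have s: "s \<in> {-e..e}" "s * s = e * e" "s * ip ?n y \<xi> = e * \<bar>ip ?n y \<xi>\<bar>" using e by (auto simp: s_def)
    have "ip ?n (y - s *\<^sub>R \<xi>) (y - s *\<^sub>R \<xi>) = ?R\<^sup>2 - 2 * (s * ip ?n y \<xi>) + s * s * ip ?n \<xi> \<xi>"
      by (simp add: ip_simps ip_commute[of ?n \<xi> y] ip_self[of ?n y] algebra_simps)
    also have "\<dots> = ?R\<^sup>2 - 2 * (e * \<bar>ip ?n y \<xi>\<bar>) + e * e" using s usphere_ip[OF u(1)] by simp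
    also have "\<dots> \<le> ?R\<^sup>2 - 2 * (e * (2 * \<kappa> * ?R)) + e * e" using t e by simp
    \<comment> \<open>The gain \<open>4 * e * \<kappa> * ?R\<close> exceeds the first-order excess
      \<open>2 * \<rho> * \<kappa> * e\<close> of the shell radius by at least as much again; by
      \<open>e\<rho>\<close> this surplus covers the quadratic terms (1 + \<kappa>^2) e^2.\<close>
    also have "\<dots> \<le> \<rho>\<^sup>2"
    proof -
      have "?R\<^sup>2 \<le> (\<rho> + \<kappa> * e)\<^sup>2" using ky(4) by (intro power_mono) auto
      also have "\<dots> = \<rho>\<^sup>2 + 2 * \<rho> * \<kappa> * e + \<kappa>\<^sup>2 * e * e" by (simp add: power2_eq_square algebra_simps)
      finally have 1: "?R\<^sup>2 \<le> \<rho>\<^sup>2 + 2 * \<rho> * \<kappa> * e + \<kappa>\<^sup>2 * e * e" .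
      have "e * \<kappa> * \<rho> \<le> e * \<kappa> * ?R" using R e \<kappa> by (intro mult_left_mono) auto
      moreover have "e * (e * (1 + \<kappa>\<^sup>2)) \<le> e * (2 * \<kappa> * \<rho>)" using e\<rho> e by (intro mult_left_mono) auto
      ultimately show ?thesis using 1 by (simp add: algebra_simps)
    qed
    finally have "nm ?n (y - s *\<^sub>R \<xi>) \<le> \<rho>" using \<rho> by (simp add: nm_le_iff)
    then have "y - s *\<^sub>R \<xi> \<in> eball ?n \<rho>" using ky u by (simp add: eball_iff)
    moreover have "x = (k + (y - s *\<^sub>R \<xi>)) + s *\<^sub>R \<xi>" using ky by simp
    ultimately show "\<xi> \<in> ?H" using u ky s(1) unfolding seg_def
      by (metis (mono_tags, lifting) add_setI imageI mem_Collect_eq)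
  qed
  moreover have "?H \<in> sets borel"
  proof -
    have m: "(\<lambda>\<xi>. (\<xi>, x)) \<in> measurable borel (borel \<Otimes>\<^sub>M borel)" by measurable
    have "?H = (\<lambda>\<xi>. (\<xi>, x)) -` {(\<xi>, x). \<xi> \<in> usphere ?n \<and> x \<in> add_set (add_set K (eball ?n \<rho>)) (seg \<xi> e)} \<inter> space borel"
      by auto
    also have "\<dots> \<in> sets borel"
      by (rule measurable_sets[OF m sets_seg_graph[OF compact_parallel[OF K(1)]]])
    finally show ?thesis .
  qed
  ultimately have "measure (sphere_measure ?n) ?G \<le> measure (sphere_measure ?n) ?H"
    by (intro finite_measure_mono) auto
  then show ?thesis using sphere_measure_cap_ge[OF m \<nu>] by linarith
qed

lemma mean_proj_nonneg: "cbody (Suc m) r K \<Longrightarrow> mean_proj (Suc m) K \<ge> 0"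
  unfolding mean_proj_def using proj_vol_pos[of m r K]
  by (intro integral_nonneg_AE AE_I2) (auto simp: indicator_def intro: less_imp_le)

text \<open>Double counting of pairs (\<xi>, x): every x in the shell is reached by at least half of
  the directions, while for a fixed \<xi> the points reached lie in (L + segment) - L, of volume 2e
  times the projection volume.\<close>

lemma shell_volume_le:
  assumes m: "m \<ge> 1" and K: "cbody (Suc m) r K"
  defines "\<kappa> \<equiv> 1 / (8 * sqrt (real (Suc m)))"
  assumes \<rho>: "\<rho> > 0" and e: "e > 0" and e\<rho>: "e * (1 + \<kappa>\<^sup>2) \<le> 2 * \<kappa> * \<rho>"
  shows "vol (Suc m) (add_set K (eball (Suc m) (\<rho> + \<kappa> * e))) - vol (Suc m) (add_set K (eball (Suc m) \<rho>))
    \<le> 4 * e * mean_proj (Suc m) (add_set K (eball (Suc m) \<rho>))"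
proof -
  let ?n = "Suc m"
  let ?\<sigma> = "sphere_measure ?n"
  let ?L = "add_set K (eball ?n \<rho>)" and ?B = "add_set K (eball ?n (\<rho> + \<kappa> * e))"
  interpret prob_space ?\<sigma> by (rule prob_space_sphere_measure)
  interpret PS: pair_sigma_finite ?\<sigma> "lebn ?n" by (rule pair_sphere_lebn)
  have \<kappa>: "\<kappa> > 0" by (simp add: \<kappa>_def)
  have L: "cbody ?n r ?L" and B: "cbody ?n r ?B" using K \<rho> e \<kappa> by (auto intro: cbody_parallel)
  note l = cbodyD[OF L] and b = cbodyD[OF B]
  have LB: "?L \<subseteq> ?B" using \<kappa> e by (intro add_set_mono eball_mono order_refl) simp
  define E where "E = {(\<xi>, x). \<xi> \<in> usphere ?n \<and> x \<in> add_set ?L (seg \<xi> e)}"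
  have E [measurable]: "E \<in> sets (borel \<Otimes>\<^sub>M borel)" unfolding E_def by (rule sets_seg_graph[OF l(1)])
  note [measurable] = l(5) b(5)
  have half: "ennreal (1 / 2) * indicator (?B - ?L) x \<le> (\<integral>\<^sup>+\<xi>. indicator E (\<xi>, x) * indicator (?B - ?L) x \<partial>?\<sigma>)" for x
  proof (cases "x \<in> ?B - ?L")
    case True
    have "1 / 2 \<le> measure ?\<sigma> {\<xi> \<in> usphere ?n. x \<in> add_set ?L (seg \<xi> e)}"
      using shell_point_cap[OF m cbodyD(1,3)[OF K] \<rho> e e\<rho>[unfolded \<kappa>_def]] True unfolding \<kappa>_def by auto
    then have "ennreal (1 / 2) \<le> emeasure ?\<sigma> {\<xi> \<in> usphere ?n. x \<in> add_set ?L (seg \<xi> e)}"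
      unfolding emeasure_eq_measure by (rule ennreal_leI)
    also have "{\<xi> \<in> usphere ?n. x \<in> add_set ?L (seg \<xi> e)} = (\<lambda>\<xi>. (\<xi>, x)) -` E" by (auto simp: E_def)
    also have "emeasure ?\<sigma> \<dots> = (\<integral>\<^sup>+\<xi>. indicator ((\<lambda>\<xi>. (\<xi>, x)) -` E) \<xi> \<partial>?\<sigma>)"
    proof (rule nn_integral_indicator[symmetric])
      have "(\<lambda>\<xi>. (\<xi>, x)) \<in> measurable borel (borel \<Otimes>\<^sub>M borel)" by measurable
      from measurable_sets[OF this E] show "(\<lambda>\<xi>. (\<xi>, x)) -` E \<in> sets ?\<sigma>" by simp
    qed
    finally show ?thesis using True by (simp add: indicator_def)
  qed simp
  have "ennreal (1 / 2 * (vol ?n ?B - vol ?n ?L)) = ennreal (1 / 2) * emeasure (lebn ?n) (?B - ?L)"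
  proof -
    have "emeasure (lebn ?n) (?B - ?L) = emeasure (lebn ?n) ?B - emeasure (lebn ?n) ?L"
      using emeasure_compact_finite[OF l(1,3)] LB by (intro emeasure_Diff) auto
    also have "\<dots> = ennreal (vol ?n ?B - vol ?n ?L)"
      unfolding emeasure_eq_vol[OF l(1,3)] emeasure_eq_vol[OF b(1,3)] by (rule ennreal_minus) simp
    finally show ?thesis by (simp only:) (rule ennreal_mult', simp)
  qed
  also have "\<dots> = (\<integral>\<^sup>+x. ennreal (1 / 2) * indicator (?B - ?L) x \<partial>lebn ?n)"
    by (simp add: nn_integral_cmult)
  also have "\<dots> \<le> (\<integral>\<^sup>+x. (\<integral>\<^sup>+\<xi>. indicator E (\<xi>, x) * indicator (?B - ?L) x \<partial>?\<sigma>) \<partial>lebn ?n)"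
    by (intro nn_integral_mono half)
  also have "\<dots> = (\<integral>\<^sup>+\<xi>. (\<integral>\<^sup>+x. indicator E (\<xi>, x) * indicator (?B - ?L) x \<partial>lebn ?n) \<partial>?\<sigma>)"
    by (rule PS.Fubini') measurable
  also have "\<dots> \<le> (\<integral>\<^sup>+\<xi>. ennreal (2 * e) * ennreal (indicator (usphere ?n) \<xi> * proj_vol ?n ?L \<xi>) \<partial>?\<sigma>)"
  proof (rule nn_integral_mono)
    fix \<xi>
    show "(\<integral>\<^sup>+x. indicator E (\<xi>, x) * indicator (?B - ?L) x \<partial>lebn ?n)
      \<le> ennreal (2 * e) * ennreal (indicator (usphere ?n) \<xi> * proj_vol ?n ?L \<xi>)"
    proof (cases "\<xi> \<in> usphere ?n")
      case True
      let ?S = "add_set ?L (seg \<xi> e)"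
      have \<xi>: "\<xi> \<in> rspace ?n" using True by (simp add: usphere_iff)
      have S: "compact ?S" "?S \<subseteq> rspace ?n"
        using compact_add_set[OF l(1) compact_seg] add_set_rspace[OF l(3) seg_subset_rspace[OF \<xi>]] by auto
      note [measurable] = sets_compact[OF S(1)]
      have LS: "?L \<subseteq> ?S"
      proof
        fix x assume "x \<in> ?L"
        moreover have "0 \<in> seg \<xi> e" using e by (auto simp: seg_def intro!: image_eqI[of _ _ 0])
        ultimately show "x \<in> ?S" using add_setI[of x ?L 0] by simp
      qed
      have "(\<integral>\<^sup>+x. indicator E (\<xi>, x) * indicator (?B - ?L) x \<partial>lebn ?n) \<le> (\<integral>\<^sup>+x. indicator (?S - ?L) x \<partial>lebn ?n)"
        by (intro nn_integral_mono) (auto simp: E_def split: split_indicator)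
      also have "\<dots> = emeasure (lebn ?n) (?S - ?L)" by simp
      also have "\<dots> = emeasure (lebn ?n) ?S - emeasure (lebn ?n) ?L"
        using emeasure_compact_finite[OF l(1,3)] LS by (intro emeasure_Diff) auto
      also have "\<dots> = ennreal (2 * e * proj_vol ?n ?L \<xi>)"
        unfolding emeasure_eq_vol[OF l(1,3)] emeasure_eq_vol[OF S]
        using vol_add_seg_proj_vol[OF True l(1-3), of e] e by (simp add: ennreal_minus)
      also have "\<dots> = ennreal (2 * e) * ennreal (indicator (usphere ?n) \<xi> * proj_vol ?n ?L \<xi>)"
        using True e proj_vol_pos[OF L True] by (simp add: ennreal_mult)
      finally show ?thesis .
    next
      case False
      then have "indicator E (\<xi>, x) = (0 :: ennreal)" for x by (auto simp: E_def)
      then show ?thesis by simp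
    qed
  qed
  also have "\<dots> = ennreal (2 * e) * (\<integral>\<^sup>+\<xi>. ennreal (indicator (usphere ?n) \<xi> * proj_vol ?n ?L \<xi>) \<partial>?\<sigma>)"
    using measurable_proj_vol[OF l(1,3)] by (intro nn_integral_cmult) auto
  also have "(\<integral>\<^sup>+\<xi>. ennreal (indicator (usphere ?n) \<xi> * proj_vol ?n ?L \<xi>) \<partial>?\<sigma>) = ennreal (mean_proj ?n ?L)"
    unfolding mean_proj_def using proj_vol_pos[OF L]
    by (intro nn_integral_eq_integral integrable_proj_vol[OF L] AE_I2) (auto simp: indicator_def intro: less_imp_le)
  also have "ennreal (2 * e) * ennreal (mean_proj ?n ?L) = ennreal (2 * e * mean_proj ?n ?L)"
    using e by (simp add: ennreal_mult')
  finally have "ennreal (1 / 2 * (vol ?n ?B - vol ?n ?L)) \<le> ennreal (2 * e * mean_proj ?n ?L)" .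
  moreover have "mean_proj ?n ?L \<ge> 0" by (rule mean_proj_nonneg[OF L])
  ultimately have "1 / 2 * (vol ?n ?B - vol ?n ?L) \<le> 2 * e * mean_proj ?n ?L"
    using e by (subst (asm) ennreal_le_iff) auto
  then show ?thesis by simp
qed

lemma mean_proj_parallel_le:
  assumes K: "cbody (Suc m) r K" and e: "e \<ge> 0"
  shows "mean_proj (Suc m) (add_set K (eball (Suc m) e)) \<le> (1 + e / r) ^ m * mean_proj (Suc m) K"
proof -
  have "mean_proj (Suc m) (add_set K (eball (Suc m) e))
     \<le> (\<integral>\<xi>. (1 + e / r) ^ m * (indicator (usphere (Suc m)) \<xi> * proj_vol (Suc m) K \<xi>) \<partial>sphere_measure (Suc m))"
    unfolding mean_proj_def using proj_vol_parallel_le[OF K _ e]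
    by (intro integral_mono integrable_mult_right integrable_proj_vol[OF K] integrable_proj_vol[OF cbody_parallel[OF K e]])
       (auto simp: indicator_def)
  then show ?thesis by (simp add: mean_proj_def)
qed

text \<open>One inequality of Cauchy's surface area formula, up to an absolute constant. The estimate for thin
  shells is only available for shells whose width is at most a fixed multiple \<open>q\<close> of the inner radius,
  so it is summed over a geometric sequence of radii.\<close>

lemma surface_area_le_mean_proj:
  assumes m: "m \<ge> 1" and K: "cbody (Suc m) r K"
  shows "surface_area (Suc m) K \<le> 32 * sqrt (real (Suc m)) * mean_proj (Suc m) K"
proof -
  let ?n = "Suc m"
  define V where "V = (\<lambda>e. vol ?n (add_set K (eball ?n e)))"
  define G where "G = mean_proj ?n K"
  define \<kappa> where "\<kappa> = 1 / (8 * sqrt (real ?n))"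
  \<comment> \<open>With this q the choice e = q \<rho> / \<kappa> satisfies the constraint e (1 +
    \<kappa>^2) \<le> 2 \<kappa> \<rho> of the shell estimate with equality, so a shell of inner
    radius \<rho> may have width q \<rho>. The radii then grow by the factor 1 + q = 1/t.\<close>
  define q where "q = 2 * \<kappa>\<^sup>2 / (1 + \<kappa>\<^sup>2)"
  define t where "t = 1 / (1 + q)"
  have \<kappa>: "\<kappa> > 0" by (simp add: \<kappa>_def)
  have r: "r > 0" using cbodyD[OF K] by simp
  have G: "G \<ge> 0" unfolding G_def by (rule mean_proj_nonneg[OF K])
  have k1: "1 + \<kappa>\<^sup>2 > 0" by (simp add: add_pos_nonneg)
  have q: "q > 0" unfolding q_def using \<kappa> k1 by (intro divide_pos_pos) auto
  have t: "0 < t" "t < 1" "t * (1 + q) = 1" using q by (auto simp: t_def)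
  \<comment> \<open>One rate for all shells of inner radius at most R: the mean projection of the
    inner parallel body is at most (1 + R/r)^m G. As R tends to 0 the rate tends to 4 G / \<kappa> =
    32 sqrt n G.\<close>
  define c where "c = (\<lambda>R. 4 / \<kappa> * ((1 + R / r) ^ m * G))"
  have step: "V (\<rho> + q * \<rho>) - V \<rho> \<le> c R * (q * \<rho>)" if \<rho>: "0 < \<rho>" "\<rho> \<le> R" for \<rho> R
  proof -
    define e where "e = q * \<rho> / \<kappa>"
    have e: "e > 0" "\<kappa> * e = q * \<rho>" using q \<rho> \<kappa> by (auto simp: e_def)
    have "e * (1 + \<kappa>\<^sup>2) = 2 * \<kappa> * \<rho>"
      unfolding e_def q_def using k1 \<kappa> by (simp add: power2_eq_square)
    then have "V (\<rho> + \<kappa> * e) - V \<rho> \<le> 4 * e * mean_proj ?n (add_set K (eball ?n \<rho>))"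
      unfolding V_def \<kappa>_def by (intro shell_volume_le[OF m K \<rho>(1) e(1)]) simp
    also have "\<dots> \<le> 4 * e * ((1 + \<rho> / r) ^ m * G)"
      unfolding G_def using e \<rho> by (intro mult_left_mono mean_proj_parallel_le[OF K]) auto
    also have "\<dots> \<le> 4 * e * ((1 + R / r) ^ m * G)"
      using e \<rho> r G by (intro mult_left_mono mult_right_mono power_mono) (auto intro: divide_right_mono add_nonneg_nonneg)
    also have "\<dots> = c R * (q * \<rho>)" using \<kappa> by (simp add: c_def e_def)
    finally show ?thesis using e by simp
  qed
  have chain: "V R - V (R * t ^ N) \<le> c R * (R - R * t ^ N)" if R: "R > 0" for R N
  proof (induction N)
    case (Suc N)
    have "R * t ^ Suc N \<le> R * 1" using R t by (intro mult_left_mono power_le_one) auto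
    then have "V (R * t ^ Suc N + q * (R * t ^ Suc N)) - V (R * t ^ Suc N) \<le> c R * (q * (R * t ^ Suc N))"
      using R t by (intro step) auto
    moreover have "R * t ^ Suc N + q * (R * t ^ Suc N) = R * t ^ N * (t * (1 + q))" by (simp add: algebra_simps)
    then have eq: "R * t ^ Suc N + q * (R * t ^ Suc N) = R * t ^ N" unfolding t(3) by simp
    then have "q * (R * t ^ Suc N) = R * t ^ N - R * t ^ Suc N" by linarith
    ultimately have "V (R * t ^ N) - V (R * t ^ Suc N) \<le> c R * (R * t ^ N - R * t ^ Suc N)" using eq by metis
    then show ?case using Suc by (simp add: right_diff_distrib)
  qed simp
  have big: "V R - V 0 \<le> c R * R" if R: "R > 0" for R
  proof -
    have cR: "c R \<ge> 0" using R r G \<kappa> by (simp add: c_def)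
    \<comment> \<open>The geometric sequence never reaches radius 0; the remaining parallel body is
      bounded by the homothety estimate, which tends to V 0 as N grows.\<close>
    have "V R \<le> c R * R + (1 + R * t ^ N / r) ^ ?n * V 0" for N
    proof -
      have "V (R * t ^ N) \<le> (1 + R * t ^ N / r) ^ ?n * V 0"
        unfolding V_def using vol_parallel_le[OF K, of "R * t ^ N"] R t by simp
      moreover have "c R * (R - R * t ^ N) \<le> c R * R" using cR R t by (intro mult_left_mono) auto
      ultimately show ?thesis using chain[OF R, of N] by linarith
    qed
    moreover have "(\<lambda>N. c R * R + (1 + R * t ^ N / r) ^ ?n * V 0) \<longlonglongrightarrow> c R * R + (1 + R * 0 / r) ^ ?n * V 0"
      using t r by (intro tendsto_intros LIMSEQ_realpow_zero) auto
    ultimately have "V R \<le> c R * R + (1 + R * 0 / r) ^ ?n * V 0"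
      by (intro LIMSEQ_le_const) auto
    then show ?thesis by simp
  qed
  have "surface_area ?n K \<le> 4 / \<kappa> * ((1 + 0 / r) ^ m * G)"
  proof (rule tendsto_le[OF _ _ surface_area_tendsto[OF K]])
    show "(c \<longlongrightarrow> 4 / \<kappa> * ((1 + 0 / r) ^ m * G)) (at_right 0)"
      unfolding c_def using r by (intro tendsto_intros) auto
    have "\<forall>\<^sub>F s in at_right (0::real). 0 < s" by (simp add: eventually_at_right_less)
    then show "\<forall>\<^sub>F e in at_right 0. (vol ?n (add_set K (eball ?n e)) - vol ?n K) / e \<le> c e"
      by eventually_elim (use big in \<open>simp add: V_def divide_le_eq mult.commute\<close>)
  qed simp
  then show ?thesis by (simp add: \<kappa>_def G_def)
qed

lemma surface_area_pos:
  assumes "cbody n r K" "n \<ge> 1" shows "surface_area n K > 0"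
proof -
  have "0 < 2 * sqrt (real n) * vol n K powr (1 - 1 / real n)"
    using vol_cbody_pos[OF assms(1)] assms(2) by simp
  then show ?thesis using isoperimetric[OF assms] by linarith
qed

section \<open>Reduction to an exponential bound on the surface area\<close>

text \<open>The definition of \<open>surface_area_perp\<close> selects a basis separately for every
  \<xi>. This limit involves only \<open>proj_vol\<close>, and thus makes measurability in \<xi>
  provable.\<close>

lemma surface_area_perp_tendsto:
  assumes K: "cbody (Suc m) r K" and \<xi>: "\<xi> \<in> usphere (Suc m)"
  shows "((\<lambda>e. (proj_vol (Suc m) (add_set K (eball (Suc m) e)) \<xi> - proj_vol (Suc m) K \<xi>) / e)
    \<longlongrightarrow> surface_area_perp (Suc m) \<xi> (proj (Suc m) \<xi> ` K)) (at_right 0)"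
proof -
  obtain b where b: "orthonormal (Suc m) b" "b m = \<xi>"
    "\<And>A. perp_coords (Suc m) \<xi> ` proj (Suc m) \<xi> ` A = coords m (Suc m) b ` A"
    using perp_coords_eq[OF \<xi>] by blast
  have C: "cbody m r (coords m (Suc m) b ` K)" by (rule cbody_coords[OF K b(1)]) simp
  have "\<forall>\<^sub>F s in at_right (0::real). 0 < s" by (simp add: eventually_at_right_less)
  then have "\<forall>\<^sub>F e in at_right 0. (vol m (add_set (coords m (Suc m) b ` K) (eball m e)) - vol m (coords m (Suc m) b ` K)) / e
     = (proj_vol (Suc m) (add_set K (eball (Suc m) e)) \<xi> - proj_vol (Suc m) K \<xi>) / e"
    by eventually_elim (simp add: proj_vol_parallel[OF K b(1,2)] proj_vol_coords[OF b(1,2) cbodyD(1-3)[OF K]])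
  from Lim_transform_eventually[OF surface_area_tendsto[OF C] this]
  show ?thesis by (simp add: surface_area_perp_def b(3))
qed

lemma surface_area_perp_bounds:
  assumes m: "m \<ge> 1" and K: "cbody (Suc m) r K" and \<xi>: "\<xi> \<in> usphere (Suc m)"
  defines "s \<equiv> surface_area_perp (Suc m) \<xi> (proj (Suc m) \<xi> ` K)" and "p \<equiv> proj_vol (Suc m) K \<xi>"
  shows "2 * sqrt (real m) * p powr (1 - 1 / real m) \<le> s" "s \<le> real m / r * p" "0 \<le> s"
proof -
  obtain b where b: "orthonormal (Suc m) b" "b m = \<xi>"
    "\<And>A. perp_coords (Suc m) \<xi> ` proj (Suc m) \<xi> ` A = coords m (Suc m) b ` A"
    using perp_coords_eq[OF \<xi>] by blast
  have C: "cbody m r (coords m (Suc m) b ` K)" by (rule cbody_coords[OF K b(1)]) simp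
  have s: "s = surface_area m (coords m (Suc m) b ` K)" by (simp add: s_def surface_area_perp_def b(3))
  have p: "p = vol m (coords m (Suc m) b ` K)"
    by (simp add: p_def proj_vol_coords[OF b(1,2) cbodyD(1-3)[OF K]])
  show "2 * sqrt (real m) * p powr (1 - 1 / real m) \<le> s" unfolding s p by (rule isoperimetric[OF C m])
  show "s \<le> real m / r * p" unfolding s p by (rule surface_area_le_vol[OF C])
  show "0 \<le> s" unfolding s by (rule surface_area_nonneg[OF C])
qed

lemma integrable_surface_area_perp:
  assumes m: "m \<ge> 1" and K: "cbody (Suc m) r K"
  shows "integrable (sphere_measure (Suc m))
    (\<lambda>\<xi>. indicator (usphere (Suc m)) \<xi> * surface_area_perp (Suc m) \<xi> (proj (Suc m) \<xi> ` K))"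
proof -
  let ?n = "Suc m"
  interpret prob_space "sphere_measure ?n" by (rule prob_space_sphere_measure)
  let ?s = "\<lambda>\<xi>. surface_area_perp ?n \<xi> (proj ?n \<xi> ` K)"
  let ?e = "\<lambda>j. inverse (real (Suc j))"
  let ?f = "\<lambda>j \<xi>. (indicator (usphere ?n) \<xi> * proj_vol ?n (add_set K (eball ?n (?e j))) \<xi>
      - indicator (usphere ?n) \<xi> * proj_vol ?n K \<xi>) / ?e j"
  have r: "r > 0" using cbodyD[OF K] by simp
  have "(\<lambda>\<xi>. indicator (usphere ?n) \<xi> * ?s \<xi>) \<in> borel_measurable (sphere_measure ?n)"
  proof (rule borel_measurable_LIMSEQ_real)
    fix j
    have Kj: "cbody ?n r (add_set K (eball ?n (?e j)))" by (rule cbody_parallel[OF K]) simp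
    note [measurable] = measurable_proj_vol[OF cbodyD(1,3)[OF Kj]] measurable_proj_vol[OF cbodyD(1,3)[OF K]]
    show "?f j \<in> borel_measurable (sphere_measure ?n)" by measurable
  next
    fix \<xi>
    show "(\<lambda>j. ?f j \<xi>) \<longlonglongrightarrow> indicator (usphere ?n) \<xi> * ?s \<xi>"
    proof (cases "\<xi> \<in> usphere ?n")
      case True
      have "filterlim ?e (at_right 0) sequentially"
        unfolding filterlim_at using LIMSEQ_inverse_real_of_nat by auto
      from filterlim_compose[OF surface_area_perp_tendsto[OF K True] this]
      show ?thesis using True by simp
    qed simp
  qed
  moreover have "\<bar>indicator (usphere ?n) \<xi> * ?s \<xi>\<bar> \<le> real m / r * surface_area ?n K" for \<xi>
  proof (cases "\<xi> \<in> usphere ?n")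
    case True
    have "?s \<xi> \<le> real m / r * proj_vol ?n K \<xi>" by (rule surface_area_perp_bounds(2)[OF m K True])
    also have "\<dots> \<le> real m / r * surface_area ?n K"
      using proj_vol_le_surface_area[OF K True] proj_vol_pos[OF K True] r by (intro mult_left_mono) auto
    finally show ?thesis using surface_area_perp_bounds(3)[OF m K True] True by simp
  qed (use r surface_area_nonneg[OF K] in simp)
  ultimately show ?thesis
    by (intro integrable_const_bound[of _ "real m / r * surface_area ?n K"]) auto
qed

text \<open>By the isoperimetric inequality \<open>S(P) \<ge> 2 \<surd>m |P|\<^bsup>1-1/m\<^esup>\<close> for a projection \<open>P\<close> in dimension
  \<open>m = n - 1\<close>. Since \<open>|P| \<le> S(K)\<close>, an exponential bound on \<open>S(K)\<close> makes \<open>|P|\<^bsup>-1/m\<^esup>\<close> at least a constant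
  times \<open>|K|\<^bsup>-1/n\<^esup>\<close>, and the integral of \<open>|P|\<close> is controlled by Cauchy's formula.\<close>

lemma mean_surface_area_ge:
  assumes n: "n \<ge> 2" and K: "cbody n r K" and C: "C \<ge> 1"
    and S: "surface_area n K \<le> C ^ n * vol n K powr (1 - 1 / real n)"
  shows "surface_area n K / (32 * C\<^sup>2) \<le>
     vol n K powr (1 / real n) * (LINT \<xi>:usphere n|sphere_measure n. surface_area_perp n \<xi> (proj n \<xi> ` K))"
proof -
  obtain m where nm: "n = Suc m" and m: "m \<ge> 1" using n by (cases n) auto
  note K = K[unfolded nm]
  let ?n = "Suc m" and ?s = "\<lambda>\<xi>. surface_area_perp (Suc m) \<xi> (proj (Suc m) \<xi> ` K)"
  define A where "A = surface_area ?n K"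
  define V where "V = vol ?n K"
  have A: "A > 0" unfolding A_def using surface_area_pos[OF K] by simp
  have V: "V > 0" unfolding V_def by (rule vol_cbody_pos[OF K])
  \<comment> \<open>Linearises the isoperimetric bound: |P| \<le> A gives |P|^(1 - 1/m) \<ge>
    A^(-1/m) |P|, hence S(P) \<ge> \<alpha> |P| for every projection.\<close>
  define \<alpha> where "\<alpha> = 2 * sqrt (real m) * A powr (- 1 / real m)"
  have \<alpha>: "\<alpha> > 0" using A m by (simp add: \<alpha>_def)
  have "\<alpha> * mean_proj ?n K = (\<integral>\<xi>. \<alpha> * (indicator (usphere ?n) \<xi> * proj_vol ?n K \<xi>) \<partial>sphere_measure ?n)"
    by (simp add: mean_proj_def)
  also have "\<dots> \<le> (\<integral>\<xi>. indicator (usphere ?n) \<xi> * ?s \<xi> \<partial>sphere_measure ?n)"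
  proof (intro integral_mono integrable_mult_right integrable_proj_vol[OF K] integrable_surface_area_perp[OF m K])
    fix \<xi>
    show "\<alpha> * (indicator (usphere ?n) \<xi> * proj_vol ?n K \<xi>) \<le> indicator (usphere ?n) \<xi> * ?s \<xi>"
    proof (cases "\<xi> \<in> usphere ?n")
      case True
      let ?p = "proj_vol ?n K \<xi>"
      have p: "0 < ?p" "?p \<le> A"
        using proj_vol_pos[OF K True] proj_vol_le_surface_area[OF K True] by (auto simp: A_def)
      have "A powr (- 1 / real m) \<le> ?p powr (- 1 / real m)"
        using p by (intro powr_mono2') auto
      then have "\<alpha> * ?p \<le> 2 * sqrt (real m) * ?p powr (- 1 / real m) * ?p"
        unfolding \<alpha>_def using p by (intro mult_right_mono mult_left_mono) auto
      also have "\<dots> = 2 * sqrt (real m) * ?p powr (1 - 1 / real m)"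
        using p by (simp add: powr_diff powr_minus_divide)
      also have "\<dots> \<le> ?s \<xi>" by (rule surface_area_perp_bounds(1)[OF m K True])
      finally show ?thesis using True by simp
    qed simp
  qed
  also have "\<dots> = (LINT \<xi>:usphere ?n|sphere_measure ?n. ?s \<xi>)"
    by (simp add: set_lebesgue_integral_def)
  finally have I: "\<alpha> * mean_proj ?n K \<le> (LINT \<xi>:usphere ?n|sphere_measure ?n. ?s \<xi>)" .
  have "A / (32 * C\<^sup>2) \<le> V powr (1 / real ?n) * (\<alpha> * mean_proj ?n K)"
  proof -
    have MP: "A / (32 * sqrt (real ?n)) \<le> mean_proj ?n K"
      using surface_area_le_mean_proj[OF m K] by (simp add: A_def divide_le_eq mult.commute)
    \<comment> \<open>The exponents of V match exactly, as (1 - 1/n)/m = 1/n for n = m + 1, and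
      C^(n/m) \<le> C^2 because m \<ge> 1.\<close>
    have root: "A powr (1 / real m) \<le> C\<^sup>2 * V powr (1 / real ?n)"
    proof -
      have "A powr (1 / real m) \<le> (C ^ ?n * V powr (1 - 1 / real ?n)) powr (1 / real m)"
        using S A by (intro powr_mono2) (auto simp: A_def V_def nm)
      also have "\<dots> = C powr (real ?n / real m) * V powr ((1 - 1 / real ?n) / real m)"
      proof -
        have "C ^ ?n = C powr real ?n" using C by (intro powr_realpow[symmetric]) simp
        then show ?thesis using C V by (simp add: powr_mult powr_powr del: of_nat_Suc power_Suc)
      qed
      also have "(1 - 1 / real ?n) / real m = 1 / real ?n"
        using m by (simp add: divide_simps)
      also have "C powr (real ?n / real m) \<le> C powr 2" using C m by (intro powr_mono) (auto simp: field_simps)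
      finally show ?thesis using C V by (simp add: powr_numeral)
    qed
    have sq: "sqrt (real ?n) \<le> 2 * sqrt (real m)"
    proof -
      have "sqrt (real ?n) \<le> sqrt (4 * real m)" using m by (intro real_sqrt_le_mono) auto
      then show ?thesis by (simp add: real_sqrt_mult)
    qed
    have inv: "A powr (- 1 / real m) * (C\<^sup>2 * V powr (1 / real ?n)) \<ge> 1"
    proof -
      have "1 = A powr (- 1 / real m) * A powr (1 / real m)" using A by (simp add: powr_add[symmetric])
      also have "\<dots> \<le> A powr (- 1 / real m) * (C\<^sup>2 * V powr (1 / real ?n))"
        using root by (intro mult_left_mono) auto
      finally show ?thesis .
    qed
    have C2: "C\<^sup>2 > 0" using C by simp
    have "A / (32 * C\<^sup>2) \<le> A / (32 * C\<^sup>2) * (A powr (- 1 / real m) * (C\<^sup>2 * V powr (1 / real ?n)))"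
    proof -
      have "0 \<le> A / (32 * C\<^sup>2)" using A C2 by simp
      from mult_left_mono[OF inv this] show ?thesis by (simp only: mult_1_right)
    qed
    also have "\<dots> = V powr (1 / real ?n) * A powr (- 1 / real m) * (A / 32)"
      using C2 by simp
    also have "\<dots> \<le> V powr (1 / real ?n) * A powr (- 1 / real m) * (2 * sqrt (real m) * (A / (32 * sqrt (real ?n))))"
    proof (intro mult_left_mono)
      have "sqrt (real ?n) * (A / (32 * sqrt (real ?n))) \<le> 2 * sqrt (real m) * (A / (32 * sqrt (real ?n)))"
        using sq A by (intro mult_right_mono) auto
      then show "A / 32 \<le> 2 * sqrt (real m) * (A / (32 * sqrt (real ?n)))" by simp
    qed auto
    also have "\<dots> = V powr (1 / real ?n) * (\<alpha> * (A / (32 * sqrt (real ?n))))" by (simp add: \<alpha>_def mult_ac)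
    also have "\<dots> \<le> V powr (1 / real ?n) * (\<alpha> * mean_proj ?n K)"
      using MP \<alpha> by (intro mult_left_mono) auto
    finally show ?thesis .
  qed
  also have "\<dots> \<le> V powr (1 / real ?n) * (LINT \<xi>:usphere ?n|sphere_measure ?n. ?s \<xi>)"
    using I by (intro mult_left_mono) auto
  finally show ?thesis unfolding nm A_def V_def .
qed

section \<open>Separation and inscribed balls\<close>

text \<open>u points from the nearest point x0 of K to p. Moving from x0 towards another x in K
  cannot decrease the distance to p, which forces x - x0 to make no acute angle with p - x0.\<close>

lemma separation:
  assumes K: "compact K" "convex K" "K \<subseteq> rspace n" "K \<noteq> {}" and p: "p \<in> rspace n" "p \<notin> K"
  obtains u where "u \<in> usphere n" "\<And>x. x \<in> K \<Longrightarrow> ip n x u < ip n p u"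
proof -
  have "continuous_on K (\<lambda>x. nm n (x - p))" by (intro fun_cont)
  from continuous_attains_inf[OF K(1,4) this]
  obtain x0 where x0: "x0 \<in> K" "\<And>x. x \<in> K \<Longrightarrow> nm n (x0 - p) \<le> nm n (x - p)" by auto
  define v where "v = p - x0"
  have v: "v \<in> rspace n" "v \<noteq> 0" using p K(3) x0(1) by (auto simp: v_def)
  have nv: "nm n v > 0" using nm_eq_0[OF v(1)] v(2) L2_set_nonneg[of v "{..<n}"] by linarith
  have le: "ip n (x - x0) v \<le> 0" if x: "x \<in> K" for x
  proof -
    have "0 \<le> - 2 * ip n (x - x0) v + t * ip n (x - x0) (x - x0)" if t: "0 < t" "t \<le> 1" for t
    proof -
      let ?y = "x0 + t *\<^sub>R (x - x0)"
      have "?y = (1 - t) *\<^sub>R x0 + t *\<^sub>R x" by (simp add: algebra_simps)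
      then have "?y \<in> K" using convexD[OF K(2) x0(1) x, of "1 - t" t] t by simp
      then have "(nm n (x0 - p))\<^sup>2 \<le> (nm n (?y - p))\<^sup>2" by (intro power_mono x0(2)) auto
      moreover have "?y - p = t *\<^sub>R (x - x0) - v" "x0 - p = - v" by (simp_all add: v_def)
      ultimately have "ip n (- v) (- v) \<le> ip n (t *\<^sub>R (x - x0) - v) (t *\<^sub>R (x - x0) - v)"
        by (simp only: ip_self)
      then have "0 \<le> t * (- 2 * ip n (x - x0) v + t * ip n (x - x0) (x - x0))"
        unfolding ip_diff_left[of n "t *\<^sub>R (x - x0)"] ip_diff_right[of n _ "t *\<^sub>R (x - x0)"]
          ip_scale_left ip_scale_right ip_minus_left ip_minus_right ip_commute[of n v "x - x0"]
        by (simp add: algebra_simps)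
      then show ?thesis using t by (simp add: zero_le_mult_iff)
    qed
    then have *: "0 \<le> - 2 * ip n (x - x0) v + t * ip n (x - x0) (x - x0)" if "0 < t" "t \<le> 1" for t
      using that by blast
    show ?thesis
    proof (rule ccontr)
      let ?a = "ip n (x - x0) v" and ?q = "ip n (x - x0) (x - x0)"
      assume "\<not> ?a \<le> 0"
      then have a: "?a > 0" by simp
      \<comment> \<open>Small enough for the quadratic term to stay below the linear one;
        \<open>?q + 1\<close> avoids division by zero when x = x0.\<close>
      define t where "t = min 1 (?a / (?q + 1))"
      have q: "?q + 1 > 0" using ip_self_nonneg[of n "x - x0"] by linarith
      have t: "0 < t" "t \<le> 1" using a q by (auto simp: t_def)
      have "t * ?q \<le> ?a / (?q + 1) * ?q" using ip_self_nonneg[of n "x - x0"] by (intro mult_right_mono) (auto simp: t_def)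
      also have "\<dots> \<le> ?a" using a q by (simp add: field_simps)
      finally show False using *[OF t] a by simp
    qed
  qed
  show ?thesis
  proof (rule that[of "(1 / nm n v) *\<^sub>R v"])
    show "(1 / nm n v) *\<^sub>R v \<in> usphere n" by (rule normalize_usphere[OF v])
    fix x assume "x \<in> K"
    then have "ip n x v \<le> ip n x0 v" using le[of x] by (simp add: ip_simps)
    moreover have "ip n p v - ip n x0 v = ip n v v" by (simp add: v_def ip_simps)
    moreover have "ip n v v > 0" using nv by (simp add: ip_self)
    ultimately have "ip n x v < ip n p v" by linarith
    then show "ip n x ((1 / nm n v) *\<^sub>R v) < ip n p ((1 / nm n v) *\<^sub>R v)"
      using nv by (simp add: ip_scale_right divide_strict_right_mono)
  qed
qed

text \<open>The source of inscribed balls for the isotropic, minimal mean width and Loewner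
  positions: a point of the ball outside K would be separated from K in a direction u in which K
  stays below d.\<close>

lemma ball_subset_if_support:
  assumes K: "compact K" "convex K" "K \<subseteq> rspace n" "K \<noteq> {}" and a: "a \<in> rspace n"
    and d: "\<And>u. u \<in> usphere n \<Longrightarrow> \<exists>x\<in>K. d \<le> ip n (x - a) u"
  shows "add_set {a} (eball n d) \<subseteq> K"
proof
  fix p assume "p \<in> add_set {a} (eball n d)"
  then obtain z where z: "p = a + z" "z \<in> eball n d" by (auto elim: add_setE)
  show "p \<in> K"
  proof (rule ccontr)
    assume "p \<notin> K"
    moreover have "p \<in> rspace n" using z a by (auto simp: eball_iff)
    ultimately obtain u where u: "u \<in> usphere n" "\<And>x. x \<in> K \<Longrightarrow> ip n x u < ip n p u"
      using separation[OF K] by blast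
    obtain x where x: "x \<in> K" "d \<le> ip n (x - a) u" using d[OF u(1)] by blast
    have "ip n z u \<le> d" using ip_le[of n z u] z u(1) by (simp add: usphere_iff eball_iff)
    then show False using u(2)[OF x(1)] x(2) by (simp add: z(1) ip_simps)
  qed
qed

section \<open>Linear maps\<close>

lemma lin_rspace: "lin n T x \<in> rspace n"
  by (simp add: lin_def rspace_iff)

lemma lin_linear:
  "lin n T (x + y) = lin n T x + lin n T y"
  "lin n T (c *\<^sub>R x) = c *\<^sub>R lin n T x"
  by (auto simp: lin_def fun_eq_iff fun_apply algebra_simps sum.distrib sum_distrib_left)

lemma continuous_on_lin: "continuous_on S (lin n T)"
proof (rule continuous_on_coordinatewise_then_product)
  fix i
  have "continuous_on S (\<lambda>x. \<Sum>j<n. T $$ (i, j) * (x j :: real))"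
    by (intro continuous_intros continuous_on_fun_apply[OF continuous_on_id])
  then show "continuous_on S (\<lambda>x. lin n T x i)" by (cases "i < n") (auto simp: lin_def)
qed

lemma compact_lin: "compact K \<Longrightarrow> compact (lin n T ` K)"
  by (intro compact_continuous_image continuous_on_lin)

lemma convex_lin:
  assumes "convex K" shows "convex (lin n T ` K)"
proof (rule convexI)
  fix x y and u v :: real
  assume *: "x \<in> lin n T ` K" "y \<in> lin n T ` K" "0 \<le> u" "0 \<le> v" "u + v = 1"
  then obtain x' y' where xy: "x' \<in> K" "x = lin n T x'" "y' \<in> K" "y = lin n T y'" by auto
  have "u *\<^sub>R x + v *\<^sub>R y = lin n T (u *\<^sub>R x' + v *\<^sub>R y')" by (simp only: xy lin_linear)
  then show "u *\<^sub>R x + v *\<^sub>R y \<in> lin n T ` K"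
    using convexD[OF assms xy(1,3) *(3-5)] by (metis image_eqI)
qed

lemma lin_mult:
  assumes "A \<in> carrier_mat n n" "B \<in> carrier_mat n n"
  shows "lin n (A * B) x = lin n A (lin n B x)"
proof
  fix i
  have e: "(A * B) $$ (i, j) = (\<Sum>k<n. A $$ (i, k) * B $$ (k, j))" if "i < n" "j < n" for j
    using that assms by (simp add: scalar_prod_def atLeast0LessThan)
  show "lin n (A * B) x i = lin n A (lin n B x) i"
  proof (cases "i < n")
    case True
    then have "lin n (A * B) x i = (\<Sum>j<n. \<Sum>k<n. A $$ (i, k) * B $$ (k, j) * x j)"
      by (simp add: lin_def e sum_distrib_right)
    also have "\<dots> = (\<Sum>k<n. \<Sum>j<n. A $$ (i, k) * B $$ (k, j) * x j)" by (rule sum.swap)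
    also have "\<dots> = lin n A (lin n B x) i"
      using True by (simp add: lin_def sum_distrib_left mult.assoc)
    finally show ?thesis .
  qed (simp add: lin_def)
qed

lemma lin_one: "x \<in> rspace n \<Longrightarrow> lin n (1\<^sub>m n) x = x"
proof
  fix i assume x: "x \<in> rspace n"
  have "lin n (1\<^sub>m n) x i = (\<Sum>j<n. if j = i then x j else 0)" if i: "i < n"
  proof -
    have "lin n (1\<^sub>m n) x i = (\<Sum>j<n. 1\<^sub>m n $$ (i, j) * x j)" using i by (simp add: lin_def)
    also have "\<dots> = (\<Sum>j<n. if j = i then x j else 0)" using i by (intro sum.cong refl) auto
    finally show ?thesis .
  qed
  then show "lin n (1\<^sub>m n) x i = x i" using rspaceD[OF x, of i] by (cases "i < n") (auto simp: lin_def)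
qed

section \<open>Maps that scale an axis and its orthogonal complement separately\<close>

text \<open>For a unit vector u, the symmetric map with eigenvalue \<beta> along u and eigenvalue
  \<alpha> on the orthogonal complement.\<close>

definition axial :: "nat \<Rightarrow> real \<Rightarrow> real \<Rightarrow> (nat \<Rightarrow> real) \<Rightarrow> (nat \<Rightarrow> real) \<Rightarrow> nat \<Rightarrow> real" where
  "axial n \<alpha> \<beta> u x = \<alpha> *\<^sub>R x + ((\<beta> - \<alpha>) * ip n u x) *\<^sub>R u"

definition axial_mat :: "nat \<Rightarrow> real \<Rightarrow> real \<Rightarrow> (nat \<Rightarrow> real) \<Rightarrow> real mat" where
  "axial_mat n \<alpha> \<beta> u = mat n n (\<lambda>(i, j). (if i = j then \<alpha> else 0) + (\<beta> - \<alpha>) * u i * u j)"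

lemma axial_mat_carrier [simp]: "axial_mat n \<alpha> \<beta> u \<in> carrier_mat n n"
  by (simp add: axial_mat_def)

lemma axial_rspace: "u \<in> usphere n \<Longrightarrow> x \<in> rspace n \<Longrightarrow> axial n \<alpha> \<beta> u x \<in> rspace n"
  by (auto simp: axial_def usphere_iff)

lemma lin_axial:
  assumes u: "u \<in> usphere n" and x: "x \<in> rspace n"
  shows "lin n (axial_mat n \<alpha> \<beta> u) x = axial n \<alpha> \<beta> u x"
proof
  fix i
  show "lin n (axial_mat n \<alpha> \<beta> u) x i = axial n \<alpha> \<beta> u x i"
  proof (cases "i < n")
    case True
    have "lin n (axial_mat n \<alpha> \<beta> u) x i = (\<Sum>j<n. (if i = j then \<alpha> * x j else 0) + (\<beta> - \<alpha>) * (u j * x j) * u i)"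
      using True by (auto simp: lin_def axial_mat_def algebra_simps intro!: sum.cong)
    also have "\<dots> = \<alpha> * x i + (\<beta> - \<alpha>) * ip n u x * u i"
      using True by (simp add: sum.distrib ip_def sum_distrib_left sum_distrib_right)
    finally show ?thesis by (simp add: axial_def fun_apply)
  next
    case False
    then show ?thesis using rspaceD[OF lin_rspace, of n i] rspaceD[OF axial_rspace[OF u x], of i] by simp
  qed
qed

lemma ip_axial:
  assumes u: "u \<in> usphere n"
  shows "ip n u (axial n \<alpha> \<beta> u x) = \<beta> * ip n u x"
  using usphere_ip[OF u] by (simp add: axial_def ip_simps algebra_simps)

lemma axial_axial:
  assumes u: "u \<in> usphere n"
  shows "axial n \<alpha> \<beta> u (axial n \<alpha>' \<beta>' u x) = axial n (\<alpha> * \<alpha>') (\<beta> * \<beta>') u x"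
proof -
  have "axial n \<alpha> \<beta> u (axial n \<alpha>' \<beta>' u x) = \<alpha> *\<^sub>R (\<alpha>' *\<^sub>R x + ((\<beta>' - \<alpha>') * ip n u x) *\<^sub>R u) + ((\<beta> - \<alpha>) * (\<beta>' * ip n u x)) *\<^sub>R u"
    unfolding axial_def[of n \<alpha>] ip_axial[OF u] unfolding axial_def ..
  also have "\<dots> = axial n (\<alpha> * \<alpha>') (\<beta> * \<beta>') u x"
    by (rule ext) (simp add: axial_def fun_apply algebra_simps)
  finally show ?thesis .
qed

lemma axial_1: "axial n 1 1 u x = x"
  by (simp add: axial_def)

lemma axial_linear:
  "axial n \<alpha> \<beta> u (x + y) = axial n \<alpha> \<beta> u x + axial n \<alpha> \<beta> u y"
  "axial n \<alpha> \<beta> u (c *\<^sub>R x) = c *\<^sub>R axial n \<alpha> \<beta> u x"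
  "axial n (c * \<alpha>) (c * \<beta>) u x = axial n \<alpha> \<beta> u (c *\<^sub>R x)"
  by (simp_all add: axial_def ip_simps algebra_simps)

text \<open>In an orthonormal basis ending in u the matrix becomes diagonal: it is C D B, where C is
  both the transpose and the inverse of B.\<close>

lemma det_axial:
  assumes u: "u \<in> usphere (Suc m)"
  shows "Determinant.det (axial_mat (Suc m) \<alpha> \<beta> u) = \<alpha> ^ m * \<beta>"
proof -
  let ?n = "Suc m"
  obtain b where b: "orthonormal ?n b" "b m = u" using orthonormal_exists[OF u] by auto
  define d where "d = (\<lambda>j. if j = m then \<beta> else \<alpha>)"
  define B where "B = mat ?n ?n (\<lambda>(j, k). b j k)"
  define C where "C = mat ?n ?n (\<lambda>(k, j). b j k)"
  define D where "D = mat ?n ?n (\<lambda>(i, j). if i = j then d i else 0)"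
  have car: "B \<in> carrier_mat ?n ?n" "C \<in> carrier_mat ?n ?n" "D \<in> carrier_mat ?n ?n"
    by (auto simp: B_def C_def D_def)
  have BC: "B * C = 1\<^sub>m ?n"
  proof (rule eq_matI)
    fix j k assume "j < dim_row (1\<^sub>m ?n)" "k < dim_col (1\<^sub>m ?n)"
    then have jk: "j < ?n" "k < ?n" by auto
    then have "(B * C) $$ (j, k) = (\<Sum>i = 0..<?n. b j i * b k i)"
      by (simp add: B_def C_def scalar_prod_def)
    also have "\<dots> = ip ?n (b j) (b k)" by (simp only: ip_def atLeast0LessThan)
    finally show "(B * C) $$ (j, k) = 1\<^sub>m ?n $$ (j, k)" using b jk by (simp add: orthonormal_def)
  qed (auto simp: B_def C_def)
  have CB: "C * B = 1\<^sub>m ?n" by (rule mat_mult_left_right_inverse[OF car(1,2) BC])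
  have o: "(\<Sum>j<?n. b j i * b j k) = (if i = k then 1 else 0)" if "i < ?n" "k < ?n" for i k
  proof -
    have "(C * B) $$ (i, k) = (\<Sum>j = 0..<?n. b j i * b j k)"
      using that by (simp add: B_def C_def scalar_prod_def)
    then show ?thesis using CB that by (simp add: atLeast0LessThan)
  qed
  have DB: "(D * B) $$ (j, k) = d j * b j k" if "j < ?n" "k < ?n" for j k
  proof -
    have "(D * B) $$ (j, k) = (\<Sum>i = 0..<?n. (if j = i then d j else 0) * b i k)"
      using that by (simp add: D_def B_def scalar_prod_def)
    also have "\<dots> = (\<Sum>i = 0..<?n. if j = i then d j * b i k else 0)" by (intro sum.cong) auto
    also have "\<dots> = d j * b j k" using that by simp
    finally show ?thesis .
  qed
  have "axial_mat ?n \<alpha> \<beta> u = C * (D * B)"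
  proof (rule eq_matI)
    fix i k assume "i < dim_row (C * (D * B))" "k < dim_col (C * (D * B))"
    then have ik: "i < ?n" "k < ?n" using car by auto
    have "(C * (D * B)) $$ (i, k) = (\<Sum>j = 0..<?n. C $$ (i, j) * (D * B) $$ (j, k))"
      using ik car by (simp add: scalar_prod_def)
    also have "\<dots> = (\<Sum>j<?n. b j i * (d j * b j k))"
      using ik DB by (simp only: atLeast0LessThan) (simp add: C_def)
    also have "\<dots> = (\<Sum>j<?n. \<alpha> * (b j i * b j k) + (if j = m then (\<beta> - \<alpha>) * (b j i * b j k) else 0))"
      by (intro sum.cong refl) (auto simp: d_def algebra_simps)
    also have "\<dots> = \<alpha> * (\<Sum>j<?n. b j i * b j k) + (\<beta> - \<alpha>) * (b m i * b m k)"
      by (simp only: sum.distrib sum_distrib_left) simp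
    also have "\<dots> = axial_mat ?n \<alpha> \<beta> u $$ (i, k)"
      unfolding o[OF ik] using ik b(2) by (simp add: axial_mat_def)
    finally show "axial_mat ?n \<alpha> \<beta> u $$ (i, k) = (C * (D * B)) $$ (i, k)" by simp
  qed (use car in \<open>auto simp: axial_mat_def\<close>)
  then have "Determinant.det (axial_mat ?n \<alpha> \<beta> u) = Determinant.det C * (Determinant.det D * Determinant.det B)"
    using car by (simp add: det_mult[of _ ?n])
  moreover have "Determinant.det B * Determinant.det C = 1"
    using det_mult[OF car(1,2)] BC by simp
  moreover have "Determinant.det D = \<alpha> ^ m * \<beta>"
  proof -
    have "Determinant.det D = prod_list (diag_mat D)"
      by (rule det_upper_triangular[OF _ car(3)]) (auto simp: D_def upper_triangular_def)
    also have "\<dots> = (\<Prod>i = 0..<?n. d i)"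
      unfolding prod_list_diag_prod using car(3) by (auto simp: D_def intro!: prod.cong)
    also have "\<dots> = (\<Prod>i = 0..<m. \<alpha>) * \<beta>" by (simp add: d_def)
    finally show ?thesis by simp
  qed
  ultimately show ?thesis by (metis mult.assoc mult.commute mult_1)
qed

lemma vol_diag:
  assumes A: "compact A" and d: "\<And>i. d i > 0"
  shows "vol n ((\<lambda>x i. d i * x i) ` A) = (\<Prod>i<n. d i) * vol n A"
proof -
  let ?f = "\<lambda>x i. d i * (x i :: real)"
  have "continuous_on A ?f"
    by (rule continuous_on_coordinatewise_then_product)
       (intro continuous_intros continuous_on_fun_apply[OF continuous_on_id])
  then have cS: "compact (?f ` A)" using A by (rule compact_continuous_image)
  note [measurable] = sets_compact[OF A] sets_compact[OF cS]
  have inj: "?f x \<in> ?f ` A \<longleftrightarrow> x \<in> A" for x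
  proof
    assume "?f x \<in> ?f ` A"
    then obtain y where y: "y \<in> A" "?f x = ?f y" by auto
    have "x = y"
    proof
      fix i show "x i = y i" using fun_cong[OF y(2), of i] d[of i] by simp
    qed
    then show "x \<in> A" using y(1) by simp
  qed auto
  have "emeasure (lebn n) (?f ` A) = (\<integral>\<^sup>+x. indicator (?f ` A) x \<partial>lebn n)" by simp
  also have "\<dots> = ennreal (\<Prod>i<n. \<bar>d i\<bar>) * (\<integral>\<^sup>+x. indicator (?f ` A) (?f x) \<partial>lebn n)"
    by (rule nn_integral_lebn_diag) (use d in \<open>auto simp: less_imp_neq[symmetric]\<close>)
  also have "(\<lambda>x. indicator (?f ` A) (?f x)) = (indicator A :: (nat \<Rightarrow> real) \<Rightarrow> ennreal)"
    unfolding fun_eq_iff indicator_def inj by simp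
  also have "(\<Prod>i<n. \<bar>d i\<bar>) = (\<Prod>i<n. d i)" using d by (intro prod.cong) (auto simp: less_imp_le)
  finally have "emeasure (lebn n) (?f ` A) = ennreal (\<Prod>i<n. d i) * emeasure (lebn n) A" by simp
  moreover have "(\<Prod>i<n. d i) \<ge> 0" using d by (intro prod_nonneg) (auto intro: less_imp_le)
  ultimately show ?thesis by (simp add: vol_def measure_def enn2real_mult)
qed

text \<open>Both A and its image are rotated into coordinates in which the map is diagonal, where
  the recursive integration formula applies.\<close>

lemma vol_axial:
  assumes u: "u \<in> usphere (Suc m)" and A: "compact A" "A \<subseteq> rspace (Suc m)" and pos: "\<alpha> > 0" "\<beta> > 0"
  shows "vol (Suc m) (axial (Suc m) \<alpha> \<beta> u ` A) = \<alpha> ^ m * \<beta> * vol (Suc m) A"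
proof -
  let ?n = "Suc m"
  obtain b where b: "orthonormal ?n b" "b m = u" using orthonormal_exists[OF u] by auto
  define d where "d = (\<lambda>j. if j = m then \<beta> else \<alpha>)"
  let ?c = "coords ?n ?n b"
  have "continuous_on A (axial ?n \<alpha> \<beta> u)" unfolding axial_def
    by (intro fun_cont continuous_on_mult)
  then have cA: "compact (axial ?n \<alpha> \<beta> u ` A)" using A(1) by (rule compact_continuous_image)
  have sA: "axial ?n \<alpha> \<beta> u ` A \<subseteq> rspace ?n" using A(2) axial_rspace[OF u] by auto
  have diag: "?c (axial ?n \<alpha> \<beta> u x) = (\<lambda>i. d i * ?c x i)" for x
  proof
    fix i show "?c (axial ?n \<alpha> \<beta> u x) i = d i * ?c x i"
      using b by (auto simp: coords_def axial_def ip_simps d_def orthonormal_def algebra_simps ip_commute[of ?n _ x])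
  qed
  have "vol ?n (axial ?n \<alpha> \<beta> u ` A) = vol ?n (?c ` axial ?n \<alpha> \<beta> u ` A)"
    by (rule vol_coords[OF b(1) cA sA, symmetric])
  also have "?c ` axial ?n \<alpha> \<beta> u ` A = (\<lambda>x i. d i * x i) ` ?c ` A" by (simp add: image_image diag)
  also have "vol ?n \<dots> = (\<Prod>i<?n. d i) * vol ?n (?c ` A)"
    by (rule vol_diag[OF compact_coords[OF A(1)]]) (use pos in \<open>simp add: d_def\<close>)
  also have "(\<Prod>i<?n. d i) = \<alpha> ^ m * \<beta>"
  proof -
    have "(\<Prod>i<m. d i) = (\<Prod>i<m. \<alpha>)" by (intro prod.cong) (auto simp: d_def)
    then show ?thesis by (simp add: d_def)
  qed
  finally show ?thesis by (simp add: vol_coords[OF b(1) A])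
qed

lemma lin_axial_image:
  "u \<in> usphere n \<Longrightarrow> A \<subseteq> rspace n \<Longrightarrow> lin n (axial_mat n \<alpha> \<beta> u) ` A = axial n \<alpha> \<beta> u ` A"
  by (intro image_cong refl lin_axial) auto

section \<open>The five positions\<close>

text \<open>From S(K) \<le> n|K|/r, with n absorbed into 2^n. With D = 64 this yields the constant
  128.\<close>

lemma surface_area_le_if_inradius:
  assumes n: "n \<ge> 1" and K: "cbody n r K" and D: "D \<ge> 0" and le: "vol n K powr (1 / real n) \<le> D ^ n * r"
  shows "surface_area n K \<le> (2 * D) ^ n * vol n K powr (1 - 1 / real n)"
proof -
  let ?V = "vol n K"
  have V: "?V > 0" by (rule vol_cbody_pos[OF K])
  have r: "r > 0" using cbodyD[OF K] by simp
  have "surface_area n K \<le> real n / r * ?V" by (rule surface_area_le_vol[OF K])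
  also have "?V = ?V powr (1 / real n) * ?V powr (1 - 1 / real n)" using V by (simp add: powr_add[symmetric])
  also have "real n / r * \<dots> \<le> real n / r * (D ^ n * r * ?V powr (1 - 1 / real n))"
    using le r by (intro mult_left_mono mult_right_mono) auto
  also have "\<dots> = real n * D ^ n * ?V powr (1 - 1 / real n)" using r by simp
  also have "\<dots> \<le> 2 ^ n * D ^ n * ?V powr (1 - 1 / real n)"
    using D of_nat_less_two_power[of n, where 'a=real] by (intro mult_right_mono) auto
  finally show ?thesis by (simp add: power_mult_distrib)
qed

lemma vol_root_le_if_subset_ball:
  assumes n: "n \<ge> 1" and K: "K \<in> sets borel" "K \<subseteq> add_set {a} (eball n R)" and a: "a \<in> rspace n" and R: "R \<ge> 0"
  shows "vol n K powr (1 / real n) \<le> 2 * R"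
proof -
  have "vol n K \<le> vol n (add_set {a} (eball n R))"
    using a by (intro vol_mono K compact_add_set compact_eball add_set_rspace eball_subset_rspace) auto
  also have "\<dots> = vol n (eball n R)" by (rule vol_translate[OF _ a]) simp
  also have "\<dots> \<le> (2 * R) ^ n" by (rule vol_eball_le[OF R])
  finally have "vol n K powr (1 / real n) \<le> ((2 * R) ^ n) powr (1 / real n)" by (intro powr_mono2) auto
  also have "\<dots> = 2 * R"
  proof (cases "R = 0")
    case False
    then have "(2 * R) ^ n = (2 * R) powr real n" using R by (intro powr_realpow[symmetric]) simp
    then show ?thesis using n R by (simp only: powr_powr) simp
  qed (use n in simp)
  finally show ?thesis .
qed

text \<open>The circumscribed ball bounds |K|^(1/n) by 2 * 8^n r \<le> 64^n r, so the inradius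
  criterion applies with D = 64.\<close>

lemma surface_area_le_if_eccentricity:
  assumes n: "n \<ge> 1" and K: "cbody n r K" and a: "a \<in> rspace n"
    and far: "\<And>x. x \<in> K \<Longrightarrow> nm n (x - a) \<le> 8 ^ n * r"
  shows "surface_area n K \<le> 128 ^ n * vol n K powr (1 - 1 / real n)"
proof -
  note k = cbodyD[OF K]
  have "K \<subseteq> add_set {a} (eball n (8 ^ n * r))"
  proof
    fix x assume x: "x \<in> K"
    then have "x - a \<in> eball n (8 ^ n * r)" using k(3) a far by (auto simp: eball_iff)
    then show "x \<in> add_set {a} (eball n (8 ^ n * r))" using add_setI[of a "{a}" "x - a"] by simp
  qed
  then have "vol n K powr (1 / real n) \<le> 2 * (8 ^ n * r)"
    using k(4) a by (intro vol_root_le_if_subset_ball[OF n k(5)]) auto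
  also have "\<dots> \<le> 64 ^ n * r"
  proof -
    have "(8::real) \<le> 8 ^ n" using n by (intro self_le_power) auto
    then have "(2::real) \<le> 8 ^ n" by linarith
    then have "(2::real) * 8 ^ n \<le> 8 ^ n * 8 ^ n" by (rule mult_right_mono) simp
    also have "\<dots> = 64 ^ n" by (simp add: power_mult_distrib[symmetric])
    finally show ?thesis using k(4) by (simp add: mult.assoc[symmetric] mult_right_mono)
  qed
  finally show ?thesis using surface_area_le_if_inradius[OF n K, of 64] by simp
qed

section \<open>Bounded eccentricity: John's position and minimal surface area\<close>

text \<open>If \<open>K\<close> contains a ball of radius \<open>r\<close> and a point much farther away, it contains an ellipsoid that
  is thin orthogonally to \<open>u\<close>, but so long in the direction of \<open>u\<close> that a volume preserving axial map
  takes it to a ball of radius \<open>2 r\<close>.\<close>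

lemma long_ellipsoid_subset:
  assumes K: "convex K" and a: "a \<in> rspace (Suc m)" "add_set {a} (eball (Suc m) r) \<subseteq> K" and r: "r > 0"
    and x: "x \<in> K" "x \<in> rspace (Suc m)" and far: "8 ^ Suc m * r < nm (Suc m) (x - a)"
  obtains u c where "u \<in> usphere (Suc m)" "c \<in> rspace (Suc m)"
    "\<And>z. z \<in> eball (Suc m) (2 * r) \<Longrightarrow> c + axial (Suc m) (1 / 8) (8 ^ m) u z \<in> K"
proof -
  let ?n = "Suc m"
  define D where "D = nm ?n (x - a)"
  define u where "u = (1 / D) *\<^sub>R (x - a)"
  define c where "c = a + (1 / 2) *\<^sub>R (x - a)"
  have "0 < 8 ^ ?n * r" using r by simp
  then have D: "D > 0" "8 * 8 ^ m * r \<le> D" using far unfolding D_def by (linarith, simp)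
  have "x - a \<noteq> 0" using D by (auto simp: D_def)
  then have u: "u \<in> usphere ?n" unfolding u_def D_def using x a by (intro normalize_usphere) auto
  have c: "c \<in> rspace ?n" using x a by (auto simp: c_def)
  have "c + axial ?n (1 / 8) (8 ^ m) u z \<in> K" if z: "z \<in> eball ?n (2 * r)" for z
  proof -
    define s where "s = ip ?n u z"
    define w where "w = (1 / 8) *\<^sub>R (z - s *\<^sub>R u)"
    define \<tau> where "\<tau> = 8 ^ m * s / D"
    \<comment> \<open>The target point is (1 - l) x + l (a + w/l): its axial part moves it by \<tau>
      (x - a) away from the midpoint c, and w is its orthogonal part. Since D \<ge> 8 * 8^m r and
      |s| \<le> 2r, the shift satisfies |\<tau>| \<le> 1/4, so l \<ge> 1/4; as w has norm at most
      r/4, the point a + w/l stays in the ball.\<close>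
    define l where "l = 1 / 2 - \<tau>"
    have zr: "z \<in> rspace ?n" "nm ?n z \<le> 2 * r" using z by (auto simp: eball_iff)
    have s: "\<bar>s\<bar> \<le> 2 * r" using abs_ip_le[of ?n u z] u zr by (simp add: s_def usphere_iff)
    have "\<bar>\<tau>\<bar> \<le> 1 / 4"
    proof -
      have "8 ^ m * \<bar>s\<bar> * 4 \<le> 8 ^ m * (2 * r) * 4" using s by (intro mult_left_mono mult_right_mono) auto
      also have "\<dots> \<le> D" using D(2) by (simp add: mult_ac)
      finally have "8 ^ m * \<bar>s\<bar> * 4 \<le> D" .
      then show ?thesis using D(1) by (simp add: \<tau>_def abs_mult field_simps)
    qed
    then have l: "1 / 4 \<le> l" "l \<le> 3 / 4" by (auto simp: l_def abs_le_iff)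
    have w: "w \<in> rspace ?n" "nm ?n w \<le> l * r"
    proof -
      show "w \<in> rspace ?n" using zr u by (auto simp: w_def usphere_iff)
      have "ip ?n (z - s *\<^sub>R u) (z - s *\<^sub>R u) = ip ?n z z - s\<^sup>2"
        using usphere_ip[OF u] by (simp add: ip_simps s_def ip_commute[of ?n z u] power2_eq_square)
      then have "ip ?n (z - s *\<^sub>R u) (z - s *\<^sub>R u) \<le> (nm ?n z)\<^sup>2" by (simp add: ip_self)
      also have "\<dots> \<le> (2 * r)\<^sup>2" using zr by (intro power_mono) auto
      finally have "nm ?n (z - s *\<^sub>R u) \<le> 2 * r" using r by (simp add: nm_le_iff)
      then have "nm ?n w \<le> r / 4" by (simp add: w_def)
      also have "\<dots> \<le> l * r" using l r by simp
      finally show "nm ?n w \<le> l * r" .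
    qed
    have "(1 / l) *\<^sub>R w \<in> eball ?n r" using w l by (simp add: eball_iff divide_le_eq mult.commute)
    then have "a + (1 / l) *\<^sub>R w \<in> K" using a(2) add_setI[of a "{a}"] by blast
    from convexD[OF K x(1) this, of "1 - l" l] l
    have "(1 - l) *\<^sub>R x + l *\<^sub>R (a + (1 / l) *\<^sub>R w) \<in> K" by auto
    moreover have "(1 - l) *\<^sub>R x + l *\<^sub>R (a + (1 / l) *\<^sub>R w) = c + axial ?n (1 / 8) (8 ^ m) u z"
    proof -
      have su: "(8 ^ m * s) *\<^sub>R u = \<tau> *\<^sub>R (x - a)" by (simp add: u_def \<tau>_def)
      have "axial ?n (1 / 8) (8 ^ m) u z = w + (8 ^ m * s) *\<^sub>R u"
        by (simp add: axial_def w_def s_def[symmetric] algebra_simps scaleR_diff_left)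
      then have "c + axial ?n (1 / 8) (8 ^ m) u z = a + (1 / 2 + \<tau>) *\<^sub>R (x - a) + w"
        unfolding su by (simp add: c_def scaleR_add_left algebra_simps)
      moreover have "1 / 2 + \<tau> = 1 - l" by (simp add: l_def)
      moreover have "(1 - l) *\<^sub>R x + l *\<^sub>R (a + (1 / l) *\<^sub>R w) = a + (1 - l) *\<^sub>R (x - a) + w"
        using l by (simp add: scaleR_add_right algebra_simps)
      ultimately show ?thesis by simp
    qed
    ultimately show ?thesis by simp
  qed
  then show ?thesis using that u c by blast
qed

text \<open>A point of K beyond distance 8^n r would produce an ellipsoid in K with the volume of a
  ball of radius 2r, which exceeds the maximal volume.\<close>

lemma john_imp:
  assumes n: "n \<ge> 2" and K: "convex_body n K" and J: "john_position n K"
  shows "\<exists>r. cbody n r K \<and> surface_area n K \<le> 128 ^ n * vol n K powr (1 - 1 / real n)"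
proof -
  obtain m where nm: "n = Suc m" using n by (cases n) auto
  note Kb = convex_body_imp[OF K[unfolded nm]]
  obtain r where r: "r > 0" "max_inscribed_ellipsoid (Suc m) K (eball (Suc m) r)" using J nm by (auto simp: john_position_def)
  then have sub: "add_set {0} (eball (Suc m) r) \<subseteq> K" by (auto simp: max_inscribed_ellipsoid_def add_set_eq)
  have cb: "cbody (Suc m) r K" using Kb r sub unfolding cbody_def by (intro conjI bexI[of _ 0]) auto
  have "nm (Suc m) (x - 0) \<le> 8 ^ Suc m * r" if x: "x \<in> K" for x
  proof (rule ccontr)
    assume "\<not> ?thesis"
    then have far: "8 ^ Suc m * r < nm (Suc m) (x - 0)" by simp
    obtain u c where uc: "u \<in> usphere (Suc m)" "c \<in> rspace (Suc m)"
      "\<And>z. z \<in> eball (Suc m) (2 * r) \<Longrightarrow> c + axial (Suc m) (1 / 8) (8 ^ m) u z \<in> K"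
      using long_ellipsoid_subset[OF Kb(3) _ sub r(1) x _ far] x Kb(2) by auto
    \<comment> \<open>The axial map of determinant 1 from \<open>long_ellipsoid_subset\<close>,
      composed with scaling by 2r so that it acts on the unit ball.\<close>
    let ?T = "axial_mat (Suc m) (2 * r * (1 / 8)) (2 * r * 8 ^ m) u"
    let ?E = "add_set {c} (lin (Suc m) ?T ` eball (Suc m) 1)"
    have img: "lin (Suc m) ?T ` eball (Suc m) 1 = axial (Suc m) (1 / 8) (8 ^ m) u ` eball (Suc m) (2 * r)"
    proof -
      have "lin (Suc m) ?T ` eball (Suc m) 1 = axial (Suc m) (2 * r * (1 / 8)) (2 * r * 8 ^ m) u ` eball (Suc m) 1"
        by (rule lin_axial_image[OF uc(1) eball_subset_rspace])
      also have "\<dots> = axial (Suc m) (1 / 8) (8 ^ m) u ` (\<lambda>x. (2 * r) *\<^sub>R x) ` eball (Suc m) 1"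
        unfolding axial_linear(3) image_image ..
      finally show ?thesis using scale_eball[of "2 * r" "Suc m" 1] r by simp
    qed
    have "ellipsoid (Suc m) ?E" unfolding ellipsoid_def
      using uc(2) det_axial[OF uc(1)] r(1) by (intro bexI[of _ ?T] bexI[of _ c] conjI refl) auto
    moreover have "?E \<subseteq> K" unfolding img using uc(3) by (auto elim!: add_setE)
    ultimately have "vol (Suc m) ?E \<le> vol (Suc m) (eball (Suc m) r)"
      using r(2) by (simp add: max_inscribed_ellipsoid_def)
    moreover have "vol (Suc m) ?E = vol (Suc m) (eball (Suc m) (2 * r))"
    proof -
      have "vol (Suc m) ?E = vol (Suc m) (lin (Suc m) ?T ` eball (Suc m) 1)"
        by (rule vol_translate[OF sets_compact[OF compact_lin[OF compact_eball]] uc(2)])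
      also have "\<dots> = (1 / 8) ^ m * 8 ^ m * vol (Suc m) (eball (Suc m) (2 * r))"
        unfolding img by (rule vol_axial[OF uc(1) compact_eball eball_subset_rspace]) auto
      finally show ?thesis by (simp add: power_mult_distrib[symmetric])
    qed
    moreover have "vol (Suc m) (eball (Suc m) (2 * r)) = 2 ^ Suc m * vol (Suc m) (eball (Suc m) r)"
      using vol_eball_scale[of "2 * r" "Suc m"] vol_eball_scale[of r "Suc m"] r by (simp add: power_mult_distrib)
    moreover have "(2::real) ^ Suc m > 1" by (rule one_less_power) auto
    ultimately show False using vol_eball_pos[OF r(1), of "Suc m"]
      by (smt (verit) mult_less_cancel_right1)
  qed
  then have "surface_area (Suc m) K \<le> 128 ^ Suc m * vol (Suc m) K powr (1 - 1 / real (Suc m))"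
    by (intro surface_area_le_if_eccentricity[OF _ cb, of 0]) auto
  then show ?thesis using cb unfolding nm by blast
qed

text \<open>Among volume-preserving linear images of K, take one whose inradius is nearly maximal. A
  very distant point in it would allow an axial map to double the inscribed ball; so this image has
  bounded eccentricity and satisfies the surface area bound. Minimality hands the bound to K, whose
  volume is the same.\<close>

lemma minimal_surface_area_imp:
  assumes n: "n \<ge> 2" and K: "convex_body n K" and M: "minimal_surface_area_position n K"
  shows "\<exists>r. cbody n r K \<and> surface_area n K \<le> 128 ^ n * vol n K powr (1 - 1 / real n)"
proof -
  obtain m where nm: "n = Suc m" using n by (cases n) auto
  let ?n = "Suc m"
  note Kb = convex_body_imp[OF K[unfolded nm]]
  obtain r0 where cb: "cbody ?n r0 K" using convex_body_imp_cbody[OF K] nm by auto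
  \<comment> \<open>Invariance of volumes is demanded along with determinant 1, since volume
    distortion is computed here only for axial maps; the set is stable under composition with those
    of determinant 1.\<close>
  define \<T> where "\<T> = {T \<in> SL ?n. \<forall>A. compact A \<and> A \<subseteq> rspace ?n \<longrightarrow> vol ?n (lin ?n T ` A) = vol ?n A}"
  define R where "R = {\<rho>. 0 < \<rho> \<and> (\<exists>T\<in>\<T>. \<exists>a\<in>rspace ?n. add_set {a} (eball ?n \<rho>) \<subseteq> lin ?n T ` K)}"
  have lone: "lin ?n (1\<^sub>m ?n) ` A = A" if "A \<subseteq> rspace ?n" for A
  proof -
    have "lin ?n (1\<^sub>m ?n) ` A = (\<lambda>x. x) ` A" by (intro image_cong refl lin_one) (use that in auto)
    then show ?thesis by simp
  qed
  have "1\<^sub>m ?n \<in> \<T>" by (auto simp: \<T>_def SL_def lone)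
  moreover obtain a0 where "a0 \<in> rspace ?n" "add_set {a0} (eball ?n r0) \<subseteq> K" using cb by (auto simp: cbody_def)
  then have "add_set {a0} (eball ?n r0) \<subseteq> lin ?n (1\<^sub>m ?n) ` K" using lone[OF Kb(2)] by simp
  ultimately have r0R: "r0 \<in> R" unfolding R_def using cbodyD(4)[OF cb] \<open>a0 \<in> rspace ?n\<close> by blast
  have bdd: "bdd_above R"
  proof (rule bdd_aboveI)
    fix \<rho> assume "\<rho> \<in> R"
    then obtain T a where Ta: "\<rho> > 0" "T \<in> \<T>" "a \<in> rspace ?n" "add_set {a} (eball ?n \<rho>) \<subseteq> lin ?n T ` K"
      by (auto simp: R_def)
    have "vol ?n (add_set {a} (eball ?n \<rho>)) \<le> vol ?n (lin ?n T ` K)"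
      by (rule vol_mono[OF Ta(4)]) (auto intro!: sets_compact compact_add_set compact_eball compact_lin Kb lin_rspace)
    also have "\<dots> = vol ?n K" using Ta(2) Kb by (auto simp: \<T>_def)
    finally have "(2 * \<rho> / sqrt (real ?n)) ^ ?n \<le> vol ?n K"
      using vol_eball_ge[of \<rho> ?n] vol_translate[of "eball ?n \<rho>" a ?n] Ta(1,3) by simp
    moreover have "2 * \<rho> / sqrt (real ?n) \<le> 1 + (2 * \<rho> / sqrt (real ?n)) ^ ?n"
      using Ta(1) self_le_power[of "2 * \<rho> / sqrt (real ?n)" ?n]
      by (cases "2 * \<rho> / sqrt (real ?n) \<ge> 1") (auto intro: add_increasing2)
    ultimately have "2 * \<rho> / sqrt (real ?n) \<le> 1 + vol ?n K" by linarith
    then show "\<rho> \<le> (1 + vol ?n K) * sqrt (real ?n)"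
      using Ta(1) by (simp add: divide_le_eq)
  qed
  have Sup: "0 < Sup R" using cSup_upper[OF r0R bdd] cbodyD(4)[OF cb] by simp
  then obtain \<rho> where \<rho>: "\<rho> \<in> R" "Sup R / 2 < \<rho>"
    using less_cSup_iff[OF _ bdd, of "Sup R / 2"] r0R by auto
  \<comment> \<open>A radius within a factor 2 of the supremum already contradicts the existence of
    an image with a ball of twice that radius.\<close>
  have no: "2 * \<rho> \<notin> R" using cSup_upper[OF _ bdd, of "2 * \<rho>"] \<rho>(2) by force
  obtain T a where Ta: "\<rho> > 0" "T \<in> \<T>" "a \<in> rspace ?n" "add_set {a} (eball ?n \<rho>) \<subseteq> lin ?n T ` K"
    using \<rho>(1) by (auto simp: R_def)
  let ?L = "lin ?n T ` K"
  have L: "compact ?L" "convex ?L" "?L \<subseteq> rspace ?n" using Kb by (auto intro: compact_lin convex_lin lin_rspace)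
  have cL: "cbody ?n \<rho> ?L" unfolding cbody_def using L Ta by blast
  have Tc: "T \<in> carrier_mat ?n ?n" "Determinant.det T = 1" using Ta(2) by (auto simp: \<T>_def SL_def)
  have "nm ?n (x - a) \<le> 8 ^ ?n * \<rho>" if x: "x \<in> ?L" for x
  proof (rule ccontr)
    assume "\<not> ?thesis"
    then have far: "8 ^ ?n * \<rho> < nm ?n (x - a)" by simp
    obtain u c where uc: "u \<in> usphere ?n" "c \<in> rspace ?n"
      "\<And>z. z \<in> eball ?n (2 * \<rho>) \<Longrightarrow> c + axial ?n (1 / 8) (8 ^ m) u z \<in> ?L"
      using long_ellipsoid_subset[OF L(2) Ta(3,4,1) x _ far] x L(3) by blast
    \<comment> \<open>The inverse of the axial map with factors 1/8 and 8^m; it turns the long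
      ellipsoid inside the image into a ball of radius 2 \<rho>.\<close>
    let ?M = "axial_mat ?n 8 ((1 / 8) ^ m) u" and ?f = "axial ?n 8 ((1 / 8) ^ m) u"
    have one: "8 ^ m * (1 / 8) ^ m = (1::real)" by (simp add: power_mult_distrib[symmetric])
    have MT: "lin ?n (?M * T) ` A = ?f ` lin ?n T ` A" for A
      using lin_mult[OF axial_mat_carrier Tc(1)] lin_axial[OF uc(1) lin_rspace] by (auto simp: image_image)
    have "?M * T \<in> \<T>" unfolding \<T>_def
    proof (intro CollectI conjI allI impI)
      show "?M * T \<in> SL ?n" unfolding SL_def
        using Tc det_mult[OF axial_mat_carrier Tc(1)] det_axial[OF uc(1)] one
          mult_carrier_mat[OF axial_mat_carrier Tc(1)] by simp
      fix A assume A: "compact A \<and> A \<subseteq> rspace ?n"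
      have "vol ?n (?f ` lin ?n T ` A) = 8 ^ m * (1 / 8) ^ m * vol ?n (lin ?n T ` A)"
        using A by (intro vol_axial[OF uc(1)]) (auto intro: compact_lin lin_rspace)
      then show "vol ?n (lin ?n (?M * T) ` A) = vol ?n A" using MT A Ta(2) one by (auto simp: \<T>_def)
    qed
    moreover have "?f c \<in> rspace ?n" by (rule axial_rspace[OF uc(1,2)])
    moreover have "add_set {?f c} (eball ?n (2 * \<rho>)) \<subseteq> lin ?n (?M * T) ` K"
    proof
      fix y assume "y \<in> add_set {?f c} (eball ?n (2 * \<rho>))"
      then obtain z where z: "y = ?f c + z" "z \<in> eball ?n (2 * \<rho>)" by (auto elim: add_setE)
      have "?f (c + axial ?n (1 / 8) (8 ^ m) u z) = y"
        using one by (simp add: z(1) axial_linear axial_axial[OF uc(1)] axial_1 mult.commute)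
      then show "y \<in> lin ?n (?M * T) ` K" unfolding MT using uc(3)[OF z(2)] by blast
    qed
    ultimately have "\<exists>T\<in>\<T>. \<exists>a\<in>rspace ?n. add_set {a} (eball ?n (2 * \<rho>)) \<subseteq> lin ?n T ` K" by blast
    then have "2 * \<rho> \<in> R" unfolding R_def using Ta(1) by simp
    then show False using no by simp
  qed
  then have "surface_area ?n ?L \<le> 128 ^ ?n * vol ?n ?L powr (1 - 1 / real ?n)"
    by (intro surface_area_le_if_eccentricity[OF _ cL Ta(3)]) auto
  moreover have "vol ?n ?L = vol ?n K" using Ta(2) Kb by (auto simp: \<T>_def)
  moreover have "surface_area ?n K \<le> surface_area ?n ?L"
    using M Ta(2) unfolding nm minimal_surface_area_position_def \<T>_def by blast
  ultimately show ?thesis using cb unfolding nm by auto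
qed

section \<open>Loewner's position\<close>

text \<open>If \<open>K\<close> lies in the part \<open>\<langle>x, u\<rangle> \<le> \<delta> R\<close> of the ball of radius \<open>R\<close>, then \<open>(s + 1) (s - \<delta>) \<le> 0\<close> for
  \<open>s = \<langle>x, u\<rangle> / R\<close>, so \<open>K\<close> lies in the ellipsoid \<open>\<parallel>x\<parallel>\<^sup>2 / R\<^sup>2 + \<mu> (s + 1) (s - \<delta>) \<le> 1\<close>. Its volume is
  smaller than that of the ball for \<open>\<mu> = 1/n\<close> and \<open>\<delta> = 1/(4n)\<close>.\<close>

lemma loewner_imp:
  assumes n: "n \<ge> 2" and K: "convex_body n K" and Lw: "loewner_position n K"
  shows "\<exists>r. cbody n r K \<and> surface_area n K \<le> 128 ^ n * vol n K powr (1 - 1 / real n)"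
proof -
  obtain m where nm: "n = Suc m" using n by (cases n) auto
  let ?n = "Suc m"
  define N where "N = real ?n"
  have N: "N \<ge> 2" using n nm by (simp add: N_def)
  note Kb = convex_body_imp[OF K[unfolded nm]]
  obtain R where R: "R > 0" "min_enclosing_ellipsoid ?n K (eball ?n R)" using Lw nm by (auto simp: loewner_position_def)
  then have KR: "K \<subseteq> eball ?n R" by (simp add: min_enclosing_ellipsoid_def)
  obtain r0 where cb0: "cbody ?n r0 K" using convex_body_imp_cbody[OF K] nm by auto
  have ne: "K \<noteq> {}" using vol_cbody_pos[OF cb0] by (auto simp: vol_def)
  define \<delta> where "\<delta> = 1 / (4 * N)"
  define \<mu> where "\<mu> = 1 / N"
  \<comment> \<open>Completing the square in s turns the quadratic condition into an ellipsoid
    centred at -\<kappa> R u, with semi-axis \<rho> R / \<tau> along u and \<rho> R orthogonally to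
    it. P is the resulting constant on the right-hand side.\<close>
  define \<kappa> where "\<kappa> = \<mu> * (1 - \<delta>) / (2 * (1 + \<mu>))"
  define P where "P = 1 + \<mu> * \<delta> + (1 + \<mu>) * \<kappa>\<^sup>2"
  define \<rho> where "\<rho> = sqrt P"
  define \<tau> where "\<tau> = sqrt (1 + \<mu>)"
  have d: "0 < \<delta>" "\<delta> < 1" "0 < \<mu>" using N by (auto simp: \<delta>_def \<mu>_def field_simps)
  have P: "P > 0" using d by (simp add: P_def add_pos_nonneg)
  have \<rho>: "\<rho> > 0" "\<rho>\<^sup>2 = P" using P by (auto simp: \<rho>_def)
  have \<tau>: "\<tau> > 0" "\<tau>\<^sup>2 = 1 + \<mu>" using d by (auto simp: \<tau>_def)
  have Ple: "P \<le> 1 + 1 / (2 * N\<^sup>2)"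
  proof -
    have "\<kappa> \<le> \<mu> * 1 / (2 * (1 + \<mu>))" unfolding \<kappa>_def using d by (intro divide_right_mono mult_left_mono) auto
    moreover have "0 \<le> \<kappa>" unfolding \<kappa>_def using d by simp
    ultimately have "\<kappa>\<^sup>2 \<le> (\<mu> / (2 * (1 + \<mu>)))\<^sup>2" by (intro power_mono) auto
    then have "(1 + \<mu>) * \<kappa>\<^sup>2 \<le> (1 + \<mu>) * (\<mu> / (2 * (1 + \<mu>)))\<^sup>2" using d by (intro mult_left_mono) auto
    also have "\<dots> = \<mu>\<^sup>2 / 4 / (1 + \<mu>)"
    proof -
      have "t * (\<mu> / (2 * t))\<^sup>2 = \<mu>\<^sup>2 / 4 / t" if "t > 0" for t using that by (simp add: power2_eq_square)
      from this[of "1 + \<mu>"] show ?thesis using d by linarith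
    qed
    also have "\<dots> \<le> \<mu>\<^sup>2 / 4" using d by (simp add: divide_le_eq mult_left_le_one_le)
    finally have "(1 + \<mu>) * \<kappa>\<^sup>2 \<le> \<mu>\<^sup>2 / 4" .
    moreover have "\<mu> * \<delta> = 1 / (4 * N\<^sup>2)" "\<mu>\<^sup>2 / 4 = 1 / (4 * N\<^sup>2)" "1 / (2 * N\<^sup>2) = 2 * (1 / (4 * N\<^sup>2))"
      by (simp_all add: \<mu>_def \<delta>_def power2_eq_square)
    ultimately show ?thesis unfolding P_def by linarith
  qed
  \<comment> \<open>The volume ratio of the new ellipsoid to the ball is \<rho>^n / \<tau>. Its
    square is below 1 because P^N \<le> exp(1/(2N)) < 1 + 1/N = \<tau>^2.\<close>
  have small: "\<rho> ^ ?n < \<tau>"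
  proof -
    have "(\<rho> ^ ?n)\<^sup>2 = P ^ ?n" unfolding \<rho>(2)[symmetric] by (simp only: power_mult[symmetric] mult.commute)
    also have "\<dots> \<le> exp (1 / (2 * N\<^sup>2)) ^ ?n"
      using P Ple exp_ge_add_one_self[of "1 / (2 * N\<^sup>2)"] by (intro power_mono) linarith+
    also have "\<dots> = exp (N * (1 / (2 * N\<^sup>2)))" unfolding N_def by (rule exp_of_nat_mult[symmetric])
    also have "N * (1 / (2 * N\<^sup>2)) = 1 / (2 * N)" using N by (simp add: power2_eq_square)
    also have "exp (1 / (2 * N)) \<le> 1 + 1 / (2 * N) + (1 / (2 * N))\<^sup>2" using N by (intro exp_bound) auto
    also have "\<dots> < 1 + \<mu>" using N by (simp add: \<mu>_def power2_eq_square field_simps)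
    finally have "(\<rho> ^ ?n)\<^sup>2 < \<tau>\<^sup>2" using \<tau> by simp
    then show ?thesis using \<tau>(1) by (intro power2_less_imp_less[of _ \<tau>]) auto
  qed
  have "\<exists>x\<in>K. R * \<delta> \<le> ip ?n (x - 0) u" if u: "u \<in> usphere ?n" for u
  proof (rule ccontr)
    assume "\<not> ?thesis"
    then have lt: "ip ?n x u < R * \<delta>" if "x \<in> K" for x using that by (auto simp: not_le)
    define c where "c = (- \<kappa> * R) *\<^sub>R u"
    have ur: "u \<in> rspace ?n" using u by (simp add: usphere_iff)
    have c: "c \<in> rspace ?n" using ur by (auto simp: c_def)
    let ?T = "axial_mat ?n (\<rho> * R) (\<rho> * R / \<tau>) u"
    let ?E = "add_set {c} (lin ?n ?T ` eball ?n 1)"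
    have img: "lin ?n ?T ` eball ?n 1 = axial ?n (\<rho> * R) (\<rho> * R / \<tau>) u ` eball ?n 1"
      by (rule lin_axial_image[OF u eball_subset_rspace])
    have "Determinant.det ?T \<noteq> 0" using det_axial[OF u] \<rho>(1) R(1) \<tau>(1) by simp
    then have "ellipsoid ?n ?E" unfolding ellipsoid_def using c by (intro bexI[of _ ?T] bexI[of _ c] conjI refl) auto
    moreover have "K \<subseteq> ?E"
    proof
      fix x assume x: "x \<in> K"
      then have xr: "x \<in> rspace ?n" "nm ?n x \<le> R" using KR by (auto simp: eball_iff)
      define s where "s = ip ?n u x / R"
      define z where "z = axial ?n (1 / (\<rho> * R)) (\<tau> / (\<rho> * R)) u (x - c)"
      have sR: "ip ?n u x = s * R" using R by (simp add: s_def)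
      have s: "s \<le> \<delta>" "- 1 \<le> s"
      proof -
        show "s \<le> \<delta>" using lt[OF x] R(1) by (simp add: s_def ip_commute[of ?n u] divide_le_eq mult.commute)
        have "- ip ?n u x \<le> R" using abs_ip_le[of ?n u x] u xr by (simp add: usphere_iff)
        then show "- 1 \<le> s" using R(1) by (simp add: s_def le_divide_eq)
      qed
      have "nm ?n z \<le> 1"
      proof -
        let ?w = "x - c"
        have uw: "ip ?n u ?w = (s + \<kappa>) * R"
          using usphere_ip[OF u] by (simp add: c_def ip_simps sR algebra_simps)
        have ww: "ip ?n ?w ?w = ip ?n x x + 2 * \<kappa> * s * R\<^sup>2 + \<kappa>\<^sup>2 * R\<^sup>2"
          using usphere_ip[OF u]
          by (simp add: c_def ip_simps ip_commute[of ?n x u] sR power2_eq_square algebra_simps)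
        have ax2: "ip ?n (axial ?n \<alpha> \<beta> u y) (axial ?n \<alpha> \<beta> u y) = \<alpha>\<^sup>2 * ip ?n y y + (\<beta>\<^sup>2 - \<alpha>\<^sup>2) * (ip ?n u y)\<^sup>2" for \<alpha> \<beta> y
          using usphere_ip[OF u]
          by (simp add: axial_def ip_simps ip_commute[of ?n y u] power2_eq_square algebra_simps)
        have "ip ?n z z = (1 / (\<rho> * R))\<^sup>2 * ip ?n ?w ?w + ((\<tau> / (\<rho> * R))\<^sup>2 - (1 / (\<rho> * R))\<^sup>2) * ((s + \<kappa>) * R)\<^sup>2"
          unfolding z_def ax2 uw ..
        also have "\<dots> = (ip ?n ?w ?w + \<mu> * ((s + \<kappa>) * R)\<^sup>2) / (\<rho> * R)\<^sup>2"
          using \<tau>(2) by (simp add: power_divide add_divide_distrib diff_divide_distrib algebra_simps)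
        also have "\<dots> \<le> 1"
        proof -
          have "ip ?n x x \<le> R\<^sup>2" using xr R by (simp add: nm_le_iff[symmetric])
          then have "ip ?n ?w ?w + \<mu> * ((s + \<kappa>) * R)\<^sup>2 \<le> R\<^sup>2 * (1 + 2 * \<kappa> * s + \<kappa>\<^sup>2 + \<mu> * (s + \<kappa>)\<^sup>2)"
            unfolding ww power_mult_distrib by (simp add: algebra_simps)
          also have "1 + 2 * \<kappa> * s + \<kappa>\<^sup>2 + \<mu> * (s + \<kappa>)\<^sup>2 = P + \<mu> * ((s + 1) * (s - \<delta>))"
          proof -
            have "2 * (1 + \<mu>) * \<kappa> = \<mu> * (1 - \<delta>)" unfolding \<kappa>_def using d by simp
            then have "2 * (1 + \<mu>) * \<kappa> * s = \<mu> * (1 - \<delta>) * s" by simp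
            then show ?thesis unfolding P_def by (simp add: power2_eq_square algebra_simps)
          qed
          also have "R\<^sup>2 * \<dots> \<le> R\<^sup>2 * P"
          proof (intro mult_left_mono)
            have "(s + 1) * (s - \<delta>) \<le> 0" using s by (simp add: mult_nonneg_nonpos)
            then show "P + \<mu> * ((s + 1) * (s - \<delta>)) \<le> P" using d by (simp add: mult_nonneg_nonpos)
          qed simp
          also have "R\<^sup>2 * P = (\<rho> * R)\<^sup>2" using \<rho>(2) by (simp add: power_mult_distrib mult.commute)
          finally have le: "ip ?n ?w ?w + \<mu> * ((s + \<kappa>) * R)\<^sup>2 \<le> (\<rho> * R)\<^sup>2" .
          have pos: "(\<rho> * R)\<^sup>2 > 0" using \<rho>(1) R(1) by simp
          from le show ?thesis unfolding divide_le_eq_1_pos[OF pos] .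
        qed
        finally show ?thesis by (simp add: nm_le_iff)
      qed
      moreover have "z \<in> rspace ?n" unfolding z_def using u xr c by (intro axial_rspace) auto
      ultimately have "z \<in> eball ?n 1" by (simp add: eball_iff)
      moreover have "axial ?n (\<rho> * R) (\<rho> * R / \<tau>) u z = x - c"
        unfolding z_def axial_axial[OF u] using \<rho>(1) R(1) \<tau>(1) by (simp add: axial_1)
      ultimately have "x - c \<in> lin ?n ?T ` eball ?n 1" unfolding img by (metis image_eqI)
      then show "x \<in> ?E" using add_setI[of c "{c}" "x - c"] by simp
    qed
    ultimately have "vol ?n (eball ?n R) \<le> vol ?n ?E" using R(2) by (simp add: min_enclosing_ellipsoid_def)
    also have "vol ?n ?E = vol ?n (lin ?n ?T ` eball ?n 1)"
      by (rule vol_translate[OF sets_compact[OF compact_lin[OF compact_eball]] c])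
    also have "\<dots> = (\<rho> * R) ^ m * (\<rho> * R / \<tau>) * vol ?n (eball ?n 1)"
      unfolding img using \<rho>(1) R(1) \<tau>(1) by (intro vol_axial[OF u compact_eball eball_subset_rspace]) auto
    also have "\<dots> = \<rho> ^ ?n / \<tau> * vol ?n (eball ?n R)"
      unfolding vol_eball_scale[OF R(1)] by (simp add: power_mult_distrib mult_ac)
    also have "\<dots> < 1 * vol ?n (eball ?n R)"
      using small \<tau>(1) by (intro mult_strict_right_mono vol_eball_pos[OF R(1)]) simp
    finally show False by simp
  qed
  then have "add_set {0} (eball ?n (R * \<delta>)) \<subseteq> K"
    by (intro ball_subset_if_support[OF Kb(1,3,2) ne]) auto
  then have cb: "cbody ?n (R * \<delta>) K" using Kb R(1) d unfolding cbody_def by (intro conjI bexI[of _ 0]) auto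
  have "K \<subseteq> add_set {0} (eball ?n R)" using KR by (auto simp: add_set_eq)
  then have "vol ?n K powr (1 / real ?n) \<le> 2 * R"
    using R(1) by (intro vol_root_le_if_subset_ball[OF _ cbodyD(5)[OF cb]]) auto
  also have "\<dots> \<le> 64 ^ ?n * (R * \<delta>)"
  proof -
    have "8 * N \<le> 8 ^ ?n * 2 ^ ?n"
    proof (intro mult_mono)
      show "(8::real) \<le> 8 ^ ?n" by (rule self_le_power) auto
      show "N \<le> 2 ^ ?n" unfolding N_def using of_nat_less_two_power[of ?n, where 'a=real] by linarith
    qed (use N in auto)
    also have "\<dots> = 16 ^ ?n" by (simp add: power_mult_distrib[symmetric])
    also have "\<dots> \<le> 64 ^ ?n" by (intro power_mono) auto
    finally have "R * (8 * N) \<le> R * 64 ^ ?n" using R(1) by (intro mult_left_mono) auto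
    then show ?thesis using N by (simp add: \<delta>_def field_simps)
  qed
  finally have "surface_area ?n K \<le> (2 * 64) ^ ?n * vol ?n K powr (1 - 1 / real ?n)"
    by (intro surface_area_le_if_inradius[OF _ cb]) auto
  then show ?thesis using cb unfolding nm by auto
qed

section \<open>Centroids and the isotropic position\<close>

lemma integrable_on_compact:
  fixes f :: "(nat \<Rightarrow> real) \<Rightarrow> real"
  assumes K: "compact K" "K \<subseteq> rspace n" and f: "continuous_on UNIV f"
  shows "integrable (lebn n) (\<lambda>x. indicator K x * f x)"
proof -
  have "compact (f ` K)" using K(1) f by (intro compact_continuous_image) (auto intro: continuous_on_subset)
  then obtain B where B: "\<And>x. x \<in> K \<Longrightarrow> norm (f x) \<le> B"
    using compact_imp_bounded[of "f ` K"] unfolding bounded_iff by auto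
  have "f \<in> borel_measurable borel" using f by (rule borel_measurable_continuous_onI)
  then have "integrable (lebn n) (\<lambda>x. indicator K x *\<^sub>R f x)"
    using emeasure_compact_finite[OF K] sets_compact[OF K(1)] B
    by (intro integrableI_bounded_set_indicator[where B=B]) auto
  then show ?thesis by simp
qed

lemma integral_indicator_compact:
  assumes "compact K" "K \<subseteq> rspace n"
  shows "integrable (lebn n) (indicator K :: _ \<Rightarrow> real)" "(\<integral>x. indicator K x \<partial>lebn n) = vol n K"
  using integrable_on_compact[OF assms, of "\<lambda>_. 1"] by (auto simp: vol_def)

text \<open>A weak form of Gruenbaum's inequality: the copy \<open>(K + x\<^sub>0)/2\<close> of \<open>K\<close> has a fixed share \<open>2\<^sup>-\<^sup>n\<close> of the volume,
  so a point \<open>x\<^sub>0\<close> far on the negative side has to be balanced on the positive side.\<close>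

lemma gruenbaum_weak:
  assumes K: "cbody n r K" and 0: "(\<integral>x. indicator K x * ip n (x - g) u \<partial>lebn n) = 0"
    and a: "\<And>x. x \<in> K \<Longrightarrow> ip n (x - g) u \<le> a" and x0: "x0 \<in> K"
  shows "a - ip n (x0 - g) u \<le> 2 ^ Suc n * a"
proof -
  note k = cbodyD[OF K]
  let ?f = "\<lambda>x. ip n (x - g) u"
  let ?H = "(\<lambda>x. (1 / 2) *\<^sub>R x) ` K"
  let ?K = "add_set {(1 / 2) *\<^sub>R x0} ?H"
  have x0r: "x0 \<in> rspace n" using x0 k by auto
  have cH: "compact ?H" by (rule compact_scale_image[OF k(1)])
  have cK: "compact ?K" by (intro compact_add_set cH) simp
  have sub: "?K \<subseteq> K"
  proof
    fix y assume "y \<in> ?K"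
    then obtain x where "x \<in> K" "y = (1 / 2) *\<^sub>R x0 + (1 / 2) *\<^sub>R x" by (auto elim!: add_setE)
    then show "y \<in> K" using convexD[OF k(2) x0, of x "1 / 2" "1 / 2"] by simp
  qed
  have sK: "?K \<subseteq> rspace n" using sub k by blast
  have vK: "vol n ?K = vol n K / 2 ^ n"
  proof -
    have "vol n ?K = vol n ?H" by (rule vol_translate[OF sets_compact[OF cH]]) (simp add: x0r)
    also have "\<dots> = (1 / 2) ^ n * vol n K" by (rule vol_scale[OF k(5)]) simp
    finally show ?thesis by (simp add: power_one_over)
  qed
  have pt: "indicator K x * ?f x \<le> a * indicator K x - (a - ?f x0) / 2 * indicator ?K x" for x
  proof (cases "x \<in> ?K")
    case True
    then obtain y where y: "y \<in> K" "x = (1 / 2) *\<^sub>R x0 + (1 / 2) *\<^sub>R y" by (auto elim!: add_setE)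
    have "x - g = (1 / 2) *\<^sub>R ((x0 - g) + (y - g))" by (rule ext) (simp add: y(2) fun_apply field_simps)
    then have "?f x = 1 / 2 * (?f x0 + ?f y)" by (simp only: ip_scale_left ip_add_left)
    then have "?f x \<le> a - (a - ?f x0) / 2" using a[OF y(1)] by argo
    moreover have "x \<in> K" using True sub by blast
    ultimately show ?thesis using True by simp
  next
    case False
    then show ?thesis using a by (auto simp: indicator_def)
  qed
  have "(\<integral>x. indicator K x * ?f x \<partial>lebn n) \<le> (\<integral>x. a * indicator K x - (a - ?f x0) / 2 * indicator ?K x \<partial>lebn n)"
  proof (rule integral_mono[OF _ _ pt])
    show "integrable (lebn n) (\<lambda>x. indicator K x * ?f x)"
      by (intro integrable_on_compact k fun_cont)
    show "integrable (lebn n) (\<lambda>x. a * indicator K x - (a - ?f x0) / 2 * indicator ?K x)"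
      by (intro Bochner_Integration.integrable_diff integrable_mult_right integral_indicator_compact k cK sK)
  qed
  also have "\<dots> = a * vol n K - (a - ?f x0) / 2 * vol n ?K"
    using integral_indicator_compact[OF k(1,3)] integral_indicator_compact[OF cK sK]
    by (subst Bochner_Integration.integral_diff) auto
  finally have "0 \<le> a * vol n K - (a - ?f x0) / 2 * (vol n K / 2 ^ n)" unfolding 0 vK .
  then have "0 \<le> vol n K * (a - (a - ?f x0) / 2 / 2 ^ n)" by (simp only: right_diff_distrib) (simp add: mult_ac)
  then have "(a - ?f x0) / 2 / 2 ^ n \<le> a" using vol_cbody_pos[OF K] by (simp add: zero_le_mult_iff)
  then show ?thesis by (simp add: field_simps)
qed

lemma integral_ip_compact:
  assumes K: "compact K" "K \<subseteq> rspace n"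
  shows "(\<integral>x. indicator K x * ip n (x - g) u \<partial>lebn n) =
     (\<Sum>i<n. ((\<integral>x. indicator K x * x i \<partial>lebn n) - g i * vol n K) * u i)"
proof -
  have int: "integrable (lebn n) (\<lambda>x. indicator K x * x i)" for i
    by (intro integrable_on_compact K continuous_on_fun_apply[OF continuous_on_id])
  note ind = integral_indicator_compact[OF K]
  have "(\<integral>x. indicator K x * ip n (x - g) u \<partial>lebn n) =
     (\<integral>x. (\<Sum>i<n. (indicator K x * x i - g i * indicator K x) * u i) \<partial>lebn n)"
    by (simp add: ip_def fun_apply sum_distrib_left algebra_simps)
  also have "\<dots> = (\<Sum>i<n. \<integral>x. (indicator K x * x i - g i * indicator K x) * u i \<partial>lebn n)"
    by (intro Bochner_Integration.integral_sum integrable_mult_left Bochner_Integration.integrable_diff int integrable_mult_right ind)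
  also have "\<dots> = (\<Sum>i<n. ((\<integral>x. indicator K x * x i \<partial>lebn n) - g i * vol n K) * u i)"
    using int ind by (intro sum.cong refl) (simp add: Bochner_Integration.integral_diff)
  finally show ?thesis .
qed

text \<open>If K failed to reach height d in direction u, the weak Gruenbaum inequality would
  confine it to the slab of half width L/2, and the second moment along u would be at most L^2/4
  instead of L^2. So K contains a ball of radius d, and a lower bound on L makes d large
  enough.\<close>

lemma isotropic_imp:
  assumes n: "n \<ge> 2" and K: "convex_body n K" and I: "isotropic_position n K"
  shows "\<exists>r. cbody n r K \<and> surface_area n K \<le> 128 ^ n * vol n K powr (1 - 1 / real n)"
proof -
  note Kb = convex_body_imp[OF K]
  obtain r0 where cb0: "cbody n r0 K" using convex_body_imp_cbody[OF K] by auto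
  have ne: "K \<noteq> {}" using vol_cbody_pos[OF cb0] by (auto simp: vol_def)
  have V: "vol n K = 1" using I by (simp add: isotropic_position_def)
  obtain L where L: "L > 0" "\<And>\<xi>. \<xi> \<in> usphere n \<Longrightarrow> (\<integral>x. indicator K x * (ip n x \<xi>)\<^sup>2 \<partial>lebn n) = L\<^sup>2"
    using I by (auto simp: isotropic_position_def set_lebesgue_integral_def)
  have "(\<integral>x. indicator K x * x i \<partial>lebn n) = 0" for i
  proof -
    have "barycenter n K i = 0" using I by (simp add: isotropic_position_def centered_def)
    then show ?thesis using V by (simp add: barycenter_def set_lebesgue_integral_def)
  qed
  then have cent: "(\<integral>x. indicator K x * ip n (x - 0) u \<partial>lebn n) = 0" for u
    unfolding integral_ip_compact[OF Kb(1,2)] by (simp add: fun_apply)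
  \<comment> \<open>n L^2 is the integral of the squared norm. The ball of radius 1/4 has volume at
    most 1/2, so at least half of the volume of K lies where the squared norm is at least
    1/16.\<close>
  have Lge: "1 / 32 \<le> real n * L\<^sup>2"
  proof -
    define e :: "nat \<Rightarrow> nat \<Rightarrow> real" where "e = (\<lambda>i j. if j = i then 1 else 0)"
    have ipe: "ip n x (e i) = x i" if "i < n" for x i
      using that by (simp add: ip_def e_def if_distrib cong: if_cong)
    have e: "e i \<in> usphere n" if "i < n" for i
      using that ipe[OF that, of "e i"] by (simp add: usphere_iff rspace_iff nm_eq_sqrt) (simp add: e_def)
    have sq: "(\<integral>x. indicator K x * (x i)\<^sup>2 \<partial>lebn n) = L\<^sup>2" if "i < n" for i
      using L(2)[OF e[OF that]] ipe[OF that] by simp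
    have int: "integrable (lebn n) (\<lambda>x. indicator K x * (x i)\<^sup>2)" for i
      by (intro integrable_on_compact Kb continuous_on_power continuous_on_fun_apply[OF continuous_on_id])
    let ?B = "eball n (1 / 4)"
    have vB: "vol n ?B \<le> 1 / 2"
    proof -
      have "vol n ?B \<le> (2 * (1 / 4)) ^ n" by (rule vol_eball_le) simp
      also have "\<dots> \<le> (1 / 2) ^ 1" using n by (simp, intro power_decreasing[of 1 n "1/2::real", simplified]) auto
      finally show ?thesis by simp
    qed
    note iK = integral_indicator_compact[OF Kb(1,2)] and iB = integral_indicator_compact[OF compact_eball[of n "1/4"] eball_subset_rspace]
    have "1 / 32 \<le> 1 / 16 * (vol n K - vol n ?B)" using vB V by simp
    also have "\<dots> = (\<integral>x. 1 / 16 * (indicator K x - indicator ?B x) \<partial>lebn n)"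
      using iK iB by simp
    also have "\<dots> \<le> (\<integral>x. (\<Sum>i<n. indicator K x * (x i)\<^sup>2) \<partial>lebn n)"
    proof (intro integral_mono_AE integrable_mult_right Bochner_Integration.integrable_diff iK iB Bochner_Integration.integrable_sum int)
      show "AE x in lebn n. 1 / 16 * (indicator K x - indicator ?B x) \<le> (\<Sum>i<n. indicator K x * (x i)\<^sup>2)"
        using AE_rspace
      proof eventually_elim
        case (elim x)
        have s: "(\<Sum>i<n. indicator K x * (x i)\<^sup>2) = indicator K x * ip n x x"
          by (simp add: ip_def sum_distrib_left power2_eq_square)
        show ?case
        proof (cases "x \<in> K \<and> x \<notin> ?B")
          case True
          then have "1 / 4 \<le> nm n x" using elim by (auto simp: eball_iff)
          then have "(1 / 4)\<^sup>2 \<le> (nm n x)\<^sup>2" by (intro power_mono) auto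
          then show ?thesis unfolding s using True by (simp add: ip_self power2_eq_square)
        next
          case False
          then have "indicator K x - indicator ?B x \<le> (0::real)" by (auto simp: indicator_def)
          then have "1 / 16 * (indicator K x - indicator ?B x) \<le> (0::real)" by (intro mult_nonneg_nonpos) auto
          also have "\<dots> \<le> indicator K x * ip n x x" using ip_self_nonneg by simp
          finally show ?thesis unfolding s .
        qed
      qed
    qed
    also have "\<dots> = (\<Sum>i<n. L\<^sup>2)" using int sq by (subst Bochner_Integration.integral_sum) auto
    finally show ?thesis by simp
  qed
  \<comment> \<open>Chosen so that the Gruenbaum factor 2^(n+1) times d equals L/2.\<close>
  define d where "d = L / 2 ^ (n + 2)"
  have d: "d > 0" using L by (simp add: d_def)
  have "\<exists>x\<in>K. d \<le> ip n (x - 0) u" if u: "u \<in> usphere n" for u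
  proof (rule ccontr)
    assume "\<not> ?thesis"
    then have lt: "ip n (x - 0) u \<le> d" if "x \<in> K" for x using that by (auto simp: not_le intro: less_imp_le)
    have ab: "\<bar>ip n x u\<bar> \<le> L / 2" if x: "x \<in> K" for x
    proof -
      have "d - ip n (x - 0) u \<le> 2 ^ Suc n * d" by (rule gruenbaum_weak[OF cb0 cent lt x])
      also have "2 ^ Suc n * d = L / 2" by (simp add: d_def)
      finally have "- ip n x u \<le> L / 2" using d by simp
      moreover have "d \<le> L / 2"
      proof -
        have "(2::real) \<le> 2 ^ (n + 2)" by (rule self_le_power) auto
        then have "L * 2 \<le> L * 2 ^ (n + 2)" using L by (intro mult_left_mono) auto
        then show ?thesis by (simp add: d_def field_simps)
      qed
      ultimately show ?thesis using lt[OF x] by (simp add: abs_le_iff)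
    qed
    have "L\<^sup>2 = (\<integral>x. indicator K x * (ip n x u)\<^sup>2 \<partial>lebn n)" using L(2)[OF u] by simp
    also have "\<dots> \<le> (\<integral>x. (L / 2)\<^sup>2 * indicator K x \<partial>lebn n)"
    proof (rule integral_mono)
      show "integrable (lebn n) (\<lambda>x. indicator K x * (ip n x u)\<^sup>2)"
        by (intro integrable_on_compact Kb continuous_on_power fun_cont)
      show "integrable (lebn n) (\<lambda>x. (L / 2)\<^sup>2 * indicator K x)"
        by (intro integrable_mult_right integral_indicator_compact Kb)
      fix x
      show "indicator K x * (ip n x u)\<^sup>2 \<le> (L / 2)\<^sup>2 * indicator K x"
        using ab[of x] L(1) by (auto simp: indicator_def abs_le_square_iff[symmetric] simp del: power_divide)
    qed
    also have "\<dots> = (L / 2)\<^sup>2" using integral_indicator_compact[OF Kb(1,2)] V by simp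
    finally show False using L(1) by (simp add: power_divide)
  qed
  then have "add_set {0} (eball n d) \<subseteq> K" by (intro ball_subset_if_support[OF Kb(1,3,2) ne]) auto
  then have cb: "cbody n d K" using Kb d unfolding cbody_def by (intro conjI bexI[of _ 0]) auto
  have "1 \<le> 64 ^ n * d"
  proof -
    have n2: "real n \<le> 2 ^ n" using of_nat_less_two_power[of n, where 'a=real] by linarith
    have "1 \<le> 32 * (real n * L\<^sup>2)" using Lge by simp
    also have "\<dots> \<le> 32 * (2 ^ n * L\<^sup>2)" using n2 by (intro mult_left_mono mult_right_mono) auto
    also have "32 * (2 ^ n * L\<^sup>2) = 512 * (2 ^ n * 4 ^ n) * d\<^sup>2"
    proof -
      have "(2 ^ (n + 2))\<^sup>2 = 16 * (4::real) ^ n"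
        by (simp add: power_add power_mult_distrib power_mult[symmetric] mult.commute[of n] power_mult)
      then have "L\<^sup>2 = 16 * 4 ^ n * d\<^sup>2" by (simp add: d_def power_divide)
      then show ?thesis by simp
    qed
    also have "\<dots> = 512 * 8 ^ n * d\<^sup>2" by (simp add: power_mult_distrib[symmetric])
    also have "\<dots> \<le> 512 ^ n * 8 ^ n * d\<^sup>2" using n self_le_power[of "512::real" n] by (intro mult_right_mono) auto
    also have "\<dots> = (64 ^ n * d)\<^sup>2"
    proof -
      have "(64 ^ n)\<^sup>2 = (64\<^sup>2::real) ^ n" by (simp only: power_mult[symmetric] mult.commute)
      also have "\<dots> = 512 ^ n * 8 ^ n" by (simp add: power_mult_distrib[symmetric])
      finally show ?thesis by (simp add: power_mult_distrib)
    qed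
    finally have "1\<^sup>2 \<le> (64 ^ n * d)\<^sup>2" by simp
    then show ?thesis by (rule power2_le_imp_le) (use d in simp)
  qed
  then have "surface_area n K \<le> (2 * 64) ^ n * vol n K powr (1 - 1 / real n)"
    using n V by (intro surface_area_le_if_inradius[OF _ cb]) auto
  then show ?thesis using cb by auto
qed

subsection \<open>Minimal mean width\<close>

lemma ip_le_support:
  assumes "compact K" "x \<in> K" shows "ip n x y \<le> support_fun n K y"
proof -
  have "compact ((\<lambda>x. ip n x y) ` K)" by (intro compact_continuous_image fun_cont assms)
  then have "bdd_above ((\<lambda>x. ip n x y) ` K)" by (intro bounded_imp_bdd_above compact_imp_bounded)
  then show ?thesis unfolding support_fun_def by (intro cSUP_upper assms)
qed

lemma support_attained:
  assumes "compact K" "K \<noteq> {}"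
  obtains x where "x \<in> K" "support_fun n K y = ip n x y"
proof -
  have "continuous_on K (\<lambda>x. ip n x y)" by (intro fun_cont)
  from continuous_attains_sup[OF assms this] obtain x where x: "x \<in> K" "\<And>z. z \<in> K \<Longrightarrow> ip n z y \<le> ip n x y" by auto
  have "support_fun n K y = ip n x y"
    unfolding support_fun_def by (rule cSup_eq_maximum) (use x in auto)
  then show ?thesis using that x by blast
qed

lemma support_add_le:
  assumes "compact K" "K \<noteq> {}"
  shows "support_fun n K (y + z) \<le> support_fun n K y + support_fun n K z"
proof -
  obtain x where x: "x \<in> K" "support_fun n K (y + z) = ip n x (y + z)" using support_attained[OF assms] by blast
  then show ?thesis using ip_le_support[OF assms(1) x(1), of n y] ip_le_support[OF assms(1) x(1), of n z]
    by (simp add: ip_add_right)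
qed

lemma support_scale_le:
  assumes "compact K" "K \<noteq> {}" "c \<ge> 0"
  shows "support_fun n K (c *\<^sub>R y) \<le> c * support_fun n K y"
proof -
  obtain x where x: "x \<in> K" "support_fun n K (c *\<^sub>R y) = ip n x (c *\<^sub>R y)" using support_attained[OF assms(1,2)] by blast
  then show ?thesis using mult_left_mono[OF ip_le_support[OF assms(1) x(1), of n y] assms(3)]
    by (simp add: ip_scale_right)
qed

text \<open>A supremum of continuous functions is lower semicontinuous: its strict superlevel sets
  are unions of open sets.\<close>

lemma measurable_support:
  assumes "compact K" "K \<noteq> {}" shows "support_fun n K \<in> borel_measurable borel"
  unfolding borel_measurable_iff_greater
proof
  fix a
  have "{y \<in> space borel. a < support_fun n K y} = (\<Union>x\<in>K. {y. a < ip n x y})"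
  proof (intro equalityI subsetI)
    fix y assume "y \<in> {y \<in> space borel. a < support_fun n K y}"
    moreover obtain x where "x \<in> K" "support_fun n K y = ip n x y" using support_attained[OF assms] by blast
    ultimately show "y \<in> (\<Union>x\<in>K. {y. a < ip n x y})" by (intro UN_I[of x]) simp_all
  next
    fix y assume "y \<in> (\<Union>x\<in>K. {y. a < ip n x y})"
    then obtain x where "x \<in> K" "a < ip n x y" by auto
    then show "y \<in> {y \<in> space borel. a < support_fun n K y}" using ip_le_support[OF assms(1), of x n y] by simp
  qed
  moreover have "open (\<Union>x\<in>K. {y. a < ip n x y})" by (intro open_UN ballI open_Collect_less fun_cont)
  ultimately show "{y \<in> space borel. a < support_fun n K y} \<in> sets borel" by simp
qed

lemma sphere_integrable:
  fixes f :: "(nat \<Rightarrow> real) \<Rightarrow> real"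
  assumes [measurable]: "f \<in> borel_measurable borel" and "\<And>\<theta>. \<theta> \<in> usphere n \<Longrightarrow> \<bar>f \<theta>\<bar> \<le> B"
  shows "integrable (sphere_measure n) (\<lambda>\<theta>. indicator (usphere n) \<theta> * f \<theta>)"
proof -
  interpret prob_space "sphere_measure n" by (rule prob_space_sphere_measure)
  have "\<bar>indicator (usphere n) \<theta> * f \<theta>\<bar> \<le> \<bar>B\<bar>" for \<theta>
    using assms(2)[of \<theta>] by (cases "\<theta> \<in> usphere n") auto
  then show ?thesis by (intro integrable_const_bound[of _ "\<bar>B\<bar>"]) auto
qed

text \<open>A norm-preserving homogeneous map commutes with radial normalisation, so invariance of
  Lebesgue measure passes to the sphere.\<close>

lemma distr_sphere_measure:
  fixes R :: "(nat \<Rightarrow> real) \<Rightarrow> nat \<Rightarrow> real"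
  assumes [measurable]: "R \<in> borel_measurable borel" and d: "distr (lebn n) borel R = lebn n"
    and R: "\<And>c x. R (c *\<^sub>R x) = c *\<^sub>R R x" "\<And>x. nm n (R x) = nm n x" "\<And>x. R x \<in> rspace n \<longleftrightarrow> x \<in> rspace n"
  shows "distr (sphere_measure n) borel R = sphere_measure n"
proof (rule measure_eqI)
  fix B assume "B \<in> sets (distr (sphere_measure n) borel R)"
  then have [measurable]: "B \<in> sets borel" by simp
  have R': "{x. R x \<in> B} \<in> sets borel" by measurable
  let ?A = "eball n 1 \<inter> {x. (1 / nm n x) *\<^sub>R x \<in> B}"
  have A: "?A \<in> sets borel" by measurable
  have "emeasure (distr (sphere_measure n) borel R) B = emeasure (sphere_measure n) {x. R x \<in> B}"
    by (simp add: emeasure_distr vimage_def)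
  also have "\<dots> = emeasure (lebn n) (eball n 1 \<inter> {x. (1 / nm n x) *\<^sub>R x \<in> {x. R x \<in> B}}) / emeasure (lebn n) (eball n 1)"
    by (rule emeasure_sphere_measure[OF R'])
  also have "eball n 1 \<inter> {x. (1 / nm n x) *\<^sub>R x \<in> {x. R x \<in> B}} = {x. R x \<in> ?A}"
    by (auto simp: eball_iff R)
  also have "emeasure (lebn n) {x. R x \<in> ?A} = emeasure (lebn n) ?A"
    by (rule emeasure_distr_eq[OF d _ A]) measurable
  also have "\<dots> / emeasure (lebn n) (eball n 1) = emeasure (sphere_measure n) B"
    by (rule emeasure_sphere_measure[symmetric]) measurable
  finally show "emeasure (distr (sphere_measure n) borel R) B = emeasure (sphere_measure n) B" .
qed simp

lemma sphere_integral_mirror: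
  fixes f :: "(nat \<Rightarrow> real) \<Rightarrow> real"
  assumes [measurable]: "f \<in> borel_measurable borel" and v: "v \<in> rspace n"
  shows "(\<integral>\<theta>. f (mirror n v \<theta>) \<partial>sphere_measure n) = (\<integral>\<theta>. f \<theta> \<partial>sphere_measure n)"
proof -
  have "distr (sphere_measure n) borel (mirror n v) = sphere_measure n"
  proof (rule distr_sphere_measure[OF measurable_mirror distr_mirror[OF v]])
    show "mirror n v (c *\<^sub>R x) = c *\<^sub>R mirror n v x" for c x
      by (simp add: mirror_def ip_simps algebra_simps)
    show "mirror n v x \<in> rspace n \<longleftrightarrow> x \<in> rspace n" for x
      using mirror_rspace[OF v] mirror_mirror by metis
  qed (rule nm_mirror)
  then have "(\<integral>\<theta>. f \<theta> \<partial>sphere_measure n) = (\<integral>\<theta>. f \<theta> \<partial>distr (sphere_measure n) borel (mirror n v))" by simp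
  also have "\<dots> = (\<integral>\<theta>. f (mirror n v \<theta>) \<partial>sphere_measure n)" by (rule integral_distr) measurable
  finally show ?thesis by simp
qed

lemma sphere_integral_uminus:
  fixes f :: "(nat \<Rightarrow> real) \<Rightarrow> real"
  assumes [measurable]: "f \<in> borel_measurable borel"
  shows "(\<integral>\<theta>. f (- \<theta>) \<partial>sphere_measure n) = (\<integral>\<theta>. f \<theta> \<partial>sphere_measure n)"
proof -
  have m [measurable]: "(uminus :: (nat \<Rightarrow> real) \<Rightarrow> _) \<in> borel_measurable borel" by measurable
  have "distr (lebn n) borel uminus = lebn n"
    by (rule distr_lebn_isometry[OF m m]) auto
  then have "distr (sphere_measure n) borel uminus = sphere_measure n"
  proof (rule distr_sphere_measure[OF m])
    show "- x \<in> rspace n \<longleftrightarrow> x \<in> rspace n" for x by (auto simp: rspace_iff fun_apply)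
  qed auto
  then have "(\<integral>\<theta>. f \<theta> \<partial>sphere_measure n) = (\<integral>\<theta>. f \<theta> \<partial>distr (sphere_measure n) borel uminus)" by simp
  also have "\<dots> = (\<integral>\<theta>. f (- \<theta>) \<partial>sphere_measure n)" by (rule integral_distr) measurable
  finally show ?thesis by simp
qed

lemma uminus_usphere: "- \<theta> \<in> usphere n \<longleftrightarrow> \<theta> \<in> usphere n"
  by (auto simp: usphere_iff rspace_iff fun_apply)

lemma mirror_usphere: "v \<in> rspace n \<Longrightarrow> mirror n v \<theta> \<in> usphere n \<longleftrightarrow> \<theta> \<in> usphere n"
  using mirror_rspace[of v n] mirror_mirror[of n v \<theta>] nm_mirror by (auto simp: usphere_iff) metis

lemma mean_width_eq: "mean_width n K = (\<integral>\<theta>. indicator (usphere n) \<theta> * support_fun n K \<theta> \<partial>sphere_measure n)"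
  by (simp add: mean_width_def set_lebesgue_integral_def)

lemma ip_axial_commute: "ip n (axial n \<alpha> \<beta> u x) y = ip n x (axial n \<alpha> \<beta> u y)"
  by (simp add: axial_def ip_simps ip_commute[of n u x] mult_ac)

lemma support_axial:
  "support_fun n (axial n \<alpha> \<beta> u ` K) y = support_fun n K (axial n \<alpha> \<beta> u y)"
  unfolding support_fun_def image_image ip_axial_commute ..

lemma abs_support_le:
  assumes "compact K" "K \<noteq> {}" "K \<subseteq> eball n R"
  shows "\<bar>support_fun n K y\<bar> \<le> R * nm n y"
proof -
  obtain x where x: "x \<in> K" "support_fun n K y = ip n x y" using support_attained[OF assms(1,2)] by blast
  have "\<bar>ip n x y\<bar> \<le> nm n x * nm n y" by (rule abs_ip_le)
  also have "\<dots> \<le> R * nm n y" using x assms(3) by (intro mult_right_mono) (auto simp: eball_iff)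
  finally show ?thesis using x by simp
qed

lemma integrable_support:
  assumes K: "compact K" "K \<subseteq> rspace n" "K \<noteq> {}" and f: "f \<in> borel_measurable borel"
    and B: "\<And>\<theta>. \<theta> \<in> usphere n \<Longrightarrow> nm n (f \<theta>) \<le> B"
  shows "integrable (sphere_measure n) (\<lambda>\<theta>. indicator (usphere n) \<theta> * support_fun n K (f \<theta>))"
proof -
  obtain R where R: "R > 0" "K \<subseteq> eball n R" using eball_bounds[OF K(1,2)] by blast
  show ?thesis
  proof (rule sphere_integrable[where B="R * B"])
    show "(\<lambda>\<theta>. support_fun n K (f \<theta>)) \<in> borel_measurable borel"
      using measurable_comp[OF f measurable_support[OF K(1,3)]] by (simp add: comp_def)
    fix \<theta> assume "\<theta> \<in> usphere n"
    from B[OF this] have "R * nm n (f \<theta>) \<le> R * B" using R(1) by (intro mult_left_mono) auto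
    then show "\<bar>support_fun n K (f \<theta>)\<bar> \<le> R * B" using abs_support_le[OF K(1,3) R(2), of "f \<theta>"] by linarith
  qed
qed

lemma sphere_integral_support_uminus:
  assumes "compact K" "K \<noteq> {}"
  shows "(\<integral>\<theta>. indicator (usphere n) \<theta> * support_fun n K (- \<theta>) \<partial>sphere_measure n) = mean_width n K"
proof -
  note [measurable] = measurable_support[OF assms, of n]
  show ?thesis
    using sphere_integral_uminus[of "\<lambda>\<theta>. indicator (usphere n) \<theta> * support_fun n K \<theta>" n]
    by (simp add: mean_width_eq indicator_def uminus_usphere)
qed

text \<open>By minimality, compared with the map that halves all directions orthogonal to \<open>u\<close> and stretches the
  direction \<open>u\<close>, the width \<open>h(u) + h(-u)\<close> is not much smaller than the mean width.\<close>

lemma minimal_mean_width_widths: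
  assumes K: "compact K" "K \<subseteq> rspace (Suc m)" "K \<noteq> {}" and M: "minimal_mean_width_position (Suc m) K"
    and u: "u \<in> usphere (Suc m)"
  shows "mean_width (Suc m) K \<le> 2 ^ m * (support_fun (Suc m) K u + support_fun (Suc m) K (- u))"
proof -
  let ?n = "Suc m" and ?h = "support_fun (Suc m) K"
  let ?\<sigma> = "sphere_measure ?n" and ?I = "indicator (usphere ?n) :: _ \<Rightarrow> real"
  interpret prob_space ?\<sigma> by (rule prob_space_sphere_measure)
  \<comment> \<open>Compensates the factor (1/2)^m of the halved directions, so that the map has
    determinant 1.\<close>
  define \<beta> :: real where "\<beta> = 2 ^ m"
  define f where "f = axial ?n (1 / 2) \<beta> u"
  define W where "W = ?h u + ?h (- u)"
  have ur: "u \<in> rspace ?n" using u by (simp add: usphere_iff)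
  note h [measurable] = measurable_support[OF K(1,3), of ?n]
  have [measurable]: "f \<in> borel_measurable borel" unfolding f_def axial_def by measurable
  have fb: "nm ?n (f \<theta>) \<le> 1 / 2 + \<bar>\<beta> - 1 / 2\<bar>" if "\<theta> \<in> usphere ?n" for \<theta>
  proof -
    have "nm ?n (f \<theta>) \<le> 1 / 2 * nm ?n \<theta> + \<bar>\<beta> - 1 / 2\<bar> * \<bar>ip ?n u \<theta>\<bar> * nm ?n u"
      using nm_triangle[of "(1 / 2) *\<^sub>R \<theta>" "((\<beta> - 1 / 2) * ip ?n u \<theta>) *\<^sub>R u" ?n] unfolding f_def axial_def
      by (simp add: abs_mult)
    also have "\<dots> \<le> 1 / 2 + \<bar>\<beta> - 1 / 2\<bar> * 1 * 1"
      using abs_ip_le[of ?n u \<theta>] that u by (intro add_mono mult_mono) (auto simp: usphere_iff)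
    finally show ?thesis by simp
  qed
  have W0: "W \<ge> 0"
  proof -
    obtain x where "x \<in> K" using K by blast
    then show ?thesis using ip_le_support[OF K(1), of x ?n u] ip_le_support[OF K(1), of x ?n "- u"]
      by (simp add: W_def ip_minus_right)
  qed
  have i1: "integrable ?\<sigma> (\<lambda>\<theta>. ?I \<theta> * ?h \<theta>)" "integrable ?\<sigma> (\<lambda>\<theta>. ?I \<theta> * ?h (- \<theta>))"
    "integrable ?\<sigma> (\<lambda>\<theta>. ?I \<theta> * ?h (mirror ?n u \<theta>))" "integrable ?\<sigma> (\<lambda>\<theta>. ?I \<theta> * ?h (- mirror ?n u \<theta>))"
    by (rule integrable_support[OF K, where B=1], measurable, simp add: usphere_iff nm_mirror)+
  have i2: "integrable ?\<sigma> (\<lambda>\<theta>. ?I \<theta> * ?h (f \<theta>))" "integrable ?\<sigma> (\<lambda>\<theta>. ?I \<theta> * ?h (- f \<theta>))"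
    by (rule integrable_support[OF K, where B="1 / 2 + \<bar>\<beta> - 1 / 2\<bar>"], measurable, simp add: fb)+
  let ?w = "mean_width ?n K"
  have e1: "(\<integral>\<theta>. ?I \<theta> * ?h \<theta> \<partial>?\<sigma>) = ?w" by (simp add: mean_width_eq)
  have e2: "(\<integral>\<theta>. ?I \<theta> * ?h (- \<theta>) \<partial>?\<sigma>) = ?w"
    by (rule sphere_integral_support_uminus[OF K(1,3)])
  have e3: "(\<integral>\<theta>. ?I \<theta> * ?h (mirror ?n u \<theta>) \<partial>?\<sigma>) = ?w"
    using sphere_integral_mirror[of "\<lambda>\<theta>. ?I \<theta> * ?h \<theta>" u ?n] ur e1 by (simp add: indicator_def mirror_usphere)
  have e4: "(\<integral>\<theta>. ?I \<theta> * ?h (- mirror ?n u \<theta>) \<partial>?\<sigma>) = ?w"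
    using sphere_integral_mirror[of "\<lambda>\<theta>. ?I \<theta> * ?h (- \<theta>)" u ?n] ur e2 by (simp add: indicator_def mirror_usphere)
  have wf: "(\<integral>\<theta>. ?I \<theta> * ?h (f \<theta>) \<partial>?\<sigma>) = mean_width ?n (lin ?n (axial_mat ?n (1 / 2) \<beta> u) ` K)"
    unfolding mean_width_eq lin_axial_image[OF u K(2)] support_axial f_def ..
  have fneg: "f (- \<theta>) = - f \<theta>" for \<theta> by (simp add: f_def axial_def ip_simps)
  have wf2: "(\<integral>\<theta>. ?I \<theta> * ?h (- f \<theta>) \<partial>?\<sigma>) = (\<integral>\<theta>. ?I \<theta> * ?h (f \<theta>) \<partial>?\<sigma>)"
    using sphere_integral_uminus[of "\<lambda>\<theta>. ?I \<theta> * ?h (f \<theta>)" ?n] by (simp add: indicator_def uminus_usphere fneg)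
  have pt: "?h (f \<theta>) + ?h (- f \<theta>) \<le>
      1 / 4 * (?h \<theta> + ?h (- \<theta>) + ?h (mirror ?n u \<theta>) + ?h (- mirror ?n u \<theta>)) + \<beta> * W"
    if \<theta>: "\<theta> \<in> usphere ?n" for \<theta>
  proof -
    define s where "s = ip ?n u \<theta>"
    have s1: "\<bar>s\<bar> \<le> 1" using abs_ip_le[of ?n u \<theta>] u \<theta> by (simp add: s_def usphere_iff)
    \<comment> \<open>\<theta> plus its mirror image is twice the component orthogonal to u, so half
      of that component is a quarter of the sum. Sublinearity then bounds the support function at f
      \<theta> by values at \<theta>, at its mirror image and at a multiple of u.\<close>
    have f: "f \<theta> = ((1 / 4) *\<^sub>R \<theta> + (1 / 4) *\<^sub>R mirror ?n u \<theta>) + (\<beta> * s) *\<^sub>R u"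
      unfolding f_def axial_def mirror_def s_def[symmetric] usphere_ip[OF u]
      by (rule ext) (simp add: fun_apply algebra_simps)
    then have f': "- f \<theta> = ((1 / 4) *\<^sub>R (- \<theta>) + (1 / 4) *\<^sub>R (- mirror ?n u \<theta>)) + (\<beta> * s) *\<^sub>R (- u)"
      by simp
    have three: "?h (((1 / 4) *\<^sub>R x + (1 / 4) *\<^sub>R y) + z) \<le> 1 / 4 * ?h x + 1 / 4 * ?h y + ?h z" for x y z
      using support_add_le[OF K(1,3), of ?n "(1 / 4) *\<^sub>R x + (1 / 4) *\<^sub>R y" z]
        support_add_le[OF K(1,3), of ?n "(1 / 4) *\<^sub>R x" "(1 / 4) *\<^sub>R y"]
        support_scale_le[OF K(1,3), of "1 / 4" ?n x] support_scale_le[OF K(1,3), of "1 / 4" ?n y] by simp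
    have "?h ((\<beta> * s) *\<^sub>R u) + ?h ((\<beta> * s) *\<^sub>R (- u)) \<le> \<beta> * \<bar>s\<bar> * W"
    proof (cases "s \<ge> 0")
      case True
      then show ?thesis
        using support_scale_le[OF K(1,3), of "\<beta> * s" ?n u] support_scale_le[OF K(1,3), of "\<beta> * s" ?n "- u"]
        by (simp add: \<beta>_def W_def distrib_left)
    next
      case False
      have "(\<beta> * s) *\<^sub>R u = (\<beta> * - s) *\<^sub>R (- u)" "(\<beta> * s) *\<^sub>R (- u) = (\<beta> * - s) *\<^sub>R u" by simp_all
      moreover have c: "0 \<le> \<beta> * - s" using False by (intro mult_nonneg_nonneg) (auto simp: \<beta>_def)
      ultimately have "?h ((\<beta> * s) *\<^sub>R u) + ?h ((\<beta> * s) *\<^sub>R (- u)) \<le> (\<beta> * - s) * ?h (- u) + (\<beta> * - s) * ?h u"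
        using support_scale_le[OF K(1,3) c, of ?n u] support_scale_le[OF K(1,3) c, of ?n "- u"] by simp
      then show ?thesis using False by (simp add: W_def algebra_simps)
    qed
    also have "\<dots> \<le> \<beta> * 1 * W" using s1 W0 by (intro mult_right_mono mult_left_mono) (auto simp: \<beta>_def)
    finally have "?h ((\<beta> * s) *\<^sub>R u) + ?h ((\<beta> * s) *\<^sub>R (- u)) \<le> \<beta> * W" by simp
    moreover have "?h (f \<theta>) \<le> 1 / 4 * ?h \<theta> + 1 / 4 * ?h (mirror ?n u \<theta>) + ?h ((\<beta> * s) *\<^sub>R u)"
      unfolding f by (rule three)
    moreover have "?h (- f \<theta>) \<le> 1 / 4 * ?h (- \<theta>) + 1 / 4 * ?h (- mirror ?n u \<theta>) + ?h ((\<beta> * s) *\<^sub>R (- u))"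
      unfolding f' by (rule three)
    ultimately show ?thesis by argo
  qed
  \<comment> \<open>Each of the four support terms integrates to the mean width w, by invariance
    under reflections and sign change. Averaging thus gives 2 w(fK) \<le> w + \<beta> W, and w \<le>
    w(fK) turns this into w \<le> \<beta> W.\<close>
  have "2 * (\<integral>\<theta>. ?I \<theta> * ?h (f \<theta>) \<partial>?\<sigma>) = (\<integral>\<theta>. ?I \<theta> * ?h (f \<theta>) + ?I \<theta> * ?h (- f \<theta>) \<partial>?\<sigma>)"
    using i2 wf2 by simp
  also have "\<dots> \<le> (\<integral>\<theta>. 1 / 4 * (?I \<theta> * ?h \<theta> + ?I \<theta> * ?h (- \<theta>) + ?I \<theta> * ?h (mirror ?n u \<theta>) + ?I \<theta> * ?h (- mirror ?n u \<theta>)) + \<beta> * W \<partial>?\<sigma>)"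
  proof (intro integral_mono Bochner_Integration.integrable_add i1 i2 integrable_mult_right integrable_const)
    fix \<theta>
    show "?I \<theta> * ?h (f \<theta>) + ?I \<theta> * ?h (- f \<theta>) \<le>
       1 / 4 * (?I \<theta> * ?h \<theta> + ?I \<theta> * ?h (- \<theta>) + ?I \<theta> * ?h (mirror ?n u \<theta>) + ?I \<theta> * ?h (- mirror ?n u \<theta>)) + \<beta> * W"
      using pt[of \<theta>] W0 by (cases "\<theta> \<in> usphere ?n") (auto simp: \<beta>_def)
  qed
  also have "\<dots> = ?w + \<beta> * W"
    using i1 e1 e2 e3 e4 prob_space by simp
  finally have "2 * mean_width ?n (lin ?n (axial_mat ?n (1 / 2) \<beta> u) ` K) \<le> ?w + \<beta> * W" unfolding wf .
  moreover have "axial_mat ?n (1 / 2) \<beta> u \<in> SL ?n"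
    unfolding SL_def using det_axial[OF u, of "1 / 2" \<beta>] by (simp add: \<beta>_def power_mult_distrib[symmetric])
  then have "?w \<le> mean_width ?n (lin ?n (axial_mat ?n (1 / 2) \<beta> u) ` K)"
    using M by (simp add: minimal_mean_width_position_def)
  ultimately show ?thesis by (simp add: \<beta>_def W_def)
qed

text \<open>The width h(\<theta>) + h(-\<theta>) is at least the modulus of the component of x - y
  along \<theta>, and on a set of directions of measure at least 1/2 this is at least |x - y| / (4
  sqrt n).\<close>

lemma diameter_le_mean_width:
  assumes m: "m \<ge> 1" and K: "compact K" "K \<subseteq> rspace (Suc m)" and xy: "x \<in> K" "y \<in> K"
  shows "nm (Suc m) (x - y) \<le> 16 * sqrt (real (Suc m)) * mean_width (Suc m) K"
proof -
  let ?n = "Suc m" and ?h = "support_fun (Suc m) K"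
  let ?\<sigma> = "sphere_measure ?n" and ?I = "indicator (usphere ?n) :: _ \<Rightarrow> real"
  interpret prob_space ?\<sigma> by (rule prob_space_sphere_measure)
  have ne: "K \<noteq> {}" using xy by auto
  have i: "integrable ?\<sigma> (\<lambda>\<theta>. ?I \<theta> * ?h \<theta>)" "integrable ?\<sigma> (\<lambda>\<theta>. ?I \<theta> * ?h (- \<theta>))"
    by (rule integrable_support[OF K ne, where B=1], measurable, simp add: usphere_iff)+
  have two: "2 * mean_width ?n K = (\<integral>\<theta>. ?I \<theta> * (?h \<theta> + ?h (- \<theta>)) \<partial>?\<sigma>)"
    using i sphere_integral_support_uminus[OF K(1) ne, of ?n] by (simp add: mean_width_eq distrib_left)
  have ge: "\<bar>ip ?n (x - y) \<theta>\<bar> \<le> ?h \<theta> + ?h (- \<theta>)" for \<theta>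
    using ip_le_support[OF K(1) xy(1), of ?n \<theta>] ip_le_support[OF K(1) xy(1), of ?n "- \<theta>"]
      ip_le_support[OF K(1) xy(2), of ?n \<theta>] ip_le_support[OF K(1) xy(2), of ?n "- \<theta>"]
    by (simp add: ip_simps)
  have xyr: "x - y \<in> rspace ?n" using xy K by auto
  show ?thesis
  proof (cases "x = y")
    case True
    have "0 \<le> 2 * mean_width ?n K" unfolding two
    proof (rule integral_nonneg_AE, rule AE_I2)
      fix \<theta> show "0 \<le> ?I \<theta> * (?h \<theta> + ?h (- \<theta>))" using ge[of \<theta>] by simp
    qed
    then show ?thesis using True by simp
  next
    case False
    let ?D = "nm ?n (x - y)"
    define t where "t = 1 / (4 * sqrt (real ?n))"
    have \<nu>: "(1 / ?D) *\<^sub>R (x - y) \<in> usphere ?n" using xyr False by (intro normalize_usphere) auto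
    let ?G = "{\<xi> \<in> usphere ?n. t \<le> \<bar>ip ?n ((1 / ?D) *\<^sub>R (x - y)) \<xi>\<bar>}"
    have Dp: "?D > 0" using nm_eq_0[OF xyr] False L2_set_nonneg[of "x - y" "{..<?n}"] by (auto simp: less_le)
    have [measurable]: "?G \<in> sets borel" by measurable
    have "?D * t * (1 / 2) \<le> ?D * t * measure ?\<sigma> ?G"
      using sphere_measure_cap_ge[OF m \<nu>] Dp unfolding t_def by (intro mult_left_mono) auto
    also have "\<dots> = (\<integral>\<theta>. ?D * t * indicator ?G \<theta> \<partial>?\<sigma>)" by simp
    also have "\<dots> \<le> 2 * mean_width ?n K" unfolding two
    proof (rule integral_mono)
      show "integrable ?\<sigma> (\<lambda>\<theta>. ?D * t * indicator ?G \<theta>)"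
        by (intro integrable_mult_right integrable_real_indicator) (auto simp: emeasure_eq_measure)
      show "integrable ?\<sigma> (\<lambda>\<theta>. ?I \<theta> * (?h \<theta> + ?h (- \<theta>)))" using i by (simp add: distrib_left)
      fix \<theta>
      show "?D * t * indicator ?G \<theta> \<le> ?I \<theta> * (?h \<theta> + ?h (- \<theta>))"
      proof (cases "\<theta> \<in> ?G")
        case True
        then have "t \<le> \<bar>ip ?n (x - y) \<theta>\<bar> / ?D" using Dp by (simp add: ip_scale_left abs_mult)
        then have "?D * t \<le> \<bar>ip ?n (x - y) \<theta>\<bar>" using Dp by (simp add: le_divide_eq mult.commute)
        then show ?thesis using True ge[of \<theta>] by auto
      next
        case False
        have "0 \<le> ?I \<theta> * (?h \<theta> + ?h (- \<theta>))" using ge[of \<theta>] by simp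
        then show ?thesis using False by simp
      qed
    qed
    finally have "?D / (8 * sqrt (real ?n)) \<le> 2 * mean_width ?n K" by (simp add: t_def)
    then show ?thesis by (simp add: divide_le_eq mult_ac)
  qed
qed

text \<open>Volume is controlled by the diameter, the diameter by the mean width, and the mean width
  by every single width up to an exponential factor. Since a width does not say on which side of the
  barycenter it lies, the weak Gruenbaum inequality is used to bound both sides from below.\<close>

lemma minimal_mean_width_imp:
  assumes n: "n \<ge> 2" and K: "convex_body n K" and M: "minimal_mean_width_position n K"
  shows "\<exists>r. cbody n r K \<and> surface_area n K \<le> 128 ^ n * vol n K powr (1 - 1 / real n)"
proof -
  obtain m where nm: "n = Suc m" and m: "m \<ge> 1" using n by (cases n) auto
  let ?n = "Suc m" and ?h = "support_fun (Suc m) K"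
  note Kb = convex_body_imp[OF K[unfolded nm]]
  obtain r0 where cb0: "cbody ?n r0 K" using convex_body_imp_cbody[OF K] nm by auto
  have V: "vol ?n K > 0" by (rule vol_cbody_pos[OF cb0])
  have ne: "K \<noteq> {}" using V by (auto simp: vol_def)
  then obtain x0 where x0: "x0 \<in> K" by blast
  let ?w = "mean_width ?n K"
  have "nm ?n (x - x0) \<le> 16 * sqrt (real ?n) * ?w" if "x \<in> K" for x
    by (rule diameter_le_mean_width[OF m Kb(1,2) that x0])
  then have "K \<subseteq> add_set {x0} (eball ?n (16 * sqrt (real ?n) * ?w))"
  proof (intro subsetI)
    fix x assume H: "\<And>x. x \<in> K \<Longrightarrow> nm ?n (x - x0) \<le> 16 * sqrt (real ?n) * ?w" and x: "x \<in> K"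
    have "x - x0 \<in> rspace ?n" using x x0 Kb(2) by auto
    then have "x - x0 \<in> eball ?n (16 * sqrt (real ?n) * ?w)" using H[OF x] by (simp add: eball_iff)
    then show "x \<in> add_set {x0} (eball ?n (16 * sqrt (real ?n) * ?w))"
      using add_setI[of x0 "{x0}" "x - x0"] by simp
  qed
  moreover have "0 \<le> 16 * sqrt (real ?n) * ?w" using diameter_le_mean_width[OF m Kb(1,2) x0 x0] by simp
  ultimately have root: "vol ?n K powr (1 / real ?n) \<le> 2 * (16 * sqrt (real ?n) * ?w)"
    using x0 Kb(2) by (intro vol_root_le_if_subset_ball[OF _ cbodyD(5)[OF cb0]]) auto
  have "0 < vol ?n K powr (1 / real ?n)" using V by simp
  then have "0 < 2 * (16 * sqrt (real ?n) * ?w)" using root by linarith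
  then have w: "?w > 0" by (simp add: zero_less_mult_iff)
  define g where "g = barycenter ?n K"
  have g: "g i * vol ?n K = (\<integral>x. indicator K x * x i \<partial>lebn ?n)" for i
    using V by (simp add: g_def barycenter_def set_lebesgue_integral_def)
  have gr: "g \<in> rspace ?n"
  proof (rule rspaceI)
    fix i assume "i \<ge> ?n"
    then have "indicator K x * x i = (0::real)" for x using Kb(2) rspaceD[of x ?n i] by (auto simp: indicator_def)
    then have z: "(\<lambda>x. indicator K x * x i) = (\<lambda>_. 0::real)" by (intro ext)
    show "g i = 0" using g[of i] V unfolding z by simp
  qed
  have cent: "(\<integral>x. indicator K x * ip ?n (x - g) u \<partial>lebn ?n) = 0" for u
    unfolding integral_ip_compact[OF Kb(1,2)] g by simp
  \<comment> \<open>The width bound costs 2^m and the Gruenbaum inequality 2^(n+1); with this d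
    their product with d is w/2, which contradicts the width bound.\<close>
  define d where "d = ?w / 2 ^ (m + ?n + 2)"
  have d: "d > 0" using w by (simp add: d_def)
  have "\<exists>x\<in>K. d \<le> ip ?n (x - g) u" if u: "u \<in> usphere ?n" for u
  proof (rule ccontr)
    assume "\<not> ?thesis"
    then have lt: "ip ?n (x - g) u \<le> d" if "x \<in> K" for x using that by (auto simp: not_le intro: less_imp_le)
    obtain x where x: "x \<in> K" "?h u = ip ?n x u" using support_attained[OF Kb(1) ne] by blast
    obtain y where y: "y \<in> K" "?h (- u) = ip ?n y (- u)" using support_attained[OF Kb(1) ne] by blast
    have "?h u + ?h (- u) = ip ?n (x - g) u - ip ?n (y - g) u" using x y by (simp add: ip_simps)
    also have "\<dots> \<le> d - ip ?n (y - g) u" using lt[OF x(1)] by simp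
    also have "\<dots> \<le> 2 ^ Suc ?n * d" by (rule gruenbaum_weak[OF cb0 cent lt y(1)])
    finally have "2 ^ m * (?h u + ?h (- u)) \<le> 2 ^ m * (2 ^ Suc ?n * d)" by simp
    also have "\<dots> = ?w / 2" by (simp add: d_def power_add)
    finally show False using minimal_mean_width_widths[OF Kb(1,2) ne M[unfolded nm] u] w by linarith
  qed
  then have "add_set {g} (eball ?n d) \<subseteq> K" by (intro ball_subset_if_support[OF Kb(1,3,2) ne gr])
  then have cb: "cbody ?n d K" using Kb d gr unfolding cbody_def by blast
  note root
  also have "2 * (16 * sqrt (real ?n) * ?w) = 32 * sqrt (real ?n) * ?w" by simp
  also have "\<dots> \<le> 32 * 2 ^ ?n * ?w"
  proof -
    have "sqrt (real ?n) \<le> real ?n" by (rule real_le_lsqrt[THEN order_trans[rotated]]) (auto simp: power2_eq_square)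
    also have "\<dots> \<le> 2 ^ ?n" using of_nat_less_two_power[of ?n, where 'a=real] by linarith
    finally show ?thesis using w by (intro mult_right_mono mult_left_mono) auto
  qed
  also have "\<dots> = 64 * (2 ^ ?n * 4 ^ ?n) * d"
  proof -
    have "(4::real) ^ ?n = 2 ^ ?n * 2 ^ ?n" by (simp add: power_mult_distrib[symmetric])
    then show ?thesis by (simp add: d_def power_add)
  qed
  also have "2 ^ ?n * 4 ^ ?n = (8::real) ^ ?n" by (simp add: power_mult_distrib[symmetric])
  also have "64 * 8 ^ ?n * d \<le> 8 ^ ?n * 8 ^ ?n * d"
  proof (intro mult_right_mono)
    have "(8::real) ^ 2 \<le> 8 ^ ?n" using m by (intro power_increasing) auto
    then show "(64::real) \<le> 8 ^ ?n" by simp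
  qed (use d in auto)
  also have "\<dots> = 64 ^ ?n * d" by (simp add: power_mult_distrib[symmetric])
  finally have "surface_area ?n K \<le> (2 * 64) ^ ?n * vol ?n K powr (1 - 1 / real ?n)"
    by (intro surface_area_le_if_inradius[OF _ cb]) auto
  then show ?thesis using cb unfolding nm by auto
qed

theorem theorem4p12:
  shows "\<exists>c5::real. c5 > 0 \<and>
    (\<forall>n\<ge>2. \<forall>K. convex_body n K \<longrightarrow>
       minimal_surface_area_position n K \<or> minimal_mean_width_position n K \<or>
       isotropic_position n K \<or> john_position n K \<or> loewner_position n K \<longrightarrow>
       vol n K powr (1 / real n) *
         (LINT \<xi>:usphere n|sphere_measure n. surface_area_perp n \<xi> (proj n \<xi> ` K))
       \<ge> c5 * surface_area n K)"
proof (intro exI[of _ "1 / (32 * 128\<^sup>2)"] conjI allI impI)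
  fix n K
  assume n: "n \<ge> 2" and K: "convex_body n K" and
    "minimal_surface_area_position n K \<or> minimal_mean_width_position n K \<or>
       isotropic_position n K \<or> john_position n K \<or> loewner_position n K"
  then obtain r where "cbody n r K" "surface_area n K \<le> 128 ^ n * vol n K powr (1 - 1 / real n)"
    using minimal_surface_area_imp[OF n K] minimal_mean_width_imp[OF n K] isotropic_imp[OF n K]
      john_imp[OF n K] loewner_imp[OF n K] by blast
  \<comment> \<open>Used with C = 128. The 32 comes from the mean projection bound, whose sqrt n is
    cancelled by the isoperimetric factor 2 sqrt m; the square comes from n/m \<le> 2.\<close>
  from mean_surface_area_ge[OF n this(1) _ this(2)]
  show "1 / (32 * 128\<^sup>2) * surface_area n K \<le> vol n K powr (1 / real n) *
         (LINT \<xi>:usphere n|sphere_measure n. surface_area_perp n \<xi> (proj n \<xi> ` K))" by simp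
qed simp

end
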